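(* Fix $t>0$ and a compact interval $K\subset(0,\alpha_c)$, where $\alpha_c=\frac{3\sqrt3}2$. Uniformly for $\alpha\in K$, as $\varepsilon\downarrow0$, $$m_\varepsilon(\alpha)=\frac{L_\varepsilon}{\kappa(\alpha)}-\frac{\log L_\varepsilon}{2\kappa(\alpha)}+O(1),\qquad L_\varepsilon:=\log\frac1\varepsilon .$$ In particular, $$\lim_{\varepsilon\downarrow0}\frac{m_\varepsilon(\alpha)}{\log(1/\varepsilon)}=\frac1{\kappa(\alpha)} .$$
   Context: For $q>0$ and an integer $m\ge0$, $\mathcal R_m(q)=\left\{\frac{P_m(z)}{(q-z)^m}:\ P_m\text{ a polynomial},\ \deg P_m\le m\right\}$, and for $t>0$, $$\mathcal E_m^{\rm rat}(t,q)=\inf_{r\in\mathcal R_m(q)}\ \sup_{z\le0}|e^{tz}-r(z)| .$$ For $0<\alpha<\alpha_c$, $\zeta_\alpha$ is the unique root of $\alpha(\zeta^3-\zeta)+1=0$ in the open first quadrant, $H_e(\alpha)=\left|\frac{\zeta_\alpha-1}{\zeta_\alpha+1}\right|\exp\bigl(\alpha\operatorname{Re}(\zeta_\alpha^2)\bigr)\in(0,1)$, and $\kappa(\alpha)=-\log H_e(\alpha)>0$. For $\alpha\in(0,\alpha_c)$ put $q_m(\alpha)=\alpha m/t$ and $$m_\varepsilon(\alpha)=\min\left\{m\in\mathbb N:\ \mathcal E_m^{\rm rat}(t,q_m(\alpha))\le\varepsilon\right\},\qquad \mathbb N=\{1,2,3,\dots\}$$ (the set is nonempty for all sufficiently small $\varepsilon>0$).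 *)

theory Defs
  imports "HOL-Analysis.Analysis" "HOL-Computational_Algebra.Polynomial"
begin

definition rat_class :: "nat \<Rightarrow> real \<Rightarrow> (complex \<Rightarrow> complex) set" where
  "rat_class m q = {\<lambda>z. poly P z / (of_real q - z) ^ m | P. degree P \<le> m}"

text \<open>For \<open>q > 0\<close> the error of each member of the class is bounded on the negative
  half-line (lemma \<open>bdd_above_rat_error\<close> below), so the real-valued supremum is the true one.\<close>

definition rat_error :: "nat \<Rightarrow> real \<Rightarrow> real \<Rightarrow> real" where
  "rat_error m t q =
     (INF r\<in>rat_class m q. SUP x\<in>{..0::real}. cmod (exp (of_real (t * x)) - r (of_real x)))"

lemma bdd_above_rat_error:
  assumes "q > 0" "t > 0" "r \<in> rat_class m q"
  shows "bdd_above ((\<lambda>x. cmod (exp (of_real (t * x)) - r (of_real x))) ` {..0::real})"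
proof -
  obtain P where P: "degree P \<le> m" and r: "r = (\<lambda>z. poly P z / (of_real q - z) ^ m)"
    using assms(3) by (auto simp: rat_class_def)
  define B where "B = (\<Sum>i\<le>degree P. cmod (coeff P i) / q ^ (m - i))"
  have "cmod (exp (of_real (t * x)) - r (of_real x)) \<le> 1 + B" if x: "x \<le> 0" for x :: real
  proof -
    have pos: "q - x > 0" using assms x by simp
    have n: "cmod (of_real q - of_real x) = q - x"
      using pos by (metis abs_of_pos norm_of_real of_real_diff)
    have term_le: "cmod (coeff P i * of_real x ^ i) / (q - x) ^ m \<le> cmod (coeff P i) / q ^ (m - i)"
      if i: "i \<le> degree P" for i
    proof -
      have m: "m = i + (m - i)" using i P by simp
      have "cmod (coeff P i * of_real x ^ i) / (q - x) ^ m
          = cmod (coeff P i) * (\<bar>x\<bar> / (q - x)) ^ i * (1 / (q - x) ^ (m - i))"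
        by (subst m) (simp add: norm_mult norm_power power_add power_divide)
      also have "\<dots> \<le> cmod (coeff P i) * 1 * (1 / q ^ (m - i))"
      proof (intro mult_mono)
        show "(\<bar>x\<bar> / (q - x)) ^ i \<le> 1"
          using pos x assms by (intro power_le_one) (auto simp: divide_simps)
        show "1 / (q - x) ^ (m - i) \<le> 1 / q ^ (m - i)"
          using pos x assms by (intro divide_left_mono power_mono mult_pos_pos) auto
      qed (use pos in auto)
      finally show ?thesis by simp
    qed
    have "cmod (r (of_real x)) = cmod (\<Sum>i\<le>degree P. coeff P i * of_real x ^ i) / (q - x) ^ m"
      by (simp add: r norm_divide norm_power n poly_altdef)
    also have "\<dots> \<le> (\<Sum>i\<le>degree P. cmod (coeff P i * of_real x ^ i)) / (q - x) ^ m"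
      using pos by (intro divide_right_mono norm_sum) auto
    also have "\<dots> \<le> B"
      unfolding B_def sum_divide_distrib by (intro sum_mono term_le) auto
    finally have "cmod (r (of_real x)) \<le> B" .
    moreover have "cmod (exp (of_real (t * x))) \<le> 1"
      using assms x by (simp add: mult_nonneg_nonpos)
    ultimately show ?thesis
      using norm_triangle_ineq4[of "exp (of_real (t * x))" "r (of_real x)"] by linarith
  qed
  then show ?thesis by (intro bdd_aboveI[of _ "1 + B"]) auto
qed

definition alpha_c :: real where
  "alpha_c = 3 * sqrt 3 / 2"

definition zeta :: "real \<Rightarrow> complex" where
  "zeta \<alpha> = (THE z. of_real \<alpha> * (z ^ 3 - z) + 1 = 0 \<and> Re z > 0 \<and> Im z > 0)"

definition H_e :: "real \<Rightarrow> real" where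
  "H_e \<alpha> = cmod ((zeta \<alpha> - 1) / (zeta \<alpha> + 1)) * exp (\<alpha> * Re ((zeta \<alpha>)\<^sup>2))"

definition kappa :: "real \<Rightarrow> real" where
  "kappa \<alpha> = - ln (H_e \<alpha>)"

definition q_pole :: "real \<Rightarrow> real \<Rightarrow> nat \<Rightarrow> real" where
  "q_pole t \<alpha> m = \<alpha> * real m / t"

definition m_min :: "real \<Rightarrow> real \<Rightarrow> real \<Rightarrow> nat" where
  "m_min t \<alpha> \<epsilon> = (LEAST m. m \<ge> 1 \<and> rat_error m t (q_pole t \<alpha> m) \<le> \<epsilon>)"

end

theory Submission
  imports Defs "HOL-Complex_Analysis.Complex_Analysis" "HOL-Probability.Probability" "HOL-Real_Asymp.Real_Asymp"
begin

text \<open>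
  Substituting \<open>x = - q T\<close> with \<open>q = \<alpha> m / t\<close> turns the problem into the approximation of
  \<open>exp (- \<alpha> m T)\<close>, \<open>T \<ge> 0\<close>, by \<open>p(T) / (1 + T)^m\<close> with \<open>deg p \<le> m\<close>; the time \<open>t\<close> disappears. With \<open>T = - \<zeta>\<^sup>2\<close>,
  \<open>\<zeta>\<close> imaginary, the function is \<open>exp (\<alpha> m \<zeta>\<^sup>2)\<close>, and the Cayley transform \<open>w(\<zeta>) = (1 - \<zeta>) / (1 + \<zeta>)\<close> carries the
  imaginary axis to the unit circle, where the approximants become the polynomials of degree at most \<open>m\<close> in
  \<open>w + 1 / w\<close>. This is Chebyshev approximation, whose error is governed by the integrals of
  \<open>exp (\<alpha> m \<zeta>\<^sup>2) w(\<zeta>)^m = (w(\<zeta>) exp (\<alpha> \<zeta>\<^sup>2))^m\<close> over vertical lines. The saddle points of \<open>w(\<zeta>) exp (\<alpha> \<zeta>\<^sup>2)\<close> are the roots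
  of \<open>\<alpha> (\<zeta>\<^sup>3 - \<zeta>) + 1 = 0\<close>, and below \<open>alpha_c\<close> two of them form a conjugate pair in the right half plane,
  \<open>\<zeta>\<^sub>\<alpha> = \<xi> + i h\<close> with \<open>h\<^sup>2 = 3 \<xi>\<^sup>2 - 1\<close>. All functions of \<open>\<alpha>\<close> are written as functions of \<open>\<xi>\<close>, since \<open>\<alpha>\<close> is
  rational in \<open>\<xi>\<close> and uniformity in \<open>\<alpha>\<close> then becomes compactness of a \<open>\<xi>\<close>-interval.

  The heart of the matter is that the vertical line through \<open>\<zeta>\<^sub>\<alpha>\<close> is already a good contour: on it the
  modulus of \<open>w exp (\<alpha> \<zeta>\<^sup>2)\<close> is at most \<open>H_e(\<alpha>)\<close> times a Gaussian in the distance to the two saddle points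
  (\<open>level_line_gaussian_bound\<close>), with explicit constants. Hence the integrals have size \<open>H_e(\<alpha>)^m / sqrt m\<close>,
  and the whole theorem rests on showing that the error is of this exact order, uniformly in \<open>\<alpha>\<close>
  (\<open>rat_error_two_sided\<close>).

  \<^item> Upper bound (\<open>rat_error_upper_uniform\<close>): interpolation at Chebyshev nodes; Hermite's contour formula writes
    the error as an integral over the line.
  \<^item> Lower bound for large \<open>m\<close> (\<open>rat_error_lower_large\<close>): a linear functional of bounded norm that kills the
    approximants. The two saddle points contribute oscillating terms that could cancel, so the functional
    is built with a factor vanishing at the lower saddle point; Laplace's method at the upper one then gives a
    nonzero limit. Uniformity comes from carrying out the limit along sequences in which \<open>\<alpha>\<close> moves with \<open>m\<close>.
  \<^item> Lower bound for the finitely many remaining \<open>m\<close> (\<open>rat_error_lower_small\<close>): as \<open>T \<rightarrow> \<infinity>\<close> the exponential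
    decays faster than every power of \<open>1 / (1 + T)\<close>, which finite differences detect.

  Solving \<open>\<kappa> m + ln m / 2 = L + O(1)\<close> for \<open>m\<close> (\<open>least_below_tolerance\<close>) gives the expansion of the least degree.
\<close>

section \<open>Integrals over vertical lines\<close>

lemma truncated_integral_tendsto:
  fixes f :: "real \<Rightarrow> complex"
  assumes "integrable lborel f"
  shows "(\<lambda>n. integral {- real n..real n} f) \<longlonglongrightarrow> integral\<^sup>L lborel f"
proof -
  have "(\<lambda>n. \<integral>x. indicator {- real n..real n} x *\<^sub>R f x \<partial>lborel) \<longlonglongrightarrow> integral\<^sup>L lborel f"
  proof (rule integral_dominated_convergence[where w = "\<lambda>x. norm (f x)"])
    show "AE x in lborel. (\<lambda>n. indicator {- real n..real n} x *\<^sub>R f x) \<longlonglongrightarrow> f x"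
    proof (rule AE_I2)
      fix x :: real
      have "\<forall>\<^sub>F n in sequentially. indicator {- real n..real n} x *\<^sub>R f x = f x"
        using eventually_ge_at_top[of "nat \<lceil>\<bar>x\<bar>\<rceil>"]
        by eventually_elim (auto simp: indicator_def nat_le_iff ceiling_le_iff abs_le_iff)
      then show "(\<lambda>n. indicator {- real n..real n} x *\<^sub>R f x) \<longlonglongrightarrow> f x"
        by (rule tendsto_eventually)
    qed
  qed (use assms(1) in \<open>auto simp: indicator_def\<close>)
  moreover have "(\<integral>x. indicator {- real n..real n} x *\<^sub>R f x \<partial>lborel) = integral {- real n..real n} f" for n
  proof -
    have "set_integrable lborel {- real n..real n} f"
      using assms(1) by (simp add: integrable_mult_indicator set_integrable_def)
    from set_borel_integral_eq_integral(2)[OF this] show ?thesis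
      by (simp add: set_lebesgue_integral_def)
  qed
  ultimately show ?thesis by simp
qed

lemma integral_eq_lim_truncations:
  fixes f :: "real \<Rightarrow> complex"
  assumes "integrable lborel f"
    and "\<And>n. (f has_integral I n) {- real n..real n}"
    and "I \<longlonglongrightarrow> L"
  shows "integral\<^sup>L lborel f = L"
  using LIMSEQ_unique[OF truncated_integral_tendsto[OF assms(1)]] assms(3)
  by (simp add: integral_unique[OF assms(2)])

text \<open>
  Contours enter only as rectangles with two vertical sides: when the integrand is small on the horizontal
  sides, what remains is a difference of two integrals over vertical lines.
\<close>

lemma rectangle_contour_bound:
  assumes "c1 < c2" "n > 0"
    and I: "(F has_contour_integral I) (rectpath (Complex c1 (-n)) (Complex c2 n))"
    and B: "\<And>z. c1 \<le> Re z \<Longrightarrow> Re z \<le> c2 \<Longrightarrow> \<bar>Im z\<bar> = n \<Longrightarrow> cmod (F z) \<le> B"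
  shows "cmod (I - \<i> * (integral {-n..n} (\<lambda>y. F (Complex c2 y)) - integral {-n..n} (\<lambda>y. F (Complex c1 y))))
           \<le> 2 * (c2 - c1) * B"
proof -
  let ?a1 = "Complex c1 (-n)" and ?a2 = "Complex c2 (-n)" and ?a3 = "Complex c2 n" and ?a4 = "Complex c1 n"
  have B0: "0 \<le> B" using B[of ?a3] assms(1,2) norm_ge_zero[of "F ?a3"] by (simp del: norm_ge_zero)
  have "F contour_integrable_on rectpath ?a1 ?a3"
    using I by (auto simp: contour_integrable_on_def)
  then have int: "F contour_integrable_on linepath ?a1 ?a2" "F contour_integrable_on linepath ?a2 ?a3"
    "F contour_integrable_on linepath ?a3 ?a4" "F contour_integrable_on linepath ?a4 ?a1"
    by (auto simp: rectpath_def Let_def)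
  have Ieq: "I = contour_integral (linepath ?a1 ?a2) F + contour_integral (linepath ?a2 ?a3) F
      + contour_integral (linepath ?a3 ?a4) F + contour_integral (linepath ?a4 ?a1) F"
    using contour_integral_unique[OF I] int by (simp add: rectpath_def Let_def add.assoc)
  have h1: "cmod (contour_integral (linepath ?a1 ?a2) F) \<le> B * norm (?a2 - ?a1)"
    by (rule contour_integral_bound_linepath[OF int(1) B0 B]) (use assms in \<open>auto simp: closed_segment_same_Im closed_segment_eq_real_ivl\<close>)
  have h2: "cmod (contour_integral (linepath ?a3 ?a4) F) \<le> B * norm (?a4 - ?a3)"
    by (rule contour_integral_bound_linepath[OF int(3) B0 B]) (use assms in \<open>auto simp: closed_segment_same_Im closed_segment_eq_real_ivl\<close>)
  have n1: "norm (?a2 - ?a1) = c2 - c1" "norm (?a4 - ?a3) = c2 - c1"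
    using assms by (auto simp: cmod_def)
  have vert: "contour_integral (linepath (Complex c (-n)) (Complex c n)) F = \<i> * integral {-n..n} (\<lambda>y. F (Complex c y))"
    if "F contour_integrable_on linepath (Complex c (-n)) (Complex c n)" for c
  proof -
    have "(F has_contour_integral contour_integral (linepath (Complex c (-n)) (Complex c n)) F) (linepath (Complex c (-n)) (Complex c n))"
      using that by (rule has_contour_integral_integral)
    then have "((\<lambda>x. F (Complex c x)) has_integral (-\<i> * contour_integral (linepath (Complex c (-n)) (Complex c n)) F)) {-n..n}"
      using assms(2) by (subst (asm) has_contour_integral_linepath_same_Re_iff[where c=c and a="-n" and b=n]) auto
    from integral_unique[OF this] show ?thesis by simp
  qed
  have rev: "F contour_integrable_on linepath ?a1 ?a4"
    using int(4) contour_integrable_reversepath_eq[of "linepath ?a1 ?a4" F] by simp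
  have "contour_integral (linepath ?a4 ?a1) F = - contour_integral (linepath ?a1 ?a4) F"
    by (metis contour_integral_reversepath reversepath_linepath valid_path_linepath)
  with Ieq vert[OF int(2)] vert[OF rev] have
    "I - \<i> * (integral {-n..n} (\<lambda>y. F (Complex c2 y)) - integral {-n..n} (\<lambda>y. F (Complex c1 y)))
     = contour_integral (linepath ?a1 ?a2) F + contour_integral (linepath ?a3 ?a4) F"
    by (simp add: algebra_simps)
  also have "cmod \<dots> \<le> B * (c2 - c1) + B * (c2 - c1)"
    using norm_triangle_le[OF add_mono[OF h1 h2]] n1 by simp
  finally show ?thesis by (simp add: algebra_simps)
qed

text \<open>
  The limit of tall rectangles. With \<open>I = 0\<close> it shifts a line of integration; with \<open>I\<close> a residue it is Cauchy's
  formula for a strip.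
\<close>

lemma contour_vertical_lines:
  assumes "c1 < c2"
    and I: "\<forall>\<^sub>F n in sequentially. (F has_contour_integral I) (rectpath (Complex c1 (- real n)) (Complex c2 (real n)))"
    and B: "\<forall>\<^sub>F n in sequentially. \<forall>z. c1 \<le> Re z \<longrightarrow> Re z \<le> c2 \<longrightarrow> \<bar>Im z\<bar> = real n \<longrightarrow> cmod (F z) \<le> B n"
    and B0: "B \<longlonglongrightarrow> 0"
    and int: "integrable lborel (\<lambda>y. F (Complex c1 y))" "integrable lborel (\<lambda>y. F (Complex c2 y))"
  shows "I = \<i> * ((\<integral>y. F (Complex c2 y) \<partial>lborel) - (\<integral>y. F (Complex c1 y) \<partial>lborel))"
proof -
  let ?V = "\<lambda>n. \<i> * (integral {-real n..real n} (\<lambda>y. F (Complex c2 y)) - integral {-real n..real n} (\<lambda>y. F (Complex c1 y)))"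
  have "?V \<longlonglongrightarrow> \<i> * ((\<integral>y. F (Complex c2 y) \<partial>lborel) - (\<integral>y. F (Complex c1 y) \<partial>lborel))"
    by (intro tendsto_intros truncated_integral_tendsto int)
  moreover have "(\<lambda>n. I - ?V n) \<longlonglongrightarrow> 0"
  proof (rule Lim_null_comparison)
    show "\<forall>\<^sub>F n in sequentially. norm (I - ?V n) \<le> 2 * (c2 - c1) * B n"
      using I B eventually_gt_at_top[of 0]
      by eventually_elim (intro rectangle_contour_bound, use assms(1) in auto)
    show "(\<lambda>n. 2 * (c2 - c1) * B n) \<longlonglongrightarrow> 0"
      using tendsto_mult_right_zero[OF B0] by simp
  qed
  then have "?V \<longlonglongrightarrow> I"
    using tendsto_diff[OF tendsto_const[of I]] by fastforce
  ultimately show ?thesis by (rule LIMSEQ_unique[symmetric])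
qed

section \<open>Gaussian integrals\<close>

lemma gaussian_integral:
  assumes "\<beta> > 0"
  shows "integrable lborel (\<lambda>x::real. exp (- \<beta> * (x - c)\<^sup>2))"
    and "(\<integral>x. exp (- \<beta> * (x - c)\<^sup>2) \<partial>lborel) = sqrt (pi / \<beta>)"
proof -
  have "has_bochner_integral lborel (\<lambda>x::real. exp (- x\<^sup>2)) (sqrt pi)"
    using has_bochner_integral_even_function[OF gaussian_moment_0] by simp
  then have "has_bochner_integral lborel (\<lambda>x. exp (- ((- sqrt \<beta> * c) + sqrt \<beta> * x)\<^sup>2)) (sqrt pi /\<^sub>R \<bar>sqrt \<beta>\<bar>)"
    using assms by (subst (asm) lborel_has_bochner_integral_real_affine_iff[where c="sqrt \<beta>" and t="- sqrt \<beta> * c"]) auto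
  also have "(\<lambda>x. exp (- ((- sqrt \<beta> * c) + sqrt \<beta> * x)\<^sup>2)) = (\<lambda>x. exp (- \<beta> * (x - c)\<^sup>2))"
  proof
    fix x
    have "(- sqrt \<beta> * c) + sqrt \<beta> * x = sqrt \<beta> * (x - c)" by (simp add: algebra_simps)
    then show "exp (- ((- sqrt \<beta> * c) + sqrt \<beta> * x)\<^sup>2) = exp (- \<beta> * (x - c)\<^sup>2)"
      using assms by (simp add: power_mult_distrib)
  qed
  also have "sqrt pi /\<^sub>R \<bar>sqrt \<beta>\<bar> = sqrt (pi / \<beta>)"
    using assms by (simp add: real_sqrt_divide field_simps)
  finally show "integrable lborel (\<lambda>x::real. exp (- \<beta> * (x - c)\<^sup>2))"
    "(\<integral>x. exp (- \<beta> * (x - c)\<^sup>2) \<partial>lborel) = sqrt (pi / \<beta>)"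
    by (auto simp: has_bochner_integral_iff)
qed

lemma power_le_exp:
  fixes \<gamma> y :: real
  assumes "\<gamma> > 0" "y \<ge> 0"
  shows "y ^ k \<le> fact k / \<gamma> ^ k * exp (\<gamma> * y)"
proof -
  have "(\<Sum>n\<in>{k}. (\<gamma> * y) ^ n /\<^sub>R fact n) \<le> exp (\<gamma> * y)"
    unfolding exp_def using assms by (intro sum_le_suminf summable_exp_generic) auto
  then have "(\<gamma> * y) ^ k / fact k \<le> exp (\<gamma> * y)"
    by (simp add: field_simps)
  then show ?thesis using assms by (simp add: field_simps power_mult_distrib)
qed

lemma integrable_gaussian_bound:
  fixes f :: "real \<Rightarrow> complex"
  assumes "\<beta> > 0" "continuous_on UNIV f" "\<And>x. cmod (f x) \<le> K * (1 + x\<^sup>2) ^ k * exp (- \<beta> * x\<^sup>2)"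
  shows "integrable lborel f"
proof (rule Bochner_Integration.integrable_bound)
  let ?K = "\<bar>K\<bar> * (fact k / (\<beta>/2) ^ k * exp (\<beta>/2))"
  show "integrable lborel (\<lambda>x. ?K * exp (- (\<beta>/2) * (x - 0)\<^sup>2))"
    by (intro integrable_mult_right gaussian_integral) (use assms in auto)
  show "f \<in> borel_measurable lborel"
    using assms(2) by (simp add: borel_measurable_continuous_onI)
  show "AE x in lborel. norm (f x) \<le> norm (?K * exp (- (\<beta>/2) * (x - 0)\<^sup>2))"
  proof (rule AE_I2)
    fix x :: real
    have "(1 + x\<^sup>2) ^ k \<le> fact k / (\<beta>/2) ^ k * exp (\<beta>/2 * (1 + x\<^sup>2))"
      using assms(1) by (intro power_le_exp) auto
    then have "\<bar>K\<bar> * (1 + x\<^sup>2) ^ k * exp (- \<beta> * x\<^sup>2) \<le> \<bar>K\<bar> * (fact k / (\<beta>/2) ^ k * exp (\<beta>/2 * (1 + x\<^sup>2))) * exp (- \<beta> * x\<^sup>2)"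
      by (intro mult_right_mono mult_left_mono) auto
    also have "\<dots> = ?K * (exp (\<beta>/2 * x\<^sup>2) * exp (- \<beta> * x\<^sup>2))"
      by (simp add: exp_add distrib_left)
    also have "exp (\<beta>/2 * x\<^sup>2) * exp (- \<beta> * x\<^sup>2) = exp (- (\<beta>/2) * (x - 0)\<^sup>2)"
      by (simp add: exp_add[symmetric] field_simps)
    finally have "\<bar>K\<bar> * (1 + x\<^sup>2) ^ k * exp (- \<beta> * x\<^sup>2) \<le> ?K * exp (- (\<beta>/2) * (x - 0)\<^sup>2)" .
    moreover have "K * (1 + x\<^sup>2) ^ k * exp (- \<beta> * x\<^sup>2) \<le> \<bar>K\<bar> * (1 + x\<^sup>2) ^ k * exp (- \<beta> * x\<^sup>2)"
      by (intro mult_right_mono) auto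
    ultimately show "norm (f x) \<le> norm (?K * exp (- (\<beta>/2) * (x - 0)\<^sup>2))"
      using assms(3)[of x] assms(1) by (simp add: abs_mult)
  qed
qed

text \<open>
  Rotating the half line within the sector where \<open>Re z\<^sup>2 > 0\<close> does not change the integral of \<open>exp (- z\<^sup>2)\<close>: apply
  Cauchy's theorem to the triangle with vertices \<open>0\<close>, \<open>n\<close>, \<open>n (1 + i \<tau>)\<close>, whose third side contributes
  \<open>O(n exp (- (1 - \<tau>\<^sup>2) n\<^sup>2))\<close>.
\<close>

lemma gaussian_half_line_rotated:
  fixes \<tau> :: real
  assumes "\<bar>\<tau>\<bar> < 1"
  shows "(\<lambda>n. (1 + \<i> * \<tau>) * integral {0..real n} (\<lambda>x. exp (- ((1 + \<i> * \<tau>) * complex_of_real x)\<^sup>2)))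
           \<longlonglongrightarrow> complex_of_real (sqrt pi / 2)"
proof -
  let ?c = "1 + \<i> * complex_of_real \<tau>"
  let ?f = "\<lambda>z::complex. exp (- z\<^sup>2)"
  have seg: "contour_integral (linepath 0 (c * complex_of_real n)) ?f = c * integral {0..n} (\<lambda>x. ?f (c * x))"
    and segi: "?f contour_integrable_on linepath 0 (c * complex_of_real n)"
    if "n > 0" for n and c :: complex
  proof -
    have "((\<lambda>x. ?f (c * of_real x)) has_integral integral {0..n} (\<lambda>x. ?f (c * x))) {0..n}"
      by (intro integrable_integral integrable_continuous_real continuous_intros)
    from has_integral_stretch_real[OF this, of n] that
    have "((\<lambda>x. ?f (c * of_real (n * x))) has_integral (1 / n) *\<^sub>R integral {0..n} (\<lambda>x. ?f (c * x))) {0..1}"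
      by simp
    from has_integral_mult_left[OF this, of "c * n"] that
    have "(?f has_contour_integral (c * integral {0..n} (\<lambda>x. ?f (c * x)))) (linepath 0 (c * n))"
      unfolding has_contour_integral_linepath
      by (simp add: linepath_def scaleR_conv_of_real mult_ac)
    then show "contour_integral (linepath 0 (c * complex_of_real n)) ?f = c * integral {0..n} (\<lambda>x. ?f (c * x))"
      "?f contour_integrable_on linepath 0 (c * complex_of_real n)"
      by (auto simp: contour_integral_unique contour_integrable_on_def)
  qed
  define V where "V = (\<lambda>n. contour_integral (linepath (of_nat n) (?c * of_nat n)) ?f)"
  have eq: "?c * integral {0..real n} (\<lambda>x. ?f (?c * x)) = integral {0..real n} (\<lambda>x. ?f (complex_of_real x)) + V n"
    if "n > 0" for n :: nat
  proof -
    have "?f holomorphic_on convex hull {0, of_nat n, ?c * of_nat n}"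
      by (intro holomorphic_intros)
    from Cauchy_theorem_triangle[OF this]
    have C: "(?f has_contour_integral 0) (linepath 0 (of_nat n) +++ linepath (of_nat n) (?c * of_nat n) +++ linepath (?c * of_nat n) 0)" .
    then have "?f contour_integrable_on (linepath 0 (of_nat n) +++ linepath (of_nat n) (?c * of_nat n) +++ linepath (?c * of_nat n) 0)"
      by (auto simp: contour_integrable_on_def)
    then have "?f contour_integrable_on linepath 0 (of_nat n)" "?f contour_integrable_on linepath (of_nat n) (?c * of_nat n)"
      "?f contour_integrable_on linepath (?c * of_nat n) 0"
      by auto
    with contour_integral_unique[OF C]
    have "contour_integral (linepath 0 (of_nat n)) ?f + (V n + contour_integral (linepath (?c * of_nat n) 0) ?f) = 0"
      by (simp add: V_def)
    moreover have "contour_integral (linepath (?c * of_nat n) 0) ?f = - contour_integral (linepath 0 (?c * of_nat n)) ?f"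
      by (metis contour_integral_reversepath reversepath_linepath valid_path_linepath)
    moreover have "a + (v + w) = 0 \<Longrightarrow> w = - x \<Longrightarrow> x = a + v" for a v w x :: complex
      by algebra
    ultimately have "contour_integral (linepath 0 (?c * of_nat n)) ?f = contour_integral (linepath 0 (of_nat n)) ?f + V n"
      by blast
    then show ?thesis
      using seg(1)[of "real n" 1] seg(1)[of "real n" ?c] that by simp
  qed
  have "V \<longlonglongrightarrow> 0"
  proof (rule Lim_null_comparison)
    show "\<forall>\<^sub>F n in sequentially. norm (V n) \<le> exp (- (1 - \<tau>\<^sup>2) * real n ^ 2) * real n"
      using eventually_gt_at_top[of 0]
    proof eventually_elim
      case (elim n)
      have hol: "continuous_on UNIV ?f" by (intro continuous_intros)
      have "norm (V n) \<le> exp (- (1 - \<tau>\<^sup>2) * real n ^ 2) * norm (?c * of_nat n - of_nat n)"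
        unfolding V_def
      proof (rule contour_integral_bound_linepath)
        show "?f contour_integrable_on linepath (of_nat n) (?c * of_nat n)"
          by (intro contour_integrable_continuous_linepath continuous_intros)
        fix z assume "z \<in> closed_segment (of_nat n) (?c * of_nat n)"
        then obtain u where u: "0 \<le> u" "u \<le> 1" "z = (1 - u) *\<^sub>R of_nat n + u *\<^sub>R (?c * of_nat n)"
          by (auto simp: closed_segment_def)
        then have "z = of_nat n * (1 + \<i> * (u * \<tau>))"
          by (simp add: scaleR_conv_of_real algebra_simps)
        then have "Re (- z\<^sup>2) = - (real n)\<^sup>2 * (1 - (u * \<tau>)\<^sup>2)"
          by (simp add: power2_eq_square algebra_simps)
        also have "(u * \<tau>)\<^sup>2 \<le> \<tau>\<^sup>2"
          using u by (simp add: power_mult_distrib mult_left_le_one_le power_le_one)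
        then have "- (real n)\<^sup>2 * (1 - (u * \<tau>)\<^sup>2) \<le> - (real n)\<^sup>2 * (1 - \<tau>\<^sup>2)"
          by (simp add: mult_left_mono)
        finally show "norm (?f z) \<le> exp (- (1 - \<tau>\<^sup>2) * real n ^ 2)"
          by (simp add: algebra_simps)
      qed auto
      also have "norm (?c * of_nat n - of_nat n) = \<bar>\<tau>\<bar> * real n"
        by (simp add: algebra_simps norm_mult)
      also have "exp (- (1 - \<tau>\<^sup>2) * real n ^ 2) * (\<bar>\<tau>\<bar> * real n) \<le> exp (- (1 - \<tau>\<^sup>2) * real n ^ 2) * (1 * real n)"
        using assms by (intro mult_left_mono mult_right_mono) auto
      finally show ?case by simp
    qed
    have "1 - \<tau>\<^sup>2 > 0" using assms by (simp add: abs_square_less_1)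
    then show "(\<lambda>n. exp (- (1 - \<tau>\<^sup>2) * real n ^ 2) * real n) \<longlonglongrightarrow> 0"
      by real_asymp
  qed
  moreover have "(\<lambda>n. integral {0..real n} (\<lambda>x. ?f (complex_of_real x))) \<longlonglongrightarrow> complex_of_real (sqrt pi / 2)"
  proof -
    let ?g = "\<lambda>x. complex_of_real (indicator {0..} x *\<^sub>R exp (- x\<^sup>2))"
    have G: "integrable lborel ?g" "integral\<^sup>L lborel ?g = complex_of_real (sqrt pi / 2)"
      using gaussian_moment_0 unfolding has_bochner_integral_iff integral_complex_of_real
      by (simp_all only: integrable_of_real simp_thms)
    have "integral {- real n..real n} ?g = integral {0..real n} (\<lambda>x. ?f (complex_of_real x))" for n
    proof -
      have "((\<lambda>x. ?f (complex_of_real x)) has_integral integral {0..real n} (\<lambda>x. ?f (complex_of_real x))) {0..real n}"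
        by (intro integrable_integral integrable_continuous_real continuous_intros)
      then have "((\<lambda>x. if x \<in> {0..real n} then ?f (complex_of_real x) else 0) has_integral
          integral {0..real n} (\<lambda>x. ?f (complex_of_real x))) {- real n..real n}"
        by (subst has_integral_restrict) auto
      then have "(?g has_integral integral {0..real n} (\<lambda>x. ?f (complex_of_real x))) {- real n..real n}"
        by (rule has_integral_eq[rotated]) (auto simp: exp_of_real[symmetric])
      then show ?thesis by (rule integral_unique)
    qed
    with truncated_integral_tendsto[OF G(1)] G(2) show ?thesis by (simp only:)
  qed
  ultimately have "(\<lambda>n. integral {0..real n} (\<lambda>x. ?f (complex_of_real x)) + V n) \<longlonglongrightarrow> complex_of_real (sqrt pi / 2) + 0"
    by (intro tendsto_add)
  moreover have "\<forall>\<^sub>F n in sequentially. integral {0..real n} (\<lambda>x. ?f (complex_of_real x)) + V n =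
      ?c * integral {0..real n} (\<lambda>x. ?f (?c * x))"
    using eventually_gt_at_top[of 0] by eventually_elim (use eq in simp)
  ultimately show ?thesis
    by (simp add: Lim_transform_eventually)
qed

lemma complex_gaussian_integrable:
  assumes "Re A > 0"
  shows "integrable lborel (\<lambda>x::real. exp (- A * (complex_of_real x)\<^sup>2))"
  by (rule integrable_gaussian_bound[where \<beta>="Re A" and K=1 and k=0])
     (use assms in \<open>auto intro!: continuous_intros simp: Re_power2\<close>)

text \<open>
  Writing \<open>A = \<rho>\<^sup>2 (1 + i \<tau>)\<^sup>2\<close> with \<open>\<bar>\<tau>\<bar> < 1\<close>, the rotated half-line integral is a nonzero multiple of this one. Only
  nonvanishing matters here: it keeps the leading term of Laplace's method alive although the
  vertical line is not the direction of steepest descent, so that \<open>A\<close> is not real.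
\<close>

lemma complex_gaussian_integral_nonzero:
  assumes "Re A > 0"
  shows "(\<integral>x. exp (- A * (complex_of_real x)\<^sup>2) \<partial>lborel) \<noteq> 0"
proof
  assume 0: "(\<integral>x. exp (- A * (complex_of_real x)\<^sup>2) \<partial>lborel) = 0"
  define c where "c = csqrt A"
  have cA: "c\<^sup>2 = A" by (simp add: c_def)
  have "(Re c)\<^sup>2 - (Im c)\<^sup>2 > 0" using assms cA by (metis Re_power2)
  moreover have "Re c \<ge> 0" unfolding c_def using csqrt_principal[of A] by (auto simp: less_imp_le)
  ultimately have c: "Re c > 0" "\<bar>Im c\<bar> < Re c"
    using abs_square_less_1 power2_less_imp_less[of "\<bar>Im c\<bar>" "Re c"] by (auto simp: order_le_less)
  define \<tau> where "\<tau> = Im c / Re c"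
  have \<tau>: "\<bar>\<tau>\<bar> < 1" using c by (simp add: \<tau>_def)
  define e where "e = 1 + \<i> * complex_of_real \<tau>"
  have ce: "c = Re c * e" using c by (simp add: e_def \<tau>_def complex_eq_iff)
  let ?f = "\<lambda>x::real. exp (- ((e * complex_of_real x)\<^sup>2))"
  have Ree: "Re (e\<^sup>2) > 0" using \<tau> by (simp add: e_def Re_power2 abs_square_less_1)
  have If: "integrable lborel ?f"
    using complex_gaussian_integrable[OF Ree] by (simp add: power_mult_distrib)
  have Ae: "A = (Re c)\<^sup>2 * e\<^sup>2"
    using cA ce by (metis of_real_power power_mult_distrib)
  have "(\<integral>x. exp (- A * (complex_of_real x)\<^sup>2) \<partial>lborel) = (\<integral>x. ?f (0 + Re c * x) \<partial>lborel)"
    by (rule Bochner_Integration.integral_cong) (simp_all add: Ae power_mult_distrib mult_ac)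
  then have I0: "integral\<^sup>L lborel ?f = 0"
    using lborel_integral_real_affine[of "Re c" ?f 0] c 0 by simp
  have "(\<lambda>n. integral {- real n..real n} ?f) \<longlonglongrightarrow> 0"
    using truncated_integral_tendsto[OF If] I0 by simp
  moreover have "integral {- real n..real n} ?f = 2 * integral {0..real n} ?f" for n
  proof -
    have int: "?f integrable_on S" if "S = {a..b}" for S a b
      unfolding that by (intro integrable_continuous_real continuous_intros)
    have "integral {- real n..real n} ?f = integral {- real n..0} ?f + integral {0..real n} ?f"
      by (rule Henstock_Kurzweil_Integration.integral_combine[symmetric]) (auto intro: int)
    also have "integral {- real n..0} ?f = integral {0..real n} (\<lambda>x. ?f (- x))"
      using Henstock_Kurzweil_Integration.integral_reflect_real[of "real n" 0 "\<lambda>x. ?f (-x)"] by simp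
    finally show ?thesis by simp
  qed
  ultimately have "(\<lambda>n. 2 * integral {0..real n} ?f) \<longlonglongrightarrow> 0" by simp
  from tendsto_mult_left[OF this, of "e / 2"]
  have "(\<lambda>n. e * integral {0..real n} ?f) \<longlonglongrightarrow> 0" by simp
  moreover have "(\<lambda>n. e * integral {0..real n} ?f) \<longlonglongrightarrow> complex_of_real (sqrt pi / 2)"
    using gaussian_half_line_rotated[OF \<tau>] by (simp add: e_def)
  ultimately have "complex_of_real (sqrt pi / 2) = 0" by (metis LIMSEQ_unique)
  then show False by simp
qed

lemma Ln_second_order:
  "((\<lambda>z. (ln (1 + z) - z + z\<^sup>2 / 2) / z\<^sup>2) \<longlongrightarrow> 0) (at (0::complex))"
proof (rule Lim_null_comparison)
  show "((\<lambda>z::complex. 4 * norm z) \<longlongrightarrow> 0) (at 0)"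
    by (auto intro!: tendsto_eq_intros)
  have "\<forall>\<^sub>F z in at (0::complex). norm z < 1/2"
    by (auto simp: eventually_at intro!: exI[of _ "1/2"])
  moreover have "\<forall>\<^sub>F z in at (0::complex). z \<noteq> 0" by (auto simp: eventually_at_filter)
  ultimately show "\<forall>\<^sub>F z in at (0::complex). norm ((ln (1 + z) - z + z\<^sup>2 / 2) / z\<^sup>2) \<le> 4 * norm z"
  proof eventually_elim
    case (elim z)
    let ?f = "\<lambda>n. - ((-z)^n) / of_nat n"
    have s: "?f sums ln (1 + z)" using elim by (intro Ln_series') auto
    have "(\<lambda>n. ?f (n + 3)) sums (ln (1 + z) - (\<Sum>n<3. ?f n))"
      by (rule sums_split_initial_segment[OF s])
    also have "(\<Sum>n<3. ?f n) = z - z\<^sup>2/2"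
      by (simp add: eval_nat_numeral)
    finally have S: "(\<lambda>n. ?f (n + 3)) sums (ln (1 + z) - z + z\<^sup>2/2)" by (simp add: algebra_simps)
    have G: "(\<lambda>n. norm z ^ 3 * norm z ^ n) sums (norm z ^ 3 * (1 / (1 - norm z)))"
      using elim by (intro sums_mult geometric_sums) auto
    have "norm (ln (1 + z) - z + z\<^sup>2/2) \<le> norm z ^ 3 * (1 / (1 - norm z))"
    proof (rule norm_sums_le[OF S G])
      fix n
      have "norm (?f (n + 3)) = norm z ^ 3 * norm z ^ n / real (n + 3)"
        by (simp add: norm_divide norm_power norm_mult power_add mult.commute del: of_nat_add)
      also have "\<dots> \<le> norm z ^ 3 * norm z ^ n / 1" by (intro divide_left_mono) auto
      finally show "norm (?f (n + 3)) \<le> norm z ^ 3 * norm z ^ n" by simp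
    qed
    also have "\<dots> \<le> norm z ^ 3 * 4"
      using elim by (intro mult_left_mono) (auto simp: field_simps)
    finally have "norm (ln (1 + z) - z + z\<^sup>2/2) / norm z ^ 2 \<le> norm z ^ 3 * 4 / norm z ^ 2"
      by (intro divide_right_mono) auto
    also have "\<dots> = 4 * norm z" using elim by (simp add: eval_nat_numeral)
    finally show ?case by (simp add: norm_divide norm_power)
  qed
qed

section \<open>The saddle points\<close>

definition cayley :: "complex \<Rightarrow> complex" where
  "cayley v = (1 - v) / (1 + v)"

text \<open>
  The cubic has no quadratic term, so its real root is \<open>- 2 \<xi>\<close> when the conjugate pair has real part \<open>\<xi>\<close>. Comparing
  coefficients with \<open>(\<zeta> + 2 \<xi>) (\<zeta>\<^sup>2 - 2 \<xi> \<zeta> + \<xi>\<^sup>2 + h\<^sup>2)\<close> gives \<open>h\<^sup>2 = 3 \<xi>\<^sup>2 - 1\<close> and the value of \<open>\<alpha>\<close> below.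
\<close>

definition alpha_of :: "real \<Rightarrow> real" where
  "alpha_of \<xi> = 1 / (2 * \<xi> * (4 * \<xi>\<^sup>2 - 1))"

definition saddle_height :: "real \<Rightarrow> real" where
  "saddle_height \<xi> = sqrt (3 * \<xi>\<^sup>2 - 1)"

definition saddle :: "real \<Rightarrow> complex" where
  "saddle \<xi> = Complex \<xi> (saddle_height \<xi>)"

definition level :: "real \<Rightarrow> real" where
  "level \<xi> = cmod (cayley (saddle \<xi>)) * exp (alpha_of \<xi> * Re ((saddle \<xi>)\<^sup>2))"

text \<open>
  The second condition says that the saddle points are not real.
\<close>

definition admissible :: "real \<Rightarrow> bool" where
  "admissible \<xi> \<longleftrightarrow> \<xi> > 0 \<and> 3 * \<xi>\<^sup>2 > 1"

lemma admissibleD: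
  assumes "admissible \<xi>"
  shows "\<xi> > 0" "3 * \<xi>\<^sup>2 > 1" "4 * \<xi>\<^sup>2 > 1" "2 * \<xi> > 1" "alpha_of \<xi> > 0" "saddle_height \<xi> > 0"
    "(saddle_height \<xi>)\<^sup>2 = 3 * \<xi>\<^sup>2 - 1"
proof -
  show 1: "\<xi> > 0" "3 * \<xi>\<^sup>2 > 1" using assms by (auto simp: admissible_def)
  then show 2: "4 * \<xi>\<^sup>2 > 1" by linarith
  have "1\<^sup>2 < (2 * \<xi>)\<^sup>2" using 2 by (simp add: power_mult_distrib)
  then show "2 * \<xi> > 1" using 1 by (simp only: power2_less_imp_less)
  show "alpha_of \<xi> > 0" using 1 2 by (simp add: alpha_of_def)
  show "saddle_height \<xi> > 0" "(saddle_height \<xi>)\<^sup>2 = 3 * \<xi>\<^sup>2 - 1" using 1 by (auto simp: saddle_height_def)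
qed

lemma saddle_equation:
  assumes "admissible \<xi>"
  shows "of_real (alpha_of \<xi>) * ((saddle \<xi>) ^ 3 - saddle \<xi>) + 1 = 0"
proof -
  note a = admissibleD[OF assms]
  define h where "h = saddle_height \<xi>"
  have h: "h * h = 3 * \<xi> * \<xi> - 1" using a by (simp add: h_def power2_eq_square)
  have "(saddle \<xi>) ^ 3 - saddle \<xi> = Complex (\<xi>*\<xi>*\<xi> - 3 * \<xi> * (h*h) - \<xi>) (h * (3 * \<xi> * \<xi> - h * h - 1))"
    by (simp add: saddle_def h_def[symmetric] complex_eq_iff power3_eq_cube algebra_simps)
  also have "\<dots> = of_real (- (2 * \<xi> * (4 * \<xi>\<^sup>2 - 1)))"
    unfolding h by (simp add: complex_eq_iff algebra_simps power2_eq_square)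
  finally show ?thesis using a by (simp add: alpha_of_def flip: of_real_mult)
qed

lemma alpha_of_strict_antimono:
  assumes "admissible x" "x < y"
  shows "admissible y" "alpha_of y < alpha_of x"
proof -
  have "x\<^sup>2 < y\<^sup>2" using assms by (intro power_strict_mono) (auto simp: admissible_def)
  then show y: "admissible y" using assms by (auto simp: admissible_def)
  show "alpha_of y < alpha_of x"
  proof -
    note ax = admissibleD[OF assms(1)] and ay = admissibleD[OF y]
    have "2 * x * (4 * x\<^sup>2 - 1) < 2 * y * (4 * y\<^sup>2 - 1)"
      by (rule mult_strict_mono) (use ax(1,3) ay(1) assms(2) \<open>x\<^sup>2 < y\<^sup>2\<close> in linarith)+
    moreover have "0 < 2 * x * (4 * x\<^sup>2 - 1)" using ax(1,3) by (intro mult_pos_pos) linarith+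
    ultimately show ?thesis by (simp only: alpha_of_def divide_inverse mult_1_left less_imp_inverse_less)
  qed
qed

lemma zeta_alpha_of:
  assumes "admissible \<xi>"
  shows "zeta (alpha_of \<xi>) = saddle \<xi>"
  unfolding zeta_def
proof (rule the_equality)
  note a = admissibleD[OF assms]
  show "of_real (alpha_of \<xi>) * ((saddle \<xi>) ^ 3 - saddle \<xi>) + 1 = 0 \<and> Re (saddle \<xi>) > 0 \<and> Im (saddle \<xi>) > 0"
    using saddle_equation[OF assms] a by (simp add: saddle_def)
  fix z assume z: "of_real (alpha_of \<xi>) * (z ^ 3 - z) + 1 = 0 \<and> Re z > 0 \<and> Im z > 0"
  define x y where "x = Re z" and "y = Im z"
  have zxy: "z = Complex x y" by (simp add: x_def y_def)
  have pos: "x > 0" "y > 0" using z by (auto simp: x_def y_def)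
  have "Im (of_real (alpha_of \<xi>) * (z ^ 3 - z) + 1) = 0" using z by simp
  then have "alpha_of \<xi> * (y * (3 * x * x - y * y - 1)) = 0"
    by (simp add: zxy power3_eq_cube algebra_simps)
  then have yy: "y * y = 3 * x * x - 1" using pos a by simp
  have "Re (of_real (alpha_of \<xi>) * (z ^ 3 - z) + 1) = 0" using z by simp
  then have "alpha_of \<xi> * (x * x * x - 3 * x * (y * y) - x) + 1 = 0"
    by (simp add: zxy power3_eq_cube algebra_simps)
  then have al: "alpha_of \<xi> * (2 * x * (4 * x\<^sup>2 - 1)) = 1"
    unfolding yy by (simp add: power2_eq_square algebra_simps)
  have adm: "admissible x"
    using pos yy mult_pos_pos[OF pos(2) pos(2)] by (simp add: admissible_def power2_eq_square)
  have "alpha_of \<xi> = alpha_of x"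
    using al admissibleD[OF adm] by (auto simp: alpha_of_def field_simps)
  then have "x = \<xi>"
    using alpha_of_strict_antimono(2)[OF adm, of \<xi>] alpha_of_strict_antimono(2)[OF assms, of x] by fastforce
  moreover have "y = saddle_height x"
    unfolding saddle_height_def using yy pos by (intro real_sqrt_unique[symmetric]) (auto simp: power2_eq_square)
  ultimately show "z = saddle \<xi>" by (simp add: zxy saddle_def)
qed

lemma H_e_alpha_of:
  assumes "admissible \<xi>"
  shows "H_e (alpha_of \<xi>) = level \<xi>"
  unfolding H_e_def level_def zeta_alpha_of[OF assms] cayley_def
  by (simp add: norm_divide norm_minus_commute add.commute)

lemma norm_cayley_sq:
  "(cmod (cayley (Complex x y)))\<^sup>2 = ((1 - x)\<^sup>2 + y\<^sup>2) / ((1 + x)\<^sup>2 + y\<^sup>2)"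
  by (simp add: cayley_def norm_divide power_divide cmod_power2)

lemma saddle_height_products:
  assumes "admissible \<xi>"
  shows "(1 - \<xi>)\<^sup>2 + (saddle_height \<xi>)\<^sup>2 = 2 * \<xi> * (2 * \<xi> - 1)"
    "(1 + \<xi>)\<^sup>2 + (saddle_height \<xi>)\<^sup>2 = 2 * \<xi> * (2 * \<xi> + 1)"
  using admissibleD[OF assms] by (simp_all add: power2_eq_square algebra_simps)

lemma level_pos:
  assumes "admissible \<xi>"
  shows "level \<xi> > 0"
proof -
  have "cayley (saddle \<xi>) \<noteq> 0"
    using admissibleD(1,6)[OF assms] unfolding cayley_def saddle_def
    by (subst divide_eq_0_iff) (auto simp: complex_eq_iff)
  then show ?thesis by (simp add: level_def)
qed

text \<open>
  Put \<open>A = (1 - \<xi>)\<^sup>2\<close>, \<open>B = (1 + \<xi>)\<^sup>2\<close>, \<open>T = y\<^sup>2\<close>, \<open>T\<^sub>0 = h\<^sup>2\<close>. The squared modulus of the Cayley transform is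
  \<open>(A + T) / (B + T)\<close>, so its ratio \<open>X\<close> to the value at the saddle point satisfies \<open>X \<le> exp (X - 1)\<close>. Since
  \<open>\<alpha> = (B - A) / (2 (A + T\<^sub>0) (B + T\<^sub>0))\<close>, the exponent \<open>X - 1\<close> is exactly \<open>2 \<alpha> (T - T\<^sub>0) - 2 \<alpha> (T - T\<^sub>0)\<^sup>2 / (B + T)\<close>;
  the linear term cancels against \<open>exp (\<alpha> Re v\<^sup>2)\<close> and the quadratic term is the asserted decay.
\<close>

lemma level_line_bound:
  assumes "admissible \<xi>"
  defines "\<alpha> \<equiv> alpha_of \<xi>" and "h \<equiv> saddle_height \<xi>"
  shows "cmod (cayley (Complex \<xi> y) * exp (of_real \<alpha> * (Complex \<xi> y)\<^sup>2))
           \<le> level \<xi> * exp (- \<alpha> * (y\<^sup>2 - h\<^sup>2)\<^sup>2 / ((1 + \<xi>)\<^sup>2 + y\<^sup>2))"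
proof -
  note a = admissibleD[OF assms(1)]
  define A B T T0 where "A = (1 - \<xi>)\<^sup>2" and "B = (1 + \<xi>)\<^sup>2" and "T = y\<^sup>2" and "T0 = h\<^sup>2"
  have ge: "A \<ge> 0" "T \<ge> 0" "T0 > 0" "B > 0" using a by (auto simp: A_def T_def T0_def h_def B_def)
  have prods: "A + T0 = 2 * \<xi> * (2 * \<xi> - 1)" "B + T0 = 2 * \<xi> * (2 * \<xi> + 1)"
    using saddle_height_products[OF assms(1)] by (simp_all add: A_def B_def T0_def h_def)
  have BA: "B - A = 4 * \<xi>" by (simp add: A_def B_def power2_eq_square algebra_simps)
  have al: "\<alpha> * (2 * ((A + T0) * (B + T0))) = B - A"
    unfolding prods BA \<alpha>_def alpha_of_def using a
    by (simp add: field_simps) (simp add: power2_eq_square algebra_simps)?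
  have pos: "A + T0 > 0" "B + T0 > 0" "B + T > 0" using ge by linarith+
  define X where "X = (A + T) * (B + T0) / ((A + T0) * (B + T))"
  have "X - 1 = (T - T0) * (B - A) / ((A + T0) * (B + T))"
  proof -
    have "X - 1 = ((A + T) * (B + T0) - (A + T0) * (B + T)) / ((A + T0) * (B + T))"
      using pos by (simp add: X_def diff_divide_distrib)
    also have "(A + T) * (B + T0) - (A + T0) * (B + T) = (T - T0) * (B - A)"
      by (simp add: algebra_simps)
    finally show ?thesis .
  qed
  also have "\<dots> = 2 * (\<alpha> * (T - T0) * (B + T0) / (B + T))"
  proof -
    have "(T - T0) * (B - A) / ((A + T0) * (B + T))
        = ((A + T0) * (2 * (\<alpha> * (T - T0) * (B + T0)))) / ((A + T0) * (B + T))"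
      unfolding al[symmetric] by (simp only: mult_ac)
    also have "\<dots> = 2 * (\<alpha> * (T - T0) * (B + T0)) / (B + T)"
      using pos by (subst mult_divide_mult_cancel_left) auto
    finally show ?thesis by simp
  qed
  also have "(B + T0) / (B + T) = 1 - (T - T0) / (B + T)" using pos by (simp add: field_simps)
  then have "\<alpha> * (T - T0) * (B + T0) / (B + T) = \<alpha> * (T - T0) * (1 - (T - T0) / (B + T))"
    by (metis times_divide_eq_right)
  also have "\<dots> = \<alpha> * (T - T0) - \<alpha> * (T - T0)\<^sup>2 / (B + T)"
    by (simp add: power2_eq_square algebra_simps diff_divide_distrib add_divide_distrib)
  finally have X1: "X - 1 = 2 * (\<alpha> * (T - T0) - \<alpha> * (T - T0)\<^sup>2 / (B + T))" .
  have "X \<le> exp (X - 1)" using exp_ge_add_one_self[of "X - 1"] by simp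
  then have X: "X \<le> (exp (\<alpha> * (T - T0) - \<alpha> * (T - T0)\<^sup>2 / (B + T)))\<^sup>2"
    unfolding X1 exp_double by simp
  have c1: "(cmod (cayley (Complex \<xi> y)))\<^sup>2 = (A + T) / (B + T)"
    by (simp add: norm_cayley_sq A_def B_def T_def)
  have c0: "(cmod (cayley (saddle \<xi>)))\<^sup>2 = (A + T0) / (B + T0)"
    by (simp add: saddle_def norm_cayley_sq A_def B_def T0_def h_def)
  have "(cmod (cayley (Complex \<xi> y)))\<^sup>2 = (cmod (cayley (saddle \<xi>)))\<^sup>2 * X"
  proof -
    have cancel: "p / q = r / s * (p * s / (r * q))" if "r \<noteq> 0" "s \<noteq> 0" for p q r s :: real
      using that by simp
    show ?thesis unfolding c1 c0 X_def by (rule cancel) (use pos in linarith)+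
  qed
  also have "\<dots> \<le> (cmod (cayley (saddle \<xi>)) * exp (\<alpha> * (T - T0) - \<alpha> * (T - T0)\<^sup>2 / (B + T)))\<^sup>2"
    unfolding power_mult_distrib by (intro mult_left_mono X) auto
  finally have "cmod (cayley (Complex \<xi> y)) \<le> cmod (cayley (saddle \<xi>)) * exp (\<alpha> * (T - T0) - \<alpha> * (T - T0)\<^sup>2 / (B + T))"
    by (rule power2_le_imp_le) auto
  then have "cmod (cayley (Complex \<xi> y)) * exp (\<alpha> * (\<xi>\<^sup>2 - T)) \<le>
      cmod (cayley (saddle \<xi>)) * exp (\<alpha> * (T - T0) - \<alpha> * (T - T0)\<^sup>2 / (B + T)) * exp (\<alpha> * (\<xi>\<^sup>2 - T))"
    by (rule mult_right_mono) auto
  also have "\<dots> = cmod (cayley (saddle \<xi>)) * exp (\<alpha> * (\<xi>\<^sup>2 - T0)) * exp (- \<alpha> * (T - T0)\<^sup>2 / (B + T))"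
    by (simp add: mult.assoc exp_add[symmetric] algebra_simps)
  finally show ?thesis
    by (simp add: level_def norm_mult saddle_def Re_power2 T_def T0_def B_def \<alpha>_def h_def)
qed

text \<open>
  The infimum over \<open>y\<close> of \<open>\<alpha> (y\<^sup>2 + h\<^sup>2) / ((1 + \<xi>)\<^sup>2 + y\<^sup>2)\<close> is the smaller of \<open>\<alpha>\<close> and \<open>\<alpha> h\<^sup>2 / (1 + \<xi>)\<^sup>2\<close>; the following
  rate lies below both.
\<close>

definition decay :: "real \<Rightarrow> real" where
  "decay \<xi> = alpha_of \<xi> * (saddle_height \<xi>)\<^sup>2 / ((1 + \<xi>)\<^sup>2 + (saddle_height \<xi>)\<^sup>2)"

lemma decay_pos: "admissible \<xi> \<Longrightarrow> decay \<xi> > 0"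
  using admissibleD[of \<xi>] unfolding decay_def by (intro divide_pos_pos mult_pos_pos add_pos_pos) auto

lemma level_line_gaussian_bound:
  assumes "admissible \<xi>"
  shows "cmod (cayley (Complex \<xi> y) * exp (of_real (alpha_of \<xi>) * (Complex \<xi> y)\<^sup>2))
           \<le> level \<xi> * exp (- decay \<xi> * (\<bar>y\<bar> - saddle_height \<xi>)\<^sup>2)"
proof -
  note a = admissibleD[OF assms(1)]
  define B h where "B = (1 + \<xi>)\<^sup>2" and "h = saddle_height \<xi>"
  have pos: "B > 0" "h > 0" using a by (auto simp: B_def h_def)
  have den: "B + y\<^sup>2 > 0" "B + h\<^sup>2 > 0" using pos by (auto intro!: add_pos_nonneg)
  have "h\<^sup>2 / (B + h\<^sup>2) \<le> (y\<^sup>2 + h\<^sup>2) / (B + y\<^sup>2)"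
    using den pos by (simp add: divide_simps algebra_simps)
  also have "y\<^sup>2 + h\<^sup>2 \<le> (\<bar>y\<bar> + h)\<^sup>2"
    using pos by (simp add: power2_sum)
  then have "(y\<^sup>2 + h\<^sup>2) / (B + y\<^sup>2) \<le> (\<bar>y\<bar> + h)\<^sup>2 / (B + y\<^sup>2)"
    using den by (intro divide_right_mono) auto
  finally have "(alpha_of \<xi> * (\<bar>y\<bar> - h)\<^sup>2) * (h\<^sup>2 / (B + h\<^sup>2)) \<le> (alpha_of \<xi> * (\<bar>y\<bar> - h)\<^sup>2) * ((\<bar>y\<bar> + h)\<^sup>2 / (B + y\<^sup>2))"
    using a by (intro mult_left_mono) auto
  also have "\<dots> = alpha_of \<xi> * (y\<^sup>2 - h\<^sup>2)\<^sup>2 / (B + y\<^sup>2)"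
  proof -
    have "(\<bar>y\<bar> - h) * (\<bar>y\<bar> + h) = y\<^sup>2 - h\<^sup>2"
      by (simp add: algebra_simps power2_eq_square)
    then have "(y\<^sup>2 - h\<^sup>2)\<^sup>2 = (\<bar>y\<bar> - h)\<^sup>2 * (\<bar>y\<bar> + h)\<^sup>2"
      by (metis power_mult_distrib)
    then show ?thesis by simp
  qed
  finally have "decay \<xi> * (\<bar>y\<bar> - h)\<^sup>2 \<le> alpha_of \<xi> * (y\<^sup>2 - h\<^sup>2)\<^sup>2 / (B + y\<^sup>2)"
    by (simp add: decay_def B_def h_def mult_ac)
  then have "level \<xi> * exp (- alpha_of \<xi> * (y\<^sup>2 - h\<^sup>2)\<^sup>2 / (B + y\<^sup>2)) \<le> level \<xi> * exp (- decay \<xi> * (\<bar>y\<bar> - h)\<^sup>2)"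
    using level_pos[OF assms] by simp
  with level_line_bound[OF assms, of y] show ?thesis by (simp add: B_def h_def)
qed

text \<open>
  With \<open>p = 2 \<xi>\<close>, the logarithm of the level is \<open>- artanh (1 / p) + \<alpha> (1 - p\<^sup>2 / 2)\<close>. Here \<open>artanh (1 / p) > 1 / p\<close>, and
  \<open>\<alpha> (1 - p\<^sup>2 / 2) \<le> 1 / p\<close> because \<open>\<alpha> = 1 / (p (p\<^sup>2 - 1))\<close> and \<open>3 p\<^sup>2 > 4\<close>.
\<close>

lemma level_less_1:
  assumes "admissible \<xi>"
  shows "level \<xi> < 1"
proof -
  note a = admissibleD[OF assms]
  define p where "p = 2 * \<xi>"
  have p: "p > 1" "3 * p\<^sup>2 > 4" using a by (auto simp: p_def power_mult_distrib)
  have p2: "p\<^sup>2 > 1" using p by simp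
  have c0: "(cmod (cayley (saddle \<xi>)))\<^sup>2 = (p - 1) / (p + 1)"
    using saddle_height_products[OF assms] a by (simp add: saddle_def norm_cayley_sq p_def)
  have "exp (2 / p) < (p + 1) / (p - 1)"
  proof -
    have "2 / p < ln ((p + 1) / (p - 1))"
    proof -
      define x where "x = 1 / p"
      have x: "0 < x" "x < 1" using p by (auto simp: x_def)
      define f where "f = (\<lambda>u::real. ln (1 + u) - ln (1 - u) - 2 * u)"
      have "f 0 < f x"
      proof (rule DERIV_pos_imp_increasing_open[OF x(1)])
        fix u assume u: "0 < u" "u < x"
        then have u1: "u < 1" using x by simp
        have u2: "0 < u * u" "u * u < 1" using u u1 mult_strict_mono[of u 1 u 1] by auto
        have "(f has_real_derivative (1 / (1 + u) + 1 / (1 - u) - 2)) (at u)"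
          unfolding f_def using u u1 by (auto intro!: derivative_eq_intros)
        moreover have "1 / (1 + u) + 1 / (1 - u) - 2 > 0"
        proof -
          have "1 / (1 + u) + 1 / (1 - u) - 2 = 2 * (u * u) / (1 - u * u)"
            using u u1 u2 by (simp add: divide_simps) (simp add: algebra_simps)
          then show ?thesis using u2 by simp
        qed
        ultimately show "\<exists>y. DERIV f u :> y \<and> y > 0" by blast
      next
        show "continuous_on {0..x} f" unfolding f_def using x by (intro continuous_intros) auto
      qed
      then have "2 * x < ln (1 + x) - ln (1 - x)" by (simp add: f_def)
      also have "\<dots> = ln ((1 + x) / (1 - x))" using x by (simp add: ln_div)
      also have "(1 + x) / (1 - x) = (p + 1) / (p - 1)" using p by (simp add: x_def field_simps)
      finally show ?thesis by (simp add: x_def)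
    qed
    then have "exp (2 / p) < exp (ln ((p + 1) / (p - 1)))" by simp
    then show ?thesis using p by simp
  qed
  moreover have "alpha_of \<xi> * Re ((saddle \<xi>)\<^sup>2) \<le> 1 / p"
  proof -
    have al: "alpha_of \<xi> = 1 / (p * (p\<^sup>2 - 1))" by (simp add: alpha_of_def p_def power_mult_distrib)
    have "Re ((saddle \<xi>)\<^sup>2) = 1 - p\<^sup>2 / 2"
      using a by (simp add: saddle_def Re_power2 p_def power_mult_distrib)
    moreover have "1 - p\<^sup>2 / 2 \<le> p\<^sup>2 - 1" using p by linarith
    ultimately have "alpha_of \<xi> * Re ((saddle \<xi>)\<^sup>2) \<le> alpha_of \<xi> * (p\<^sup>2 - 1)" using a by simp
    also have "\<dots> = 1 / p" using p p2 by (simp add: al)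
    finally show ?thesis .
  qed
  then have "(exp (alpha_of \<xi> * Re ((saddle \<xi>)\<^sup>2)))\<^sup>2 \<le> exp (2 / p)"
    by (simp add: exp_double[symmetric])
  ultimately have "(exp (alpha_of \<xi> * Re ((saddle \<xi>)\<^sup>2)))\<^sup>2 < (p + 1) / (p - 1)" by linarith
  then have "(level \<xi>)\<^sup>2 < (p - 1) / (p + 1) * ((p + 1) / (p - 1))"
    unfolding level_def power_mult_distrib c0 using p by (intro mult_strict_left_mono) auto
  also have "\<dots> = 1\<^sup>2" using p by simp
  finally show ?thesis by (rule power2_less_imp_less) simp
qed

lemma admissible_mono: "admissible x \<Longrightarrow> x \<le> y \<Longrightarrow> admissible y"
  using alpha_of_strict_antimono(1)[of x y] by (cases "x = y") auto

text \<open>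
  At the endpoint \<open>\<xi> = 1 / sqrt 3\<close> the two saddle points merge and \<open>\<alpha>\<close> takes the value \<open>alpha_c\<close>; as \<open>\<xi>\<close> grows, \<open>\<alpha>\<close>
  decreases to \<open>0\<close>. The intermediate value theorem then covers the given interval.
\<close>

lemma alpha_range_parametrised:
  assumes "0 < a" "a \<le> b" "b < alpha_c"
  obtains x1 x2 where "admissible x1" "x1 \<le> x2" "{a..b} \<subseteq> alpha_of ` {x1..x2}"
proof -
  define x0 :: real where "x0 = 1 / sqrt 3"
  have x0: "x0 > 0" "x0\<^sup>2 = 1 / 3" by (auto simp: x0_def power_divide)
  have ax0: "alpha_of x0 = alpha_c"
    unfolding alpha_of_def x0 by (simp add: x0_def alpha_c_def)
  have "isCont alpha_of x0"
    unfolding alpha_of_def using x0 by (intro continuous_intros) auto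
  then have "(alpha_of \<longlongrightarrow> alpha_of x0) (at x0)"
    by (simp only: isCont_def)
  then have "(alpha_of \<longlongrightarrow> alpha_of x0) (at_right x0)"
    by (rule tendsto_mono[OF at_le[OF subset_UNIV]])
  then have "(alpha_of \<longlongrightarrow> alpha_c) (at_right x0)"
    by (simp only: ax0)
  then have "\<forall>\<^sub>F x in at_right x0. alpha_of x > b"
    using assms(3) by (rule order_tendstoD)
  moreover have "\<forall>\<^sub>F x in at_right x0. x > x0" by (rule eventually_at_right_less)
  ultimately have "\<forall>\<^sub>F x in at_right x0. alpha_of x > b \<and> x > x0" by (rule eventually_conj)
  then have "\<exists>x. alpha_of x > b \<and> x > x0"
    by (rule eventually_happens'[rotated]) simp
  then obtain x1 where x1: "alpha_of x1 > b" "x1 > x0" by blast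
  have "x0\<^sup>2 < x1\<^sup>2" using x0 x1 by (intro power_strict_mono) auto
  then have adm: "admissible x1" using x0 x1 by (simp add: admissible_def)
  define x2 where "x2 = max x1 (3 / (2 * a))"
  have adm2: "admissible x2"
    by (rule admissible_mono[OF adm]) (simp add: x2_def)
  have "3 / (2 * a) \<le> x2" by (simp add: x2_def)
  then have "1 / a \<le> 2 * x2 / 3" by simp
  also have "\<dots> = 2 * x2 * (1/3)" by simp
  also have "\<dots> \<le> 2 * x2 * (4 * x2\<^sup>2 - 1)"
    using admissibleD[OF adm2] by (intro mult_left_mono) auto
  finally have "alpha_of x2 \<le> 1 / (1 / a)"
    unfolding alpha_of_def using assms(1) by (intro divide_left_mono mult_pos_pos) (use admissibleD[OF adm2] in auto)
  then have ax2: "alpha_of x2 \<le> a" by simp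
  have le: "x1 \<le> x2" by (simp add: x2_def)
  have "{a..b} \<subseteq> alpha_of ` {x1..x2}"
  proof
    fix \<alpha> assume "\<alpha> \<in> {a..b}"
    then have "\<exists>x. x1 \<le> x \<and> x \<le> x2 \<and> alpha_of x = \<alpha>"
    proof (intro IVT2')
      show "continuous_on {x1..x2} alpha_of"
        unfolding alpha_of_def
      proof (intro continuous_intros ballI)
        fix x assume "x \<in> {x1..x2}"
        then have "admissible x" using admissible_mono[OF adm] by auto
        then show "2 * x * (4 * x\<^sup>2 - 1) \<noteq> 0" using admissibleD[of x] by auto
      qed
    qed (use x1 ax2 le in auto)
    then show "\<alpha> \<in> alpha_of ` {x1..x2}" by auto
  qed
  with adm le show ?thesis by (rule that)
qed

lemma continuous_on_saddle_data:
  "continuous_on {x. admissible x} alpha_of"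
  "continuous_on {x. admissible x} saddle_height"
  "continuous_on {x. admissible x} saddle"
  "continuous_on {x. admissible x} level"
  "continuous_on {x. admissible x} decay"
proof -
  show al: "continuous_on {x. admissible x} alpha_of"
    unfolding alpha_of_def
  proof (intro continuous_intros ballI)
    fix x assume "x \<in> {x. admissible x}"
    then show "2 * x * (4 * x\<^sup>2 - 1) \<noteq> 0" using admissibleD(1,3)[of x] by auto
  qed
  show h: "continuous_on {x. admissible x} saddle_height"
    unfolding saddle_height_def by (intro continuous_intros)
  show sd: "continuous_on {x. admissible x} saddle"
    unfolding saddle_def Complex_eq by (intro continuous_intros h)
  have "1 + saddle x \<noteq> 0" if "admissible x" for x
    using admissibleD(1)[OF that] by (simp add: saddle_def complex_eq_iff)
  then show "continuous_on {x. admissible x} level"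
    unfolding level_def cayley_def by (intro continuous_intros al sd) auto
  have "(1 + x)\<^sup>2 + (saddle_height x)\<^sup>2 \<noteq> 0" if "admissible x" for x
    using admissibleD(1)[OF that] by (simp add: add_nonneg_eq_0_iff)
  then show "continuous_on {x. admissible x} decay"
    unfolding decay_def by (intro continuous_intros al h) auto
qed

section \<open>The error as an infimum\<close>

lemma rat_error_le:
  assumes "q > 0" "t > 0" "degree P \<le> m"
    and "\<And>x. x \<le> 0 \<Longrightarrow> cmod (exp (of_real (t * x)) - poly P (of_real x) / (of_real q - of_real x) ^ m) \<le> e"
  shows "rat_error m t q \<le> e"
proof -
  let ?r = "\<lambda>z. poly P z / (of_real q - z) ^ m"
  have r: "?r \<in> rat_class m q" using assms(3) by (auto simp: rat_class_def)
  let ?S = "\<lambda>r. SUP x\<in>{..0::real}. cmod (exp (of_real (t * x)) - r (of_real x))"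
  have "0 \<le> ?S r" if "r \<in> rat_class m q" for r
    by (rule cSUP_upper2[OF bdd_above_rat_error[OF assms(1,2) that], of 0]) auto
  then have "rat_error m t q \<le> ?S ?r"
    unfolding rat_error_def by (intro cINF_lower[OF _ r]) (auto intro!: bdd_belowI[of _ 0])
  also have "\<dots> \<le> e" by (rule cSUP_least) (use assms(4) in auto)
  finally show ?thesis .
qed

lemma rat_error_ge:
  assumes "q > 0" "t > 0"
    and "\<And>P E. degree P \<le> m \<Longrightarrow>
      (\<And>x. x \<le> 0 \<Longrightarrow> cmod (exp (of_real (t * x)) - poly P (of_real x) / (of_real q - of_real x) ^ m) \<le> E) \<Longrightarrow> e \<le> E"
  shows "rat_error m t q \<ge> e"
  unfolding rat_error_def
proof (rule cINF_greatest)
  have "(\<lambda>z. poly 0 z / (of_real q - z) ^ m) \<in> rat_class m q" unfolding rat_class_def by (rule CollectI) (intro exI[of _ 0], simp)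
  then show "rat_class m q \<noteq> {}" by blast
next
  fix r assume r: "r \<in> rat_class m q"
  then obtain P where P: "degree P \<le> m" "r = (\<lambda>z. poly P z / (of_real q - z) ^ m)"
    by (auto simp: rat_class_def)
  show "e \<le> (SUP x\<in>{..0::real}. cmod (exp (of_real (t * x)) - r (of_real x)))"
  proof (rule assms(3)[OF P(1)])
    fix x :: real assume "x \<le> 0"
    then have "cmod (exp (of_real (t * x)) - r (of_real x)) \<le> (SUP x\<in>{..0::real}. cmod (exp (of_real (t * x)) - r (of_real x)))"
      by (intro cSUP_upper bdd_above_rat_error[OF assms(1,2) r]) auto
    then show "cmod (exp (of_real (t * x)) - poly P (of_real x) / (of_real q - of_real x) ^ m)
        \<le> (SUP x\<in>{..0::real}. cmod (exp (of_real (t * x)) - r (of_real x)))"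
      by (simp add: P(2))
  qed
qed

section \<open>The upper bound by interpolation\<close>

text \<open>
  Divided by \<open>(1 - v\<^sup>2)^n\<close>, the right-hand side is \<open>w^n + 1 / w^n\<close> for the Cayley transform \<open>w\<close> of \<open>v\<close>, twice a Chebyshev
  polynomial of \<open>(w + 1 / w) / 2\<close>. The existence of \<open>N\<close> is the three-term recurrence for the roots \<open>(1 \<plusminus> v)\<^sup>2\<close>.
\<close>

lemma chebyshev_numerator:
  "\<exists>N::complex poly. degree N \<le> n \<and> (\<forall>v. poly N (v\<^sup>2) = (1 + v) ^ (2 * n) + (1 - v) ^ (2 * n))"
proof -
  let ?Q = "\<lambda>n (N::complex poly). degree N \<le> n \<and> (\<forall>v. poly N (v\<^sup>2) = (1 + v) ^ (2 * n) + (1 - v) ^ (2 * n))"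
  have "(\<exists>N. ?Q n N) \<and> (\<exists>N. ?Q (Suc n) N)"
  proof (induction n)
    case 0
    have "?Q 0 [:2:]" by simp
    moreover have "?Q (Suc 0) [:2, 2:]" by (simp add: power2_eq_square algebra_simps)
    ultimately show ?case by blast
  next
    case (Suc n)
    then obtain N M where N: "?Q n N" and M: "?Q (Suc n) M" by blast
    let ?R = "[:2, 2:] * M - [:1, -2, 1:] * N"
    have "degree ([:2, 2:] * M) \<le> Suc (Suc n)"
      using M degree_mult_le[of "[:2, 2:]" M] by simp
    moreover have "degree ([:1, -2, 1:] * N) \<le> Suc (Suc n)"
      using N degree_mult_le[of "[:1, -2, 1:]" N] by simp
    ultimately have "degree ?R \<le> Suc (Suc n)" by (rule degree_diff_le)
    moreover have "poly ?R (v\<^sup>2) = (1 + v) ^ (2 * Suc (Suc n)) + (1 - v) ^ (2 * Suc (Suc n))" for v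
    proof -
      define a b where "a = (1 + v) ^ (2 * n)" and "b = (1 - v) ^ (2 * n)"
      have pows: "(1 + v) ^ (2 * Suc n) = (1 + v)\<^sup>2 * a" "(1 - v) ^ (2 * Suc n) = (1 - v)\<^sup>2 * b"
        "(1 + v) ^ (2 * Suc (Suc n)) = (1 + v)\<^sup>2 * (1 + v)\<^sup>2 * a" "(1 - v) ^ (2 * Suc (Suc n)) = (1 - v)\<^sup>2 * (1 - v)\<^sup>2 * b"
        by (simp_all add: a_def b_def power2_eq_square)
      have "poly ?R (v\<^sup>2) = (2 + 2 * v\<^sup>2) * ((1 + v)\<^sup>2 * a + (1 - v)\<^sup>2 * b) - (1 - v\<^sup>2)\<^sup>2 * (a + b)"
        using N M by (simp add: pows a_def b_def) (simp add: power2_eq_square algebra_simps)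
      also have "\<dots> = (1 + v)\<^sup>2 * (1 + v)\<^sup>2 * a + (1 - v)\<^sup>2 * (1 - v)\<^sup>2 * b" by algebra
      finally show ?thesis by (simp only: pows)
    qed
    ultimately have "?Q (Suc (Suc n)) ?R" by blast
    with M show ?case by blast
  qed
  then show ?thesis by blast
qed

lemma poly_divided_difference:
  fixes A :: "complex poly"
  assumes "degree A \<le> Suc m"
  shows "\<exists>D. \<forall>x X. poly A x - poly A X = (x - X) * (\<Sum>i\<le>m. poly (D i) X * x ^ i)"
proof -
  define D where "D = (\<lambda>j. \<Sum>i=Suc j..Suc m. monom (coeff A i) (i - j - 1))"
  have p: "poly A x = (\<Sum>i\<le>Suc m. coeff A i * x ^ i)" for x
    unfolding poly_altdef using assms by (intro sum.mono_neutral_left) (auto simp: coeff_eq_0)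
  have "poly A x - poly A X = (x - X) * (\<Sum>i\<le>m. poly (D i) X * x ^ i)" for x X
    unfolding p by (subst polyfun_diff) (auto simp: D_def poly_sum poly_monom lessThan_Suc_atMost)
  then show ?thesis by blast
qed

text \<open>
  Polynomial growth along the real line, the condition under which \<open>exp (s v\<^sup>2)\<close> makes a function
  integrable over a vertical line.
\<close>

definition tempered :: "(real \<Rightarrow> complex) \<Rightarrow> bool" where
  "tempered f \<longleftrightarrow> (\<exists>K k. \<forall>y. cmod (f y) \<le> K * (1 + y\<^sup>2) ^ k)"

lemma tempered_bounded: "(\<And>y. cmod (f y) \<le> K) \<Longrightarrow> tempered f"
  unfolding tempered_def by (intro exI[of _ K] exI[of _ 0]) simp

lemma tempered_add:
  assumes "tempered f" "tempered g"
  shows "tempered (\<lambda>y. f y + g y)"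
proof -
  obtain K k K' k' where fg: "\<And>y. cmod (f y) \<le> K * (1 + y\<^sup>2) ^ k" "\<And>y. cmod (g y) \<le> K' * (1 + y\<^sup>2) ^ k'"
    using assms unfolding tempered_def by blast
  have "cmod (f y + g y) \<le> (\<bar>K\<bar> + \<bar>K'\<bar>) * (1 + y\<^sup>2) ^ (k + k')" for y
  proof -
    have "cmod (f y) \<le> \<bar>K\<bar> * (1 + y\<^sup>2) ^ (k + k')"
      by (rule order_trans[OF fg(1)], rule mult_mono) (auto intro: power_increasing)
    moreover have "cmod (g y) \<le> \<bar>K'\<bar> * (1 + y\<^sup>2) ^ (k + k')"
      by (rule order_trans[OF fg(2)], rule mult_mono) (auto intro: power_increasing)
    ultimately show ?thesis
      using norm_triangle_ineq[of "f y" "g y"] by (simp add: distrib_right)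
  qed
  then show ?thesis unfolding tempered_def by blast
qed

lemma tempered_mult:
  assumes "tempered f" "tempered g"
  shows "tempered (\<lambda>y. f y * g y)"
proof -
  obtain K k K' k' where fg: "\<And>y. cmod (f y) \<le> K * (1 + y\<^sup>2) ^ k" "\<And>y. cmod (g y) \<le> K' * (1 + y\<^sup>2) ^ k'"
    using assms unfolding tempered_def by blast
  have "cmod (f y * g y) \<le> (K * K') * (1 + y\<^sup>2) ^ (k + k')" for y
    using mult_mono'[OF fg(1) fg(2), of y y] by (simp add: norm_mult power_add mult_ac)
  then show ?thesis unfolding tempered_def by blast
qed

lemma tempered_diff:
  assumes "tempered f" "tempered g"
  shows "tempered (\<lambda>y. f y - g y)"
  using tempered_add[OF assms(1) tempered_mult[OF tempered_bounded[of "\<lambda>_. -1" 1] assms(2)]] by simp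

lemma tempered_Complex: "tempered (\<lambda>y. Complex c y)"
proof -
  have "cmod (Complex c y) \<le> (\<bar>c\<bar> + 1) * (1 + y\<^sup>2) ^ 1" for y
  proof -
    have "0 \<le> (\<bar>y\<bar> - 1)\<^sup>2" by simp
    then have "\<bar>y\<bar> \<le> 1 + y\<^sup>2" by (simp add: power2_diff)
    moreover have "cmod (Complex c y) \<le> \<bar>c\<bar> + \<bar>y\<bar>" using cmod_le[of "Complex c y"] by simp
    moreover have "(\<bar>c\<bar> + 1) * (1 + y\<^sup>2) ^ 1 = \<bar>c\<bar> + \<bar>c\<bar> * y\<^sup>2 + 1 + y\<^sup>2" by (simp add: algebra_simps)
    moreover have "0 \<le> \<bar>c\<bar> * y\<^sup>2" by simp
    ultimately show ?thesis by linarith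
  qed
  then show ?thesis unfolding tempered_def by blast
qed

lemma tempered_poly:
  assumes "tempered f"
  shows "tempered (\<lambda>y. poly p (f y))"
proof (induction p)
  case 0 show ?case using tempered_bounded[of "\<lambda>_. 0" 0] by simp
next
  case (pCons a p)
  then show ?case using tempered_add[OF tempered_bounded[of "\<lambda>_. a" "cmod a"] tempered_mult[OF assms]] by simp
qed

lemma norm_exp_line:
  "cmod (exp (complex_of_real s * (Complex c y)\<^sup>2)) = exp (s * c\<^sup>2) * exp (- s * y\<^sup>2)"
  by (simp add: Re_power2 exp_add[symmetric] algebra_simps)

lemma continuous_on_Complex [continuous_intros]:
  "continuous_on S f \<Longrightarrow> continuous_on S g \<Longrightarrow> continuous_on S (\<lambda>x. Complex (f x) (g x))"
  unfolding Complex_eq by (intro continuous_intros)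

lemma integrable_exp_tempered:
  assumes "s > 0" "continuous_on UNIV g" "tempered g"
  shows "integrable lborel (\<lambda>y. exp (complex_of_real s * (Complex c y)\<^sup>2) * g y)"
proof -
  obtain K k where K: "\<And>y. cmod (g y) \<le> K * (1 + y\<^sup>2) ^ k"
    using assms(3) unfolding tempered_def by blast
  show ?thesis
  proof (rule integrable_gaussian_bound[OF assms(1)])
    show "continuous_on UNIV (\<lambda>y. exp (complex_of_real s * (Complex c y)\<^sup>2) * g y)"
      by (intro continuous_intros assms(2))
    fix y
    have "cmod (exp (complex_of_real s * (Complex c y)\<^sup>2) * g y) \<le> (exp (s * c\<^sup>2) * exp (- s * y\<^sup>2)) * (K * (1 + y\<^sup>2) ^ k)"
      unfolding norm_mult norm_exp_line by (intro mult_left_mono K) auto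
    then show "cmod (exp (complex_of_real s * (Complex c y)\<^sup>2) * g y) \<le> (exp (s * c\<^sup>2) * K) * (1 + y\<^sup>2) ^ k * exp (- s * y\<^sup>2)"
      by (simp only: mult_ac)
  qed
qed

lemma exp_line_limit: "s > 0 \<Longrightarrow> (\<lambda>n. K * (exp (s * c\<^sup>2) * exp (- s * (real n)\<^sup>2))) \<longlonglongrightarrow> 0"
  by real_asymp

lemma exp_rectangle_bound:
  assumes "s > 0" "- c \<le> Re z" "Re z \<le> c"
  shows "cmod (exp (complex_of_real s * z\<^sup>2)) \<le> exp (s * c\<^sup>2) * exp (- s * (Im z)\<^sup>2)"
proof -
  have "(Re z)\<^sup>2 \<le> c\<^sup>2" using assms(2,3) by (intro power2_le_iff_abs_le[THEN iffD2]) auto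
  then show ?thesis using norm_exp_line[of s "Re z" "Im z"] assms(1) by simp
qed

text \<open>
  Cauchy's formula for the even function \<open>exp (s v\<^sup>2)\<close> in the strip \<open>\<bar>Re v\<bar> < \<xi>\<close> at \<open>i sqrt T\<close>. Reflecting the left
  boundary line onto the right one replaces \<open>1 / (v - i sqrt T)\<close> by \<open>1 / (v - i sqrt T) + 1 / (v + i sqrt T)\<close>.
\<close>

lemma exp_cauchy_line:
  assumes "s > 0" "\<xi> > 0" "T \<ge> 0"
  shows "(\<integral>y. exp (complex_of_real s * (Complex \<xi> y)\<^sup>2) * (2 * Complex \<xi> y / ((Complex \<xi> y)\<^sup>2 + of_real T)) \<partial>lborel)
           = 2 * pi * exp (- s * T)"
proof -
  define \<tau> where "\<tau> = sqrt T"
  define F where "F = (\<lambda>\<sigma> v. exp (complex_of_real s * v\<^sup>2) / (v - \<i> * complex_of_real \<sigma>))"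
  have nz: "Complex c y - \<i> * complex_of_real \<sigma> \<noteq> 0" if "c \<noteq> 0" for c y \<sigma>
    using that by (simp add: complex_eq_iff)
  have int: "integrable lborel (\<lambda>y. F \<sigma> (Complex c y))" if "c \<noteq> 0" for c \<sigma>
  proof -
    have "cmod (1 / (Complex c y - \<i> * complex_of_real \<sigma>)) \<le> 1 / \<bar>c\<bar>" for y
      unfolding norm_divide using abs_Re_le_cmod[of "Complex c y - \<i> * complex_of_real \<sigma>"] that nz[OF that]
      by (intro frac_le) auto
    then have "integrable lborel (\<lambda>y. exp (complex_of_real s * (Complex c y)\<^sup>2) * (1 / (Complex c y - \<i> * complex_of_real \<sigma>)))"
      by (intro integrable_exp_tempered[OF assms(1)] continuous_intros tempered_bounded) (use nz[OF that] in auto)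
    then show ?thesis by (simp add: F_def)
  qed
  have "2 * pi * \<i> * exp (complex_of_real s * (\<i> * complex_of_real \<tau>)\<^sup>2)
      = \<i> * ((\<integral>y. F \<tau> (Complex \<xi> y) \<partial>lborel) - (\<integral>y. F \<tau> (Complex (- \<xi>) y) \<partial>lborel))"
  proof (rule contour_vertical_lines)
    have big: "\<forall>\<^sub>F n in sequentially. real n > \<bar>\<tau>\<bar> + 1"
      by (rule filterlim_real_sequentially[unfolded filterlim_at_top_dense, rule_format])
    show "\<forall>\<^sub>F n in sequentially. (F \<tau> has_contour_integral 2 * pi * \<i> * exp (complex_of_real s * (\<i> * complex_of_real \<tau>)\<^sup>2))
            (rectpath (Complex (- \<xi>) (- real n)) (Complex \<xi> (real n)))"
      using big
    proof eventually_elim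
      case (elim n)
      let ?g = "rectpath (Complex (- \<xi>) (- real n)) (Complex \<xi> (real n))"
      have box: "\<i> * complex_of_real \<tau> \<in> box (Complex (- \<xi>) (- real n)) (Complex \<xi> (real n))"
        using elim assms by (auto simp: in_box_complex_iff)
      have "path_image ?g \<subseteq> UNIV - {\<i> * complex_of_real \<tau>}"
        using path_image_rectpath_inter_box[of "Complex (- \<xi>) (- real n)" "Complex \<xi> (real n)"] box assms by auto
      then have "((\<lambda>w. exp (complex_of_real s * w\<^sup>2) / (w - \<i> * complex_of_real \<tau>)) has_contour_integral
          2 * pi * \<i> * winding_number ?g (\<i> * complex_of_real \<tau>) * exp (complex_of_real s * (\<i> * complex_of_real \<tau>)\<^sup>2)) ?g"
        by (intro Cauchy_integral_formula_convex_simple[of UNIV]) (auto intro!: holomorphic_intros)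
      then show ?case by (simp add: F_def winding_number_rectpath[OF box])
    qed
    show "\<forall>\<^sub>F n in sequentially. \<forall>z. - \<xi> \<le> Re z \<longrightarrow> Re z \<le> \<xi> \<longrightarrow> \<bar>Im z\<bar> = real n \<longrightarrow>
        cmod (F \<tau> z) \<le> 1 * (exp (s * \<xi>\<^sup>2) * exp (- s * (real n)\<^sup>2))"
      using big
    proof (eventually_elim, intro allI impI)
      fix n z assume *: "real n > \<bar>\<tau>\<bar> + 1" "- \<xi> \<le> Re z" "Re z \<le> \<xi>" "\<bar>Im z\<bar> = real n"
      have "1 \<le> cmod (z - \<i> * complex_of_real \<tau>)"
        using abs_Im_le_cmod[of "z - \<i> * complex_of_real \<tau>"] * by auto
      moreover have "cmod (exp (complex_of_real s * z\<^sup>2)) \<le> exp (s * \<xi>\<^sup>2) * exp (- s * (real n)\<^sup>2)"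
        using exp_rectangle_bound[OF assms(1) *(2,3)] *(4) by (metis power2_abs)
      ultimately show "cmod (F \<tau> z) \<le> 1 * (exp (s * \<xi>\<^sup>2) * exp (- s * (real n)\<^sup>2))"
        unfolding F_def norm_divide
        using frac_le[of "exp (s * \<xi>\<^sup>2) * exp (- s * (real n)\<^sup>2)" "cmod (exp (complex_of_real s * z\<^sup>2))" 1 "cmod (z - \<i> * complex_of_real \<tau>)"]
        by simp
    qed
    show "(\<lambda>n. 1 * (exp (s * \<xi>\<^sup>2) * exp (- s * (real n)\<^sup>2))) \<longlonglongrightarrow> 0" by (rule exp_line_limit[OF assms(1)])
  qed (use assms int in auto)
  also have "(\<integral>y. F \<tau> (Complex (- \<xi>) y) \<partial>lborel) = (\<integral>y. F \<tau> (Complex (- \<xi>) (0 + (-1) * y)) \<partial>lborel)"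
    using lborel_integral_real_affine[of "-1" "\<lambda>y. F \<tau> (Complex (- \<xi>) y)" 0] by simp
  also have "\<dots> = (\<integral>y. - F (- \<tau>) (Complex \<xi> y) \<partial>lborel)"
  proof (rule Bochner_Integration.integral_cong)
    fix y
    have neg: "Complex (- \<xi>) (0 + (-1) * y) = - Complex \<xi> y" by (simp add: complex_eq_iff)
    show "F \<tau> (Complex (- \<xi>) (0 + (-1) * y)) = - F (- \<tau>) (Complex \<xi> y)"
      unfolding neg F_def power2_minus
      by (subst minus_divide_right) (simp only: of_real_minus mult_minus_right minus_diff_eq minus_minus diff_conv_add_uminus minus_add_distrib add.commute)
  qed simp
  finally have "2 * pi * exp (complex_of_real s * (\<i> * complex_of_real \<tau>)\<^sup>2)
      = (\<integral>y. F \<tau> (Complex \<xi> y) \<partial>lborel) + (\<integral>y. F (- \<tau>) (Complex \<xi> y) \<partial>lborel)"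
    by (simp add: mult_ac)
  also have "\<dots> = (\<integral>y. F \<tau> (Complex \<xi> y) + F (- \<tau>) (Complex \<xi> y) \<partial>lborel)"
    using int assms by (intro Bochner_Integration.integral_add[symmetric]) auto
  also have "\<dots> = (\<integral>y. exp (complex_of_real s * (Complex \<xi> y)\<^sup>2) * (2 * Complex \<xi> y / ((Complex \<xi> y)\<^sup>2 + of_real T)) \<partial>lborel)"
  proof (rule Bochner_Integration.integral_cong)
    fix y
    define v where "v = Complex \<xi> y"
    have v: "v - \<i> * complex_of_real \<tau> \<noteq> 0" "v + \<i> * complex_of_real \<tau> \<noteq> 0"
      using nz[of \<xi> y \<tau>] nz[of \<xi> y "- \<tau>"] assms by (auto simp: v_def)
    have "complex_of_real T = (complex_of_real \<tau>)\<^sup>2" using assms by (simp add: \<tau>_def flip: of_real_power)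
    then have "v\<^sup>2 + of_real T = (v - \<i> * complex_of_real \<tau>) * (v + \<i> * complex_of_real \<tau>)"
      by (simp add: algebra_simps power2_eq_square)
    then have "1 / (v - \<i> * complex_of_real \<tau>) + 1 / (v + \<i> * complex_of_real \<tau>) = 2 * v / (v\<^sup>2 + of_real T)"
      using v by (simp add: add_frac_eq)
    moreover have "F \<tau> v + F (- \<tau>) v = exp (complex_of_real s * v\<^sup>2) * (1 / (v - \<i> * complex_of_real \<tau>) + 1 / (v + \<i> * complex_of_real \<tau>))"
      by (simp add: F_def distrib_left)
    ultimately show "F \<tau> (Complex \<xi> y) + F (- \<tau>) (Complex \<xi> y) =
        exp (complex_of_real s * (Complex \<xi> y)\<^sup>2) * (2 * Complex \<xi> y / ((Complex \<xi> y)\<^sup>2 + of_real T))"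
      unfolding v_def by simp
  qed simp
  finally have "(\<integral>y. exp (complex_of_real s * (Complex \<xi> y)\<^sup>2) * (2 * Complex \<xi> y / ((Complex \<xi> y)\<^sup>2 + of_real T)) \<partial>lborel)
     = 2 * pi * exp (complex_of_real s * (\<i> * complex_of_real \<tau>)\<^sup>2)" by simp
  also have "complex_of_real s * (\<i> * complex_of_real \<tau>)\<^sup>2 = complex_of_real (- s * T)"
    using assms by (simp add: \<tau>_def power_mult_distrib flip: of_real_power)
  also have "exp (complex_of_real (- s * T)) = complex_of_real (exp (- s * T))" by (rule exp_of_real)
  finally show ?thesis by simp
qed

lemma tempered_mono: "(\<And>y. cmod (f y) \<le> cmod (g y)) \<Longrightarrow> tempered g \<Longrightarrow> tempered f"
  unfolding tempered_def by (meson order_trans)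

lemma cayley_line_norms:
  assumes "\<xi> > 0"
  shows "(cmod (1 + Complex \<xi> y))\<^sup>2 - (cmod (1 - Complex \<xi> y))\<^sup>2 = 4 * \<xi>"
    "1 + Complex \<xi> y \<noteq> 0" "cmod (cayley (Complex \<xi> y)) < 1"
proof -
  show 1: "(cmod (1 + Complex \<xi> y))\<^sup>2 - (cmod (1 - Complex \<xi> y))\<^sup>2 = 4 * \<xi>"
    by (simp add: cmod_power2) (simp add: power2_eq_square algebra_simps)
  show 2: "1 + Complex \<xi> y \<noteq> 0" using assms by (simp add: complex_eq_iff)
  have "(cmod (1 - Complex \<xi> y))\<^sup>2 < (cmod (1 + Complex \<xi> y))\<^sup>2" using 1 assms by linarith
  then have "cmod (1 - Complex \<xi> y) < cmod (1 + Complex \<xi> y)" by (rule power2_less_imp_less) simp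
  then show "cmod (cayley (Complex \<xi> y)) < 1" using 2 by (simp add: cayley_def norm_divide)
qed

text \<open>
  The reciprocal of the Chebyshev factor is small on the line, since there \<open>\<bar>w\<bar> < 1\<close>. The gap
  \<open>\<bar>1 + v\<bar>\<^sup>2 - \<bar>1 - v\<bar>\<^sup>2 = 4 \<xi>\<close> prevents cancellation between the two powers, even where \<open>\<bar>w\<bar>\<close> tends to \<open>1\<close>.
\<close>

lemma chebyshev_numerator_line:
  fixes N :: "complex poly"
  assumes "\<xi> > 0" and N: "\<forall>v. poly N (v\<^sup>2) = (1 + v) ^ (2 * Suc m) + (1 - v) ^ (2 * Suc m)"
  defines "v \<equiv> \<lambda>y. Complex \<xi> y"
  shows "poly N ((v y)\<^sup>2) \<noteq> 0"
    "cmod ((1 - (v y)\<^sup>2) ^ m / poly N ((v y)\<^sup>2)) \<le> cmod (cayley (v y)) ^ m / (4 * \<xi>)"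
proof -
  define p r where "p = cmod (1 + v y)" and "r = cmod (1 - v y)"
  have pr: "p\<^sup>2 - r\<^sup>2 = 4 * \<xi>" "p > 0" "r \<ge> 0" "r < p"
    using cayley_line_norms[OF assms(1), of y] by (auto simp: p_def r_def v_def cayley_def norm_divide)
  have "p ^ (2 * m) * (4 * \<xi>) = p ^ (2 * m) * p\<^sup>2 - p ^ (2 * m) * r\<^sup>2"
    unfolding pr(1)[symmetric] by (simp add: algebra_simps)
  also have "\<dots> \<le> p ^ (2 * m) * p\<^sup>2 - r ^ (2 * m) * r\<^sup>2"
    using pr by (simp add: mult_right_mono power_mono)
  also have "\<dots> = p ^ (2 * Suc m) - r ^ (2 * Suc m)" by (simp add: power2_eq_square)
  also have "\<dots> \<le> cmod (poly N ((v y)\<^sup>2))"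
    unfolding N[rule_format] p_def r_def norm_power[symmetric] by (rule norm_diff_ineq)
  finally have low: "p ^ (2 * m) * (4 * \<xi>) \<le> cmod (poly N ((v y)\<^sup>2))" .
  moreover have lowpos: "p ^ (2 * m) * (4 * \<xi>) > 0" using pr assms(1) by simp
  ultimately show "poly N ((v y)\<^sup>2) \<noteq> 0" by auto
  have "(1 - (v y)\<^sup>2) = (1 - v y) * (1 + v y)" by (simp add: power2_eq_square algebra_simps)
  then have "cmod ((1 - (v y)\<^sup>2) ^ m) = r ^ m * p ^ m"
    by (simp add: norm_power norm_mult power_mult_distrib p_def r_def)
  then have "cmod ((1 - (v y)\<^sup>2) ^ m / poly N ((v y)\<^sup>2)) \<le> r ^ m * p ^ m / (p ^ (2 * m) * (4 * \<xi>))"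
    unfolding norm_divide using low lowpos pr by (intro frac_le) auto
  also have "\<dots> = (r / p) ^ m / (4 * \<xi>)"
    using pr by (simp add: power_divide power_add mult_2)
  finally show "cmod ((1 - (v y)\<^sup>2) ^ m / poly N ((v y)\<^sup>2)) \<le> cmod (cayley (v y)) ^ m / (4 * \<xi>)"
    by (simp add: cayley_def norm_divide p_def r_def)
qed

lemma line_denominator:
  assumes "\<xi> > 0" "T \<ge> 0"
  shows "(Complex \<xi> y)\<^sup>2 + of_real T \<noteq> 0"
    "(1 + T) / cmod ((Complex \<xi> y)\<^sup>2 + of_real T) \<le> 1 + (1 + (cmod (Complex \<xi> y))\<^sup>2) / \<xi>\<^sup>2"
proof -
  define v where "v = Complex \<xi> y"
  define \<tau> where "\<tau> = sqrt T"
  have "complex_of_real T = (complex_of_real \<tau>)\<^sup>2" using assms by (simp add: \<tau>_def flip: of_real_power)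
  then have fac: "v\<^sup>2 + of_real T = (v - \<i> * complex_of_real \<tau>) * (v + \<i> * complex_of_real \<tau>)"
    by (simp add: algebra_simps power2_eq_square)
  have "\<xi> \<le> cmod (v - \<i> * complex_of_real \<tau>)" "\<xi> \<le> cmod (v + \<i> * complex_of_real \<tau>)"
    using abs_Re_le_cmod[of "v - \<i> * complex_of_real \<tau>"] abs_Re_le_cmod[of "v + \<i> * complex_of_real \<tau>"] assms
    by (auto simp: v_def)
  then have low: "\<xi>\<^sup>2 \<le> cmod (v\<^sup>2 + of_real T)"
    using mult_mono[of \<xi> "cmod (v - \<i> * complex_of_real \<tau>)" \<xi> "cmod (v + \<i> * complex_of_real \<tau>)"] assms
    unfolding fac norm_mult power2_eq_square[of \<xi>] by simp
  moreover have x2: "\<xi>\<^sup>2 > 0" using assms by simp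
  ultimately have pos: "cmod (v\<^sup>2 + of_real T) > 0" by linarith
  then show "(Complex \<xi> y)\<^sup>2 + of_real T \<noteq> 0" by (auto simp: v_def)
  have "0 \<le> 1 + T" using assms by simp
  then have "1 + T = cmod (of_real (1 + T))" by (simp only: norm_of_real abs_of_nonneg)
  also have "\<dots> = cmod ((v\<^sup>2 + of_real T) + (1 - v\<^sup>2))" by (rule arg_cong[where f=cmod]) simp
  also have "\<dots> \<le> cmod (v\<^sup>2 + of_real T) + cmod (1 - v\<^sup>2)" by (rule norm_triangle_ineq)
  also have "cmod (1 - v\<^sup>2) \<le> 1 + (cmod v)\<^sup>2" using norm_triangle_ineq4[of 1 "v\<^sup>2"] by (simp add: norm_power)
  finally have "(1 + T) / cmod (v\<^sup>2 + of_real T) \<le> (cmod (v\<^sup>2 + of_real T) + (1 + (cmod v)\<^sup>2)) / cmod (v\<^sup>2 + of_real T)"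
    by (intro divide_right_mono) auto
  also have "\<dots> = 1 + (1 + (cmod v)\<^sup>2) / cmod (v\<^sup>2 + of_real T)" using pos by (simp add: add_divide_distrib)
  also have "\<dots> \<le> 1 + (1 + (cmod v)\<^sup>2) / \<xi>\<^sup>2"
    using low x2 by (intro add_left_mono divide_left_mono mult_pos_pos) (auto intro: pos)
  finally show "(1 + T) / cmod ((Complex \<xi> y)\<^sup>2 + of_real T) \<le> 1 + (1 + (cmod (Complex \<xi> y))\<^sup>2) / \<xi>\<^sup>2"
    by (simp add: v_def)
qed

text \<open>
  Let \<open>W(x) = N(x) / (1 - x)^m\<close> with the Chebyshev numerator \<open>N\<close> of degree \<open>m + 1\<close>. Replacing the Cauchy kernel
  \<open>1 / (X - x)\<close>, \<open>X = v\<^sup>2\<close>, by \<open>(1 - W(x) / W(X)) / (X - x)\<close> turns the integral into a rational function of \<open>x\<close> of the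
  required form, because the numerator vanishes at \<open>x = X\<close>. The error is the integral of
  \<open>exp (s X) W(x) / (W(X) (X - x))\<close>. As \<open>\<bar>N(x)\<bar> \<le> 2 (1 - x)^(m + 1)\<close> for \<open>x \<le> 0\<close>, \<open>W(x)\<close> may grow like \<open>1 - x\<close>, which the
  denominator \<open>X - x\<close> absorbs.
\<close>

lemma hermite_approximant:
  assumes "s > 0" "\<xi> > 0"
  obtains P where "degree P \<le> m"
    "\<And>T. T \<ge> 0 \<Longrightarrow> cmod (exp (- of_real (s * T)) - poly P (- of_real T) / (1 + of_real T) ^ m)
       \<le> (\<integral>y. cmod (exp (complex_of_real s * (Complex \<xi> y)\<^sup>2)) * cmod (cayley (Complex \<xi> y)) ^ m
              * (cmod (Complex \<xi> y) / \<xi> * (1 + (1 + (cmod (Complex \<xi> y))\<^sup>2) / \<xi>\<^sup>2)) \<partial>lborel)"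
proof -
  define v where "v = (\<lambda>y. Complex \<xi> y)"
  define E where "E = (\<lambda>y. exp (complex_of_real s * (v y)\<^sup>2))"
  obtain N :: "complex poly" where N: "degree N \<le> Suc m" "\<forall>v. poly N (v\<^sup>2) = (1 + v) ^ (2 * Suc m) + (1 - v) ^ (2 * Suc m)"
    using chebyshev_numerator by blast
  define B :: "complex poly" where "B = [:1, -1:] ^ m"
  have Bp: "poly B x = (1 - x) ^ m" for x by (simp add: B_def poly_power)
  have "degree B \<le> m" unfolding B_def using degree_power_le[of "[:1, -1::complex:]" m] by simp
  then obtain DB where DB: "\<And>x X. poly B x - poly B X = (x - X) * (\<Sum>i\<le>m. poly (DB i) X * x ^ i)"
    using poly_divided_difference[of B m] by auto
  obtain DN where DN: "\<And>x X. poly N x - poly N X = (x - X) * (\<Sum>i\<le>m. poly (DN i) X * x ^ i)"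
    using poly_divided_difference[OF N(1)] by auto
  note Nline = chebyshev_numerator_line[OF assms(2) N(2), folded v_def]
  define g where "g = (\<lambda>i y. 2 * v y * (poly (DB i) ((v y)\<^sup>2) - (1 - (v y)\<^sup>2) ^ m / poly N ((v y)\<^sup>2) * poly (DN i) ((v y)\<^sup>2)))"
  have cv: "continuous_on UNIV v" unfolding v_def by (intro continuous_intros)
  have tv: "tempered v" unfolding v_def by (rule tempered_Complex)
  have cpoly: "continuous_on UNIV (\<lambda>y. poly p ((v y)\<^sup>2))" for p
    by (intro continuous_intros cv)
  have tpoly: "tempered (\<lambda>y. poly p ((v y)\<^sup>2))" for p
    using tempered_poly[OF tempered_mult[OF tv tv]] by (simp add: power2_eq_square)
  have tempq: "tempered (\<lambda>y. (1 - (v y)\<^sup>2) ^ m / poly N ((v y)\<^sup>2))"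
  proof (rule tempered_bounded)
    fix y
    have "cmod (cayley (v y)) ^ m \<le> 1"
      using cayley_line_norms(3)[OF assms(2), of y] by (intro power_le_one) (auto simp: v_def)
    then show "cmod ((1 - (v y)\<^sup>2) ^ m / poly N ((v y)\<^sup>2)) \<le> 1 / (4 * \<xi>)"
      using assms(2) by (intro order_trans[OF Nline(2)] divide_right_mono) auto
  qed
  have intg: "integrable lborel (\<lambda>y. E y * g i y)" for i
    unfolding E_def v_def
  proof (rule integrable_exp_tempered[OF assms(1)])
    show "continuous_on UNIV (g i)"
      unfolding g_def by (intro continuous_intros cv cpoly) (use Nline(1) in auto)
    show "tempered (g i)"
      unfolding g_def
      by (intro tempered_mult tempered_diff tpoly tempq tv) (rule tempered_bounded[of _ 2], simp)
  qed
  define c where "c = (\<lambda>i. - (1 / (2 * pi)) * (\<integral>y. E y * g i y \<partial>lborel))"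
  define P where "P = (\<Sum>i\<le>m. monom (c i) i)"
  have dP: "degree P \<le> m" unfolding P_def by (rule degree_sum_le) (auto intro: order_trans[OF degree_monom_le])
  have tw: "tempered (\<lambda>y. of_real (1 + (1 + (cmod (v y))\<^sup>2) / \<xi>\<^sup>2))"
  proof -
    have cm: "of_real ((cmod z)\<^sup>2) = z * cnj z" for z by (rule complex_norm_square)
    have tc: "tempered (\<lambda>y. cnj (v y))"
      using tv by (simp add: tempered_def)
    have "tempered (\<lambda>y. (1 + of_real (1 / \<xi>\<^sup>2)) + of_real (1 / \<xi>\<^sup>2) * (v y * cnj (v y)))"
      by (intro tempered_add tempered_mult tc tv) (rule tempered_bounded, rule order_refl)+
    also have "(\<lambda>y. (1 + of_real (1 / \<xi>\<^sup>2)) + of_real (1 / \<xi>\<^sup>2) * (v y * cnj (v y))) =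
       (\<lambda>y. of_real (1 + (1 + (cmod (v y))\<^sup>2) / \<xi>\<^sup>2))"
      unfolding cm[symmetric] by (simp add: add_divide_distrib add.assoc)
    finally show ?thesis .
  qed
  have bound: "cmod (exp (- of_real (s * T)) - poly P (- of_real T) / (1 + of_real T) ^ m)
       \<le> (\<integral>y. cmod (E y) * cmod (cayley (v y)) ^ m * (cmod (v y) / \<xi> * (1 + (1 + (cmod (v y))\<^sup>2) / \<xi>\<^sup>2)) \<partial>lborel)"
    (is "_ \<le> integral\<^sup>L lborel ?G")
    if T: "T \<ge> 0" for T
  proof -
    define x where "x = - complex_of_real T"
    have Bx: "poly B x = (1 + of_real T) ^ m" "poly B x \<noteq> 0"
    proof -
      show "poly B x = (1 + of_real T) ^ m" by (simp add: Bp x_def)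
      moreover have "complex_of_real (1 + T) \<noteq> 0" using T by (simp only: of_real_eq_0_iff)
      ultimately show "poly B x \<noteq> 0" by simp
    qed
    define R where "R = (\<lambda>y. 2 * v y / ((v y)\<^sup>2 - x) * (poly N x * (1 - (v y)\<^sup>2) ^ m / (poly N ((v y)\<^sup>2) * poly B x)))"
    have den: "(v y)\<^sup>2 - x \<noteq> 0" for y using line_denominator(1)[OF assms(2) T, of y] by (simp add: v_def x_def)
    define e where "e = exp (- complex_of_real (s * T))"
    have ce: "complex_of_real (exp (- s * T)) = e"
      unfolding exp_of_real[symmetric] e_def by (rule arg_cong[where f=exp]) simp
    have Cau: "(\<integral>y. E y * (2 * v y / ((v y)\<^sup>2 - x)) \<partial>lborel) = 2 * pi * e"
      using exp_cauchy_line[OF assms T]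
      by (simp only: E_def v_def x_def diff_minus_eq_add of_real_mult ce)
    have Cint: "integrable lborel (\<lambda>y. E y * (2 * v y / ((v y)\<^sup>2 - x)))"
      unfolding E_def v_def
    proof (rule integrable_exp_tempered[OF assms(1)])
      show "continuous_on UNIV (\<lambda>y. 2 * Complex \<xi> y / ((Complex \<xi> y)\<^sup>2 - x))"
        by (intro continuous_intros) (use den in \<open>auto simp: v_def\<close>)
      have b: "tempered (\<lambda>y. 1 / ((Complex \<xi> y)\<^sup>2 - x))"
      proof -
        have b1: "cmod (1 / ((Complex \<xi> y)\<^sup>2 - x)) \<le> (1 + (1 + (cmod (Complex \<xi> y))\<^sup>2) / \<xi>\<^sup>2)" for y
        proof -
          have "cmod (1 / ((Complex \<xi> y)\<^sup>2 - x)) \<le> (1 + T) / cmod ((Complex \<xi> y)\<^sup>2 + of_real T)"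
            using T by (simp add: x_def norm_divide divide_right_mono)
          with line_denominator(2)[OF assms(2) T, of y] show ?thesis by simp
        qed
        show ?thesis
          by (rule tempered_mono[OF _ tw[unfolded v_def]]) (subst norm_of_real, rule order_trans[OF b1 abs_ge_self])
      qed
      have "tempered (\<lambda>y. 2 * Complex \<xi> y * (1 / ((Complex \<xi> y)\<^sup>2 - x)))"
        by (intro tempered_mult b tempered_Complex) (rule tempered_bounded[of _ 2], simp)
      then show "tempered (\<lambda>y. 2 * Complex \<xi> y / ((Complex \<xi> y)\<^sup>2 - x))" by simp
    qed
    have key: "E y * (2 * v y / ((v y)\<^sup>2 - x)) + (\<Sum>i\<le>m. E y * g i y * x ^ i) / poly B x = E y * R y" for y
    proof -
      define X where "X = (v y)\<^sup>2"
      define n b where "n = poly N X" and "b = poly B X"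
      have nz: "n \<noteq> 0" "X - x \<noteq> 0" using Nline(1)[of y] den[of y] by (auto simp: n_def X_def)
      define SB SN where "SB = (\<Sum>i\<le>m. poly (DB i) X * x ^ i)" and "SN = (\<Sum>i\<le>m. poly (DN i) X * x ^ i)"
      have "(\<Sum>i\<le>m. E y * g i y * x ^ i) = E y * (2 * v y) * (SB - b / n * SN)"
        unfolding SB_def SN_def g_def sum_distrib_left sum_subtractf[symmetric]
        by (intro sum.cong) (simp_all add: X_def n_def b_def Bp algebra_simps)
      moreover have "poly B x - b = (x - X) * SB" "poly N x - n = (x - X) * SN"
        unfolding b_def n_def SB_def SN_def by (rule DB DN)+
      then have S: "SB = (b - poly B x) / (X - x)" "SN = (n - poly N x) / (X - x)"
        using nz by (simp_all add: field_simps)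
      have "1 / d + ((b - p) / d - b / n * ((n - n') / d)) / p = 1 / d * (n' * b / (n * p))"
        if "d \<noteq> 0" "p \<noteq> 0" for d p n' :: complex
        using that nz by (simp add: field_simps)
      from this[OF nz(2) Bx(2)]
      have "1 / (X - x) + (SB - b / n * SN) / poly B x = 1 / (X - x) * (poly N x * b / (n * poly B x))"
        unfolding S .
      then have "E y * (2 * v y) * (1 / (X - x) + (SB - b / n * SN) / poly B x) = E y * (2 * v y) * (1 / (X - x) * (poly N x * b / (n * poly B x)))"
        by simp
      ultimately show ?thesis
        by (simp add: R_def X_def[symmetric] n_def[symmetric] b_def[symmetric] Bp[symmetric] distrib_left)
    qed
    have intR: "integrable lborel (\<lambda>y. E y * R y)"
      unfolding key[symmetric] by (intro Bochner_Integration.integrable_add Cint integrable_divide Bochner_Integration.integrable_sum integrable_mult_left intg)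
    have "(\<integral>y. E y * R y \<partial>lborel) = 2 * pi * e + (\<Sum>i\<le>m. (\<integral>y. E y * g i y \<partial>lborel) * x ^ i) / poly B x"
    proof -
      have S: "integrable lborel (\<lambda>y. (\<Sum>i\<le>m. E y * g i y * x ^ i) / poly B x)"
        by (intro integrable_divide Bochner_Integration.integrable_sum integrable_mult_left intg)
      show ?thesis
        unfolding key[symmetric] Bochner_Integration.integral_add[OF Cint S] Cau
        by (simp add: intg Bochner_Integration.integral_sum)
    qed
    also have "(\<Sum>i\<le>m. (\<integral>y. E y * g i y \<partial>lborel) * x ^ i) = - (2 * pi) * poly P x"
      unfolding P_def poly_sum poly_monom sum_distrib_left
      by (intro sum.cong) (simp_all add: c_def)
    finally have "e - poly P x / poly B x = (\<integral>y. E y * R y \<partial>lborel) / (2 * pi)"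
      by (simp add: field_simps)
    then have "cmod (e - poly P x / poly B x) = cmod (\<integral>y. E y * R y \<partial>lborel) / (2 * pi)"
      by (simp add: norm_divide norm_mult)
    also have "\<dots> \<le> cmod (\<integral>y. E y * R y \<partial>lborel) / 1"
      using pi_gt3 by (intro divide_left_mono) auto
    also have "\<dots> \<le> (\<integral>y. cmod (E y * R y) \<partial>lborel)" by simp
    also have "\<dots> \<le> integral\<^sup>L lborel ?G"
    proof (rule integral_mono')
      have "integrable lborel (\<lambda>y. E y * (cayley (v y) ^ m * (v y / of_real \<xi> * of_real (1 + (1 + (cmod (v y))\<^sup>2) / \<xi>\<^sup>2))))"
        unfolding E_def v_def
      proof (rule integrable_exp_tempered[OF assms(1)])
        have one: "1 + v y \<noteq> 0" for y unfolding v_def by (rule cayley_line_norms(2)[OF assms(2)])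
        show "continuous_on UNIV (\<lambda>y. cayley (Complex \<xi> y) ^ m * (Complex \<xi> y / of_real \<xi> * of_real (1 + (1 + (cmod (Complex \<xi> y))\<^sup>2) / \<xi>\<^sup>2)))"
          unfolding cayley_def using assms(2) one by (intro continuous_intros) (auto simp: v_def)
        have "cmod (cayley (v y) ^ m) \<le> 1" for y
          unfolding norm_power using cayley_line_norms(3)[OF assms(2), of y] by (intro power_le_one) (auto simp: v_def)
        then have "tempered (\<lambda>y. cayley (v y) ^ m)" by (rule tempered_bounded)
        from tempered_mult[OF this tempered_mult[OF tempered_mult[OF tv tempered_bounded[of "\<lambda>_. 1 / of_real \<xi>" "cmod (1 / of_real \<xi>)"]] tw]]
        show "tempered (\<lambda>y. cayley (Complex \<xi> y) ^ m * (Complex \<xi> y / of_real \<xi> * of_real (1 + (1 + (cmod (Complex \<xi> y))\<^sup>2) / \<xi>\<^sup>2)))"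
          by (simp add: v_def)
      qed
      from integrable_norm[OF this] show "integrable lborel ?G"
      proof (rule back_subst[where P="integrable lborel"], intro ext)
        fix y
        have "0 \<le> 1 + (1 + (cmod (v y))\<^sup>2) / \<xi>\<^sup>2" by (intro add_nonneg_nonneg divide_nonneg_nonneg) auto
        then show "cmod (E y * (cayley (v y) ^ m * (v y / of_real \<xi> * of_real (1 + (1 + (cmod (v y))\<^sup>2) / \<xi>\<^sup>2)))) = ?G y"
          using assms(2) by (simp only: norm_mult norm_power norm_divide norm_of_real abs_of_nonneg less_imp_le mult.assoc)
      qed
      fix y
      show "0 \<le> ?G y" using assms(2) by (auto intro!: mult_nonneg_nonneg add_nonneg_nonneg)
      have "cmod (poly N x) \<le> 2 * (1 + T) ^ Suc m"
      proof -
        define u where "u = \<i> * complex_of_real (sqrt T)"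
        have "x = u\<^sup>2" using T by (simp add: x_def u_def power_mult_distrib flip: of_real_power)
        then have "poly N x = (1 + u) ^ (2 * Suc m) + (1 - u) ^ (2 * Suc m)" using N(2) by simp
        then have "cmod (poly N x) \<le> ((cmod (1 + u))\<^sup>2) ^ Suc m + ((cmod (1 - u))\<^sup>2) ^ Suc m"
          using norm_triangle_ineq[of "(1 + u) ^ (2 * Suc m)" "(1 - u) ^ (2 * Suc m)"] unfolding norm_power power_mult by simp
        moreover have "(cmod (1 + u))\<^sup>2 = 1 + T" "(cmod (1 - u))\<^sup>2 = 1 + T"
          using T by (simp_all add: cmod_power2 u_def)
        ultimately show ?thesis by simp
      qed
      then have "cmod (poly N x) / cmod (poly B x) \<le> 2 * (1 + T) ^ Suc m / cmod (poly B x)"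
        by (rule divide_right_mono) simp
      also have "\<dots> = 2 * (1 + T)"
      proof -
        have "1 + complex_of_real T = of_real (1 + T)" and pos: "0 \<le> 1 + T" using T by simp_all
        then have "cmod (poly B x) = (1 + T) ^ m" by (simp only: Bx(1) norm_power norm_of_real abs_of_nonneg)
        then show ?thesis using T by simp
      qed
      finally have n1: "cmod (poly N x) / cmod (poly B x) \<le> 2 * (1 + T)" .
      have "cmod (R y) = 2 * cmod (v y) * (1 / cmod ((v y)\<^sup>2 - x)) * (cmod (poly N x) / cmod (poly B x)) * cmod ((1 - (v y)\<^sup>2) ^ m / poly N ((v y)\<^sup>2))"
        by (simp add: R_def norm_mult norm_divide mult_ac)
      also have "\<dots> \<le> 2 * cmod (v y) * (1 / cmod ((v y)\<^sup>2 - x)) * (2 * (1 + T)) * (cmod (cayley (v y)) ^ m / (4 * \<xi>))"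
      proof (rule mult_mono[OF mult_left_mono[OF n1] Nline(2)])
        show "0 \<le> 2 * cmod (v y) * (1 / cmod ((v y)\<^sup>2 - x))" by simp
        then show "0 \<le> 2 * cmod (v y) * (1 / cmod ((v y)\<^sup>2 - x)) * (2 * (1 + T))"
          using T by (intro mult_nonneg_nonneg) auto
      qed simp
      also have "\<dots> = cmod (v y) / \<xi> * ((1 + T) / cmod ((v y)\<^sup>2 - x)) * cmod (cayley (v y)) ^ m"
      proof -
        have "2 * p * (1 / d) * (2 * r) * (k / (4 * x)) = p / x * (r / d) * k" for p d r k x :: real
          by (simp add: mult_ac)
        then show ?thesis .
      qed
      also have "\<dots> \<le> cmod (v y) / \<xi> * (1 + (1 + (cmod (v y))\<^sup>2) / \<xi>\<^sup>2) * cmod (cayley (v y)) ^ m"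
      proof (rule mult_right_mono[OF mult_left_mono])
        show "(1 + T) / cmod ((v y)\<^sup>2 - x) \<le> 1 + (1 + (cmod (v y))\<^sup>2) / \<xi>\<^sup>2"
          using line_denominator(2)[OF assms(2) T, of y] by (simp only: v_def x_def diff_minus_eq_add)
      qed (use assms(2) in auto)
      finally have "cmod (R y) \<le> cmod (v y) / \<xi> * (1 + (1 + (cmod (v y))\<^sup>2) / \<xi>\<^sup>2) * cmod (cayley (v y)) ^ m" .
      from mult_left_mono[OF this norm_ge_zero[of "E y"]]
      have "cmod (E y * R y) \<le> cmod (E y) * (cmod (v y) / \<xi> * (1 + (1 + (cmod (v y))\<^sup>2) / \<xi>\<^sup>2) * cmod (cayley (v y)) ^ m)"
        by (simp only: norm_mult)
      also have "\<dots> = ?G y" by (simp only: mult_ac)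
      finally show "cmod (E y * R y) \<le> ?G y" .
    qed
    finally show ?thesis by (simp only: Bx(1)[symmetric] x_def[symmetric] e_def[symmetric])
  qed
  show ?thesis
    by (rule that[OF dP]) (rule bound[unfolded E_def v_def])
qed

text \<open>
  The weight left over in the error integral grows polynomially, so a small part of the Gaussian decay
  dominates it.
\<close>

lemma line_weight_bound:
  assumes "0 < x1" "\<gamma> > 0"
  shows "\<exists>C>0. \<forall>\<xi> h y. x1 \<le> \<xi> \<longrightarrow> 0 \<le> h \<longrightarrow> \<xi> + h \<le> c \<longrightarrow>
    cmod (Complex \<xi> y) / \<xi> * (1 + (1 + (cmod (Complex \<xi> y))\<^sup>2) / \<xi>\<^sup>2) \<le> C * exp (\<gamma> * (\<bar>y\<bar> - h)\<^sup>2)"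
proof -
  define c' where "c' = max c 1"
  define C0 where "C0 = c' / x1 * (1 + 2 * c'\<^sup>2 / x1\<^sup>2)"
  define C where "C = C0 * (4 * (fact 2 / \<gamma>\<^sup>2 * exp \<gamma>))"
  have c': "c' \<ge> 1" "c' \<ge> c" by (auto simp: c'_def)
  have C0: "C0 > 0" unfolding C0_def using assms(1) c' by (intro mult_pos_pos add_pos_nonneg divide_pos_pos) auto
  have "C > 0" unfolding C_def using C0 assms by simp
  moreover have "cmod (Complex \<xi> y) / \<xi> * (1 + (1 + (cmod (Complex \<xi> y))\<^sup>2) / \<xi>\<^sup>2) \<le> C * exp (\<gamma> * (\<bar>y\<bar> - h)\<^sup>2)"
    if xi: "x1 \<le> \<xi>" "0 \<le> h" "\<xi> + h \<le> c" for \<xi> h y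
  proof -
    define u where "u = \<bar>\<bar>y\<bar> - h\<bar>"
    have u: "u \<ge> 0" by (simp add: u_def)
    have "cmod (Complex \<xi> y) \<le> \<xi> + \<bar>y\<bar>" using cmod_le[of "Complex \<xi> y"] xi assms by simp
    also have "\<dots> \<le> \<xi> + h + u" by (simp add: u_def)
    also have "\<dots> \<le> c' + c' * u" using xi c' u mult_right_mono[OF c'(1) u] by simp
    finally have v: "cmod (Complex \<xi> y) \<le> c' * (1 + u)" by (simp add: algebra_simps)
    have one: "1 \<le> c' * (1 + u)" using c' u mult_mono[of 1 c' 1 "1 + u"] by simp
    have x2: "x1\<^sup>2 \<le> \<xi>\<^sup>2" "x1\<^sup>2 > 0" using xi assms by (auto intro: power_mono)
    have v2: "1 + (cmod (Complex \<xi> y))\<^sup>2 \<le> 2 * (c' * (1 + u))\<^sup>2"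
      using power_mono[OF v, of 2] power_mono[OF one, of 2] by simp
    have "cmod (Complex \<xi> y) / \<xi> * (1 + (1 + (cmod (Complex \<xi> y))\<^sup>2) / \<xi>\<^sup>2)
        \<le> (c' * (1 + u)) / x1 * (1 + 2 * (c' * (1 + u))\<^sup>2 / x1\<^sup>2)"
      using v v2 x2 xi assms c' u by (intro mult_mono frac_le add_mono) (auto intro!: add_nonneg_nonneg)
    also have "\<dots> \<le> (c' * (1 + u)) / x1 * ((1 + u)\<^sup>2 * (1 + 2 * c'\<^sup>2 / x1\<^sup>2))"
    proof (rule mult_left_mono)
      have "1 \<le> (1 + u)\<^sup>2" using u by (simp add: one_le_power)
      moreover have "(c' * (1 + u))\<^sup>2 = (1 + u)\<^sup>2 * c'\<^sup>2" by (simp only: power_mult_distrib mult.commute)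
      then have "2 * (c' * (1 + u))\<^sup>2 / x1\<^sup>2 = (1 + u)\<^sup>2 * (2 * c'\<^sup>2 / x1\<^sup>2)" by simp
      moreover have "(1 + u)\<^sup>2 * (1 + 2 * c'\<^sup>2 / x1\<^sup>2) = (1 + u)\<^sup>2 + (1 + u)\<^sup>2 * (2 * c'\<^sup>2 / x1\<^sup>2)"
        by (simp only: distrib_left mult_1_right)
      ultimately show "1 + 2 * (c' * (1 + u))\<^sup>2 / x1\<^sup>2 \<le> (1 + u)\<^sup>2 * (1 + 2 * c'\<^sup>2 / x1\<^sup>2)"
        by linarith
    qed (use assms c' u in auto)
    also have "\<dots> = C0 * (1 + u) ^ 3" by (simp add: C0_def power3_eq_cube power2_eq_square mult_ac)
    also have "(1 + u) ^ 3 \<le> (1 + u) ^ 4" using u by (intro power_increasing) auto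
    also have "(1 + u) ^ 4 = ((1 + u)\<^sup>2)\<^sup>2" by (simp flip: power_mult)
    also have "((1 + u)\<^sup>2)\<^sup>2 \<le> (2 * (1 + u\<^sup>2))\<^sup>2"
    proof (rule power_mono)
      have "0 \<le> (1 - u)\<^sup>2" by simp
      then show "(1 + u)\<^sup>2 \<le> 2 * (1 + u\<^sup>2)" by (simp add: power2_sum power2_diff)
    qed simp
    also have "\<dots> = 4 * (1 + u\<^sup>2) ^ 2" by (subst power_mult_distrib) simp
    also have "(1 + u\<^sup>2) ^ 2 \<le> fact 2 / \<gamma> ^ 2 * exp (\<gamma> * (1 + u\<^sup>2))"
      using assms by (intro power_le_exp) auto
    also have "exp (\<gamma> * (1 + u\<^sup>2)) = exp \<gamma> * exp (\<gamma> * u\<^sup>2)" by (simp add: distrib_left exp_add)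
    finally show ?thesis using C0 by (simp add: C_def u_def mult_ac)
  qed
  ultimately show ?thesis by blast
qed

lemma two_gaussians_integral:
  assumes "\<beta> > 0"
  shows "integrable lborel (\<lambda>y. exp (- \<beta> * (\<bar>y\<bar> - h)\<^sup>2))"
    "(\<integral>y. exp (- \<beta> * (\<bar>y\<bar> - h)\<^sup>2) \<partial>lborel) \<le> 2 * sqrt (pi / \<beta>)"
proof -
  have le: "exp (- \<beta> * (\<bar>y\<bar> - h)\<^sup>2) \<le> exp (- \<beta> * (y - h)\<^sup>2) + exp (- \<beta> * (y - (- h))\<^sup>2)" for y
  proof (cases "y \<ge> 0")
    case False
    then have "(\<bar>y\<bar> - h)\<^sup>2 = (y - (- h))\<^sup>2" by (simp add: power2_eq_square algebra_simps)
    then show ?thesis by simp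
  qed simp
  have int: "integrable lborel (\<lambda>y. exp (- \<beta> * (y - h)\<^sup>2) + exp (- \<beta> * (y - (- h))\<^sup>2))"
    by (intro Bochner_Integration.integrable_add gaussian_integral(1) assms)
  show 1: "integrable lborel (\<lambda>y. exp (- \<beta> * (\<bar>y\<bar> - h)\<^sup>2))"
    by (rule Bochner_Integration.integrable_bound[OF int]) (use le in auto)
  have "(\<integral>y. exp (- \<beta> * (\<bar>y\<bar> - h)\<^sup>2) \<partial>lborel) \<le> (\<integral>y. exp (- \<beta> * (y - h)\<^sup>2) + exp (- \<beta> * (y - (- h))\<^sup>2) \<partial>lborel)"
    by (intro integral_mono 1 int le)
  also have "\<dots> = 2 * sqrt (pi / \<beta>)"
    by (subst Bochner_Integration.integral_add[OF gaussian_integral(1)[OF assms] gaussian_integral(1)[OF assms]])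
      (simp only: gaussian_integral(2)[OF assms] mult_2)
  finally show "(\<integral>y. exp (- \<beta> * (\<bar>y\<bar> - h)\<^sup>2) \<partial>lborel) \<le> 2 * sqrt (pi / \<beta>)" .
qed

lemma admissible_interval_bounds:
  assumes "admissible x1" "x1 \<le> x2"
  obtains d c where "d > 0" "\<And>\<xi>. \<xi> \<in> {x1..x2} \<Longrightarrow> d \<le> decay \<xi>" "\<And>\<xi>. \<xi> \<in> {x1..x2} \<Longrightarrow> \<xi> + saddle_height \<xi> \<le> c"
proof -
  have sub: "{x1..x2} \<subseteq> {x. admissible x}" using admissible_mono[OF assms(1)] by auto
  have ne: "{x1..x2} \<noteq> {}" using assms(2) by simp
  obtain u where u: "u \<in> {x1..x2}" "\<And>\<xi>. \<xi> \<in> {x1..x2} \<Longrightarrow> decay u \<le> decay \<xi>"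
    using continuous_attains_inf[OF compact_Icc ne continuous_on_subset[OF continuous_on_saddle_data(5) sub]] by blast
  have "continuous_on {x1..x2} (\<lambda>x. x + saddle_height x)"
    by (intro continuous_intros continuous_on_subset[OF continuous_on_saddle_data(2) sub])
  from continuous_attains_sup[OF compact_Icc ne this] obtain w
    where w: "\<And>\<xi>. \<xi> \<in> {x1..x2} \<Longrightarrow> \<xi> + saddle_height \<xi> \<le> w + saddle_height w" by blast
  show ?thesis
    by (rule that[of "decay u"]) (use u w sub decay_pos in auto)
qed

text \<open>
  Half of the decay rate is spent on the weight; since \<open>m \<ge> 1\<close>, at least a Gaussian of rate proportional to \<open>m\<close>
  survives, whose integral gives the factor \<open>1 / sqrt m\<close>.
\<close>

lemma rat_error_upper_uniform:
  assumes "admissible x1" "x1 \<le> x2" "t > 0"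
  shows "\<exists>C>0. \<forall>\<xi>\<in>{x1..x2}. \<forall>m\<ge>1. rat_error m t (q_pole t (alpha_of \<xi>) m) \<le> C * level \<xi> ^ m / sqrt m"
proof -
  obtain d c where dc: "d > 0" "\<And>\<xi>. \<xi> \<in> {x1..x2} \<Longrightarrow> d \<le> decay \<xi>" "\<And>\<xi>. \<xi> \<in> {x1..x2} \<Longrightarrow> \<xi> + saddle_height \<xi> \<le> c"
    using admissible_interval_bounds[OF assms(1,2)] by blast
  obtain C where C: "C > 0" "\<And>\<xi> h y. x1 \<le> \<xi> \<Longrightarrow> 0 \<le> h \<Longrightarrow> \<xi> + h \<le> c \<Longrightarrow>
    cmod (Complex \<xi> y) / \<xi> * (1 + (1 + (cmod (Complex \<xi> y))\<^sup>2) / \<xi>\<^sup>2) \<le> C * exp (d / 2 * (\<bar>y\<bar> - h)\<^sup>2)"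
    using line_weight_bound[of x1 "d / 2" c] admissibleD(1)[OF assms(1)] dc(1) by auto
  define C' where "C' = C * (2 * sqrt (pi / (d / 2)))"
  have "rat_error m t (q_pole t (alpha_of \<xi>) m) \<le> C' * level \<xi> ^ m / sqrt m"
    if xi: "\<xi> \<in> {x1..x2}" and m: "m \<ge> 1" for \<xi> and m :: nat
  proof -
    have adm: "admissible \<xi>" using xi admissible_mono[OF assms(1)] by auto
    note a = admissibleD[OF adm]
    define \<alpha> h q s where "\<alpha> = alpha_of \<xi>" and "h = saddle_height \<xi>" and "q = q_pole t \<alpha> m" and "s = \<alpha> * m"
    have s: "s > 0" and q: "q > 0" "t * q = s" using a m assms(3) by (auto simp: s_def \<alpha>_def q_def q_pole_def)
    let ?G = "\<lambda>y. cmod (exp (complex_of_real s * (Complex \<xi> y)\<^sup>2)) * cmod (cayley (Complex \<xi> y)) ^ m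
              * (cmod (Complex \<xi> y) / \<xi> * (1 + (1 + (cmod (Complex \<xi> y))\<^sup>2) / \<xi>\<^sup>2))"
    have G: "?G y \<le> level \<xi> ^ m * C * exp (- (m * d / 2) * (\<bar>y\<bar> - h)\<^sup>2)" for y
    proof -
      have "cmod (exp (complex_of_real s * (Complex \<xi> y)\<^sup>2)) * cmod (cayley (Complex \<xi> y)) ^ m
          = cmod (cayley (Complex \<xi> y) * exp (of_real \<alpha> * (Complex \<xi> y)\<^sup>2)) ^ m"
        by (simp add: s_def norm_mult power_mult_distrib exp_of_nat_mult[symmetric] norm_power[symmetric] mult_ac)
      also have "\<dots> \<le> (level \<xi> * exp (- decay \<xi> * (\<bar>y\<bar> - h)\<^sup>2)) ^ m"
        unfolding \<alpha>_def h_def by (intro power_mono level_line_gaussian_bound adm) auto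
      also have "\<dots> \<le> (level \<xi> * exp (- d * (\<bar>y\<bar> - h)\<^sup>2)) ^ m"
        using dc(2)[OF xi] level_pos[OF adm] by (intro power_mono mult_left_mono) (auto intro!: mult_right_mono)
      also have "\<dots> = level \<xi> ^ m * exp (- (m * d) * (\<bar>y\<bar> - h)\<^sup>2)"
        by (simp add: power_mult_distrib exp_of_nat_mult[symmetric] mult_ac)
      finally have A: "cmod (exp (complex_of_real s * (Complex \<xi> y)\<^sup>2)) * cmod (cayley (Complex \<xi> y)) ^ m
          \<le> level \<xi> ^ m * exp (- (m * d) * (\<bar>y\<bar> - h)\<^sup>2)" .
      have B: "cmod (Complex \<xi> y) / \<xi> * (1 + (1 + (cmod (Complex \<xi> y))\<^sup>2) / \<xi>\<^sup>2) \<le> C * exp (d / 2 * (\<bar>y\<bar> - h)\<^sup>2)"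
        using dc(3)[OF xi] a xi by (intro C(2)) (auto simp: h_def)
      have "?G y \<le> (level \<xi> ^ m * exp (- (m * d) * (\<bar>y\<bar> - h)\<^sup>2)) * (C * exp (d / 2 * (\<bar>y\<bar> - h)\<^sup>2))"
        by (rule mult_mono[OF A B]) (use a C(1) level_pos[OF adm] in \<open>auto intro!: mult_nonneg_nonneg add_nonneg_nonneg\<close>)
      also have "\<dots> = level \<xi> ^ m * C * exp (- (m * d - d / 2) * (\<bar>y\<bar> - h)\<^sup>2)"
        by (simp add: exp_add[symmetric] algebra_simps)
      also have "\<dots> \<le> level \<xi> ^ m * C * exp (- (m * d / 2) * (\<bar>y\<bar> - h)\<^sup>2)"
      proof -
        have "1 * d \<le> m * d" using m dc(1) by (intro mult_right_mono) auto
        then have "m * d / 2 \<le> m * d - d / 2" by linarith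
        then have "(m * d / 2) * (\<bar>y\<bar> - h)\<^sup>2 \<le> (m * d - d / 2) * (\<bar>y\<bar> - h)\<^sup>2" by (rule mult_right_mono) simp
        then have "exp (- (m * d - d / 2) * (\<bar>y\<bar> - h)\<^sup>2) \<le> exp (- (m * d / 2) * (\<bar>y\<bar> - h)\<^sup>2)"
          by (simp only: mult_minus_left exp_le_cancel_iff neg_le_iff_le)
        then show ?thesis using C(1) level_pos[OF adm] by (intro mult_left_mono) auto
      qed
      finally show ?thesis .
    qed
    have md: "m * d / 2 > 0" using m dc(1) by simp
    have "integral\<^sup>L lborel ?G \<le> (\<integral>y. level \<xi> ^ m * C * exp (- (m * d / 2) * (\<bar>y\<bar> - h)\<^sup>2) \<partial>lborel)"
    proof (rule integral_mono'[OF integrable_mult_right[OF two_gaussians_integral(1)[OF md]] G])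
      fix y show "0 \<le> level \<xi> ^ m * C * exp (- (m * d / 2) * (\<bar>y\<bar> - h)\<^sup>2)"
        using C(1) level_pos[OF adm] by simp
    qed
    also have "\<dots> = level \<xi> ^ m * C * (\<integral>y. exp (- (m * d / 2) * (\<bar>y\<bar> - h)\<^sup>2) \<partial>lborel)" by simp
    also have "\<dots> \<le> level \<xi> ^ m * C * (2 * sqrt (pi / (m * d / 2)))"
      using C(1) level_pos[OF adm] by (intro mult_left_mono two_gaussians_integral(2) md) auto
    also have "\<dots> = C' * level \<xi> ^ m / sqrt m"
      using m by (simp add: C'_def real_sqrt_divide real_sqrt_mult mult_ac)
    finally have int: "integral\<^sup>L lborel ?G \<le> C' * level \<xi> ^ m / sqrt m" .
    obtain P where P: "degree P \<le> m"
      "\<And>T. T \<ge> 0 \<Longrightarrow> cmod (exp (- of_real (s * T)) - poly P (- of_real T) / (1 + of_real T) ^ m) \<le> integral\<^sup>L lborel ?G"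
      using hermite_approximant[OF s a(1), of m] by blast
    define P' where "P' = smult (of_real q ^ m) (pcompose P [:0, 1 / of_real q:])"
    have "rat_error m t q \<le> C' * level \<xi> ^ m / sqrt m"
    proof (rule rat_error_le[OF q(1) assms(3)])
      have "degree P' \<le> degree P * degree [:0, 1 / complex_of_real q:]"
        unfolding P'_def by (rule order_trans[OF degree_smult_le degree_pcompose_le])
      also have "\<dots> \<le> m" using P(1) by simp
      finally show "degree P' \<le> m" .
      fix x :: real assume x: "x \<le> 0"
      define T where "T = - x / q"
      have T: "T \<ge> 0" using x q by (simp add: T_def divide_nonpos_pos)
      have xT: "x = - q * T" using q by (simp add: T_def)
      have cq: "complex_of_real q \<noteq> 0" using q by simp
      have "of_real q - of_real x = complex_of_real q * (1 + of_real T)" by (simp add: xT algebra_simps)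
      then have "poly P' (of_real x) / (of_real q - of_real x) ^ m = poly P (- of_real T) / (1 + of_real T) ^ m"
        using cq by (simp add: P'_def poly_pcompose xT power_mult_distrib)
      moreover have "complex_of_real (t * x) = - of_real (s * T)"
        by (simp add: xT flip: q(2))
      ultimately show "cmod (exp (of_real (t * x)) - poly P' (of_real x) / (of_real q - of_real x) ^ m) \<le> C' * level \<xi> ^ m / sqrt m"
        using P(2)[OF T] int by simp
    qed
    then show ?thesis by (simp add: q_def \<alpha>_def)
  qed
  moreover have "C' > 0" using C(1) dc(1) by (simp add: C'_def)
  ultimately show ?thesis by blast
qed

section \<open>Functionals that annihilate the rational class\<close>

lemma norm_one_plus_imaginary: "(cmod (1 + Complex 0 y))\<^sup>2 = 1 + y\<^sup>2"
  by (simp add: cmod_power2)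

lemma one_plus_imaginary_nonzero: "1 + Complex 0 y \<noteq> 0" "1 - Complex 0 y \<noteq> 0"
  by (simp_all add: complex_eq_iff)

lemma cauchy_density:
  "integrable lborel (\<lambda>y::real. 1 / (1 + y\<^sup>2))" "(\<integral>y. 1 / (1 + y\<^sup>2) \<partial>lborel) = pi"
  using integrable_inverse_1_plus_square LBINT_inverse_1_plus_square
  by (simp_all add: set_integrable_def interval_lebesgue_integral_def set_lebesgue_integral_def einterval_def inverse_eq_divide)

text \<open>
  The antiderivative \<open>i / (k - 1) (1 + i y)^(1 - k)\<close> vanishes at both ends.
\<close>

lemma inverse_power_integral_zero:
  assumes "k \<ge> 2"
  shows "has_bochner_integral lborel (\<lambda>y. 1 / (1 + Complex 0 y) ^ k) 0"
proof -
  let ?f = "\<lambda>y. 1 / (1 + Complex 0 y) ^ k"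
  have int: "integrable lborel ?f"
  proof (rule Bochner_Integration.integrable_bound[OF cauchy_density(1)])
    have "continuous_on UNIV ?f" by (intro continuous_intros) (simp add: one_plus_imaginary_nonzero)
    then show "?f \<in> borel_measurable lborel" by (simp add: borel_measurable_continuous_onI)
    show "AE y in lborel. norm (?f y) \<le> norm (1 / (1 + y\<^sup>2))"
    proof (rule AE_I2)
      fix y :: real
      have "1\<^sup>2 \<le> (cmod (1 + Complex 0 y))\<^sup>2" by (simp add: norm_one_plus_imaginary)
      then have "1 \<le> cmod (1 + Complex 0 y)" by (rule power2_le_imp_le) simp
      then have "(cmod (1 + Complex 0 y))\<^sup>2 \<le> cmod (1 + Complex 0 y) ^ k" using assms by (intro power_increasing)
      then show "norm (?f y) \<le> norm (1 / (1 + y\<^sup>2))"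
        unfolding norm_one_plus_imaginary
        by (simp add: norm_divide norm_power abs_of_pos add_pos_nonneg) (intro divide_left_mono mult_pos_pos; simp add: add_pos_nonneg norm_one_plus_imaginary one_plus_imaginary_nonzero)
    qed
  qed
  define F where "F = (\<lambda>y. \<i> / of_nat (k - 1) / (1 + Complex 0 y) ^ (k - 1))"
  have "integral\<^sup>L lborel ?f = 0"
  proof (rule integral_eq_lim_truncations[OF int])
    show "(?f has_integral (F (real n) - F (- real n))) {- real n..real n}" for n
    proof (rule fundamental_theorem_of_calculus)
      fix y
      obtain j where k: "k = Suc (Suc j)" using assms by (metis add_2_eq_Suc le_Suc_ex)
      have Fc: "F = (\<lambda>y. \<i> / of_nat (Suc j) / (1 + \<i> * complex_of_real y) ^ Suc j)"
        by (simp add: F_def k Complex_eq)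
      have nz: "1 + \<i> * complex_of_real y \<noteq> 0" using one_plus_imaginary_nonzero(1)[of y] by (simp add: Complex_eq)
      have "((\<lambda>z. \<i> / of_nat (Suc j) / (1 + \<i> * z) ^ Suc j) has_field_derivative 1 / (1 + \<i> * of_real y) ^ k) (at (of_real y))"
      proof -
        have "((\<lambda>z. \<i> / of_nat (Suc j) / (1 + \<i> * z) ^ Suc j) has_field_derivative
          - (\<i> / of_nat (Suc j)) * (of_nat (Suc j) * (\<i> * (1 + \<i> * of_real y) ^ j)) / ((1 + \<i> * of_real y) ^ Suc j * (1 + \<i> * of_real y) ^ Suc j)) (at (of_real y))"
          by (rule derivative_eq_intros refl | use nz in simp)+
        also have "- (\<i> / of_nat (Suc j)) * (of_nat (Suc j) * (\<i> * (1 + \<i> * of_real y) ^ j)) / ((1 + \<i> * of_real y) ^ Suc j * (1 + \<i> * of_real y) ^ Suc j) = 1 / (1 + \<i> * of_real y) ^ k"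
          using nz by (simp add: k del: of_nat_Suc)
        finally show ?thesis .
      qed
      from has_vector_derivative_real_field[OF this]
      show "(F has_vector_derivative ?f y) (at y within {- real n..real n})"
        unfolding Fc by (simp add: Complex_eq)
    qed auto
    have F_le: "norm (F y) \<le> 1 / \<bar>y\<bar>" if "y \<noteq> 0" for y
    proof -
      have u: "1 \<le> cmod (1 + Complex 0 y)" "\<bar>y\<bar> \<le> cmod (1 + Complex 0 y)"
        using abs_Re_le_cmod[of "1 + Complex 0 y"] abs_Im_le_cmod[of "1 + Complex 0 y"] by auto
      have "cmod (1 + Complex 0 y) ^ 1 \<le> cmod (1 + Complex 0 y) ^ (k - 1)"
        using u(1) assms by (intro power_increasing) auto
      with u(2) have "\<bar>y\<bar> \<le> cmod (1 + Complex 0 y) ^ (k - 1)" by simp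
      moreover have "norm (\<i> / of_nat (k - 1)) \<le> 1" using assms by (simp add: norm_divide divide_le_eq_1 del: of_nat_diff)
      ultimately show ?thesis
        unfolding F_def norm_divide[of "\<i> / of_nat (k - 1)"] norm_power using that by (intro frac_le) auto
    qed
    show "(\<lambda>n. F (real n) - F (- real n)) \<longlonglongrightarrow> 0"
    proof (rule Lim_null_comparison)
      show "\<forall>\<^sub>F n in sequentially. norm (F (real n) - F (- real n)) \<le> 2 / real n"
        using eventually_gt_at_top[of 0]
      proof eventually_elim
        case (elim n)
        then show ?case
          using F_le[of "real n"] F_le[of "- real n"] norm_triangle_ineq4[of "F (real n)" "F (- real n)"] by simp
      qed
      show "(\<lambda>n. 2 / real n) \<longlonglongrightarrow> 0" by real_asymp
    qed
  qed
  then show ?thesis using int by (simp add: has_bochner_integral_iff)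
qed

text \<open>
  In the variable \<open>u = 1 + i y\<close> one has \<open>- y\<^sup>2 = (u - 1)\<^sup>2\<close>, \<open>1 + y\<^sup>2 = u (2 - u)\<close> and \<open>w = (2 - u) / u\<close>. The powers of \<open>2 - u\<close>
  cancel, and a combination of powers \<open>u^(- k)\<close> with \<open>k \<ge> 2\<close> is left.
\<close>

lemma rational_class_annihilated:
  assumes "degree P \<le> m" "q > 0"
  shows "has_bochner_integral lborel (\<lambda>y. poly P (of_real (- q * y\<^sup>2)) / (of_real q - of_real (- q * y\<^sup>2)) ^ m
     * (cayley (Complex 0 y) ^ m * (cayley (Complex 0 y) - c) / (1 + Complex 0 y)\<^sup>2)) 0"
proof -
  define G where "G = pcompose P (smult (of_real q) ([:-1, 1:]\<^sup>2))"
  have dG: "degree G \<le> 2 * m"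
  proof -
    have "degree (([:-1, 1:] :: complex poly)\<^sup>2) \<le> 2" using degree_power_le[of "[:-1, 1::complex:]" 2] by simp
    then have "degree (smult (of_real q) (([:-1, 1:] :: complex poly)\<^sup>2)) \<le> 2" by (rule order_trans[OF degree_smult_le])
    then have "degree P * degree (smult (of_real q) (([:-1, 1:] :: complex poly)\<^sup>2)) \<le> m * 2"
      using assms(1) by (intro mult_le_mono) auto
    then show ?thesis unfolding G_def using degree_pcompose_le[of P "smult (of_real q) (([:-1, 1:] :: complex poly)\<^sup>2)"] by linarith
  qed
  let ?u = "\<lambda>y. 1 + Complex 0 y"
  have hb: "has_bochner_integral lborel (\<lambda>y. \<Sum>i\<le>2*m. coeff G i / of_real q ^ m * (2 * (1 / ?u y ^ (2 * m + 3 - i)) - (1 + c) * (1 / ?u y ^ (2 * m + 2 - i))))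
       (\<Sum>i\<le>2*m. coeff G i / of_real q ^ m * (2 * 0 - (1 + c) * 0))"
    by (intro has_bochner_integral_sum has_bochner_integral_mult_right has_bochner_integral_diff inverse_power_integral_zero) auto
  have eq: "poly P (of_real (- q * y\<^sup>2)) / (of_real q - of_real (- q * y\<^sup>2)) ^ m
     * (cayley (Complex 0 y) ^ m * (cayley (Complex 0 y) - c) / (1 + Complex 0 y)\<^sup>2)
     = (\<Sum>i\<le>2*m. coeff G i / of_real q ^ m * (2 * (1 / ?u y ^ (2 * m + 3 - i)) - (1 + c) * (1 / ?u y ^ (2 * m + 2 - i))))" for y
  proof -
    define u where "u = ?u y"
    have u: "u \<noteq> 0" "2 - u \<noteq> 0" using one_plus_imaginary_nonzero[of y] by (simp_all add: u_def)
    have q: "complex_of_real q \<noteq> 0" using assms(2) by simp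
    have y2: "complex_of_real (- (y\<^sup>2)) = (u - 1)\<^sup>2" by (simp add: u_def complex_eq_iff power2_eq_square)
    have e1: "complex_of_real (- q * y\<^sup>2) = of_real q * (u - 1)\<^sup>2"
      unfolding y2[symmetric] by simp
    have pG: "poly P (of_real (- q * y\<^sup>2)) = poly G u"
      unfolding e1 by (simp add: G_def poly_pcompose)
    have dn: "of_real q - complex_of_real (- q * y\<^sup>2) = of_real q * (u * (2 - u))"
      unfolding e1 by (simp add: algebra_simps power2_eq_square)
    have cay: "cayley (Complex 0 y) = (2 - u) / u" by (simp add: cayley_def u_def)
    have "poly P (of_real (- q * y\<^sup>2)) / (of_real q - of_real (- q * y\<^sup>2)) ^ m
     * (cayley (Complex 0 y) ^ m * (cayley (Complex 0 y) - c) / (1 + Complex 0 y)\<^sup>2)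
     = poly G u / of_real q ^ m * ((2 / u - (1 + c)) / u ^ (2 * m + 2))"
    proof -
      have "(2 - u) / u - c = 2 / u - (1 + c)" using u by (simp add: field_simps)
      moreover have "u ^ (2 * m + 2) = (u * (2 - u)) ^ m * (u\<^sup>2 * (u / (2 - u)) ^ m)"
      proof -
        have "(u * (2 - u)) ^ m * (u / (2 - u)) ^ m = (u * u) ^ m" using u by (simp flip: power_mult_distrib)
        also have "\<dots> = u ^ (2 * m)" by (simp add: power_mult power2_eq_square)
        finally have "u ^ (2 * m) = (u * (2 - u)) ^ m * (u / (2 - u)) ^ m" by (rule sym)
        moreover have "u ^ (2 * m + 2) = u ^ (2 * m) * u\<^sup>2" by (rule power_add)
        ultimately show ?thesis by (simp only: mult_ac)
      qed
      moreover have "((2 - u) / u) ^ m * (u / (2 - u)) ^ m = 1" using u by (simp add: power_mult_distrib[symmetric])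
      ultimately show ?thesis
        unfolding pG dn cay u_def[symmetric] power_mult_distrib[of "of_real q"] using u q
        by (simp add: divide_simps)
    qed
    also have "\<dots> = (\<Sum>i\<le>2*m. coeff G i * u ^ i) / of_real q ^ m * ((2 / u - (1 + c)) / u ^ (2 * m + 2))"
      unfolding poly_altdef using dG
      by (subst sum.mono_neutral_left[of "{..2*m}" "{..degree G}"]) (auto simp: coeff_eq_0)
    also have "\<dots> = (\<Sum>i\<le>2*m. coeff G i / of_real q ^ m * (2 * (1 / u ^ (2 * m + 3 - i)) - (1 + c) * (1 / u ^ (2 * m + 2 - i))))"
      unfolding sum_divide_distrib sum_distrib_right
    proof (rule sum.cong[OF refl])
      fix i assume "i \<in> {..2 * m}"
      then obtain j where j: "2 * m = i + j" by (auto simp: le_iff_add)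
      show "coeff G i * u ^ i / of_real q ^ m * ((2 / u - (1 + c)) / u ^ (2 * m + 2)) =
        coeff G i / of_real q ^ m * (2 * (1 / u ^ (2 * m + 3 - i)) - (1 + c) * (1 / u ^ (2 * m + 2 - i)))"
        unfolding j using u q by (simp add: power_add divide_simps) (simp add: algebra_simps eval_nat_numeral)?
    qed
    finally show ?thesis by (simp add: u_def)
  qed
  show ?thesis unfolding eq using hb by simp
qed

lemma cayley_right_half_plane:
  assumes "Re v \<ge> 0"
  shows "cmod (cayley v) \<le> 1" "cmod (1 + v) \<ge> 1" "1 + v \<noteq> 0"
proof -
  have "(cmod (1 - v))\<^sup>2 \<le> (cmod (1 + v))\<^sup>2" using assms unfolding cmod_power2 by (simp add: power2_eq_square algebra_simps)
  then have "cmod (1 - v) \<le> cmod (1 + v)" by (rule power2_le_imp_le) simp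
  moreover show 1: "cmod (1 + v) \<ge> 1" using abs_Re_le_cmod[of "1 + v"] assms by simp
  then show "1 + v \<noteq> 0" by auto
  ultimately show "cmod (cayley v) \<le> 1" using 1 by (simp add: cayley_def norm_divide divide_le_eq_1)
qed

text \<open>
  On the imaginary axis the kernel is at most \<open>2 / (1 + y\<^sup>2)\<close> when \<open>\<bar>c\<bar> \<le> 1\<close>, so the functional that it defines has
  norm at most \<open>2 \<pi>\<close>. The constant \<open>c\<close> is at our disposal and later removes one of the saddle points.
\<close>

definition test_kernel :: "nat \<Rightarrow> complex \<Rightarrow> complex \<Rightarrow> complex" where
  "test_kernel m c v = cayley v ^ m * (cayley v - c) / (1 + v)\<^sup>2"

lemma norm_test_kernel:
  assumes "Re v \<ge> 0" "cmod c \<le> 1"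
  shows "cmod (test_kernel m c v) \<le> 2 / (cmod (1 + v))\<^sup>2" "cmod (test_kernel m c v) \<le> 2"
proof -
  note r = cayley_right_half_plane[OF assms(1)]
  have "cmod (cayley v ^ m) * cmod (cayley v - c) \<le> 1 * 2"
    using r(1) assms(2) norm_triangle_ineq4[of "cayley v" c] by (intro mult_mono) (auto simp: norm_power power_le_one)
  then show 1: "cmod (test_kernel m c v) \<le> 2 / (cmod (1 + v))\<^sup>2"
    by (simp add: test_kernel_def norm_divide norm_mult norm_power divide_right_mono)
  also have "\<dots> \<le> 2 / 1" using r(2) by (intro divide_left_mono) (auto simp: one_le_power)
  finally show "cmod (test_kernel m c v) \<le> 2" by simp
qed

lemma continuous_on_test_kernel_line:
  assumes "x \<ge> 0"
  shows "continuous_on UNIV (\<lambda>y. test_kernel m c (Complex x y))"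
  unfolding test_kernel_def cayley_def
  by (intro continuous_intros) (use cayley_right_half_plane(3) assms in auto)

lemma integrable_exp_test_kernel:
  assumes "s > 0" "x \<ge> 0" "cmod c \<le> 1"
  shows "integrable lborel (\<lambda>y. exp (complex_of_real s * (Complex x y)\<^sup>2) * test_kernel m c (Complex x y))"
  by (rule integrable_exp_tempered[OF assms(1) continuous_on_test_kernel_line[OF assms(2)]])
    (rule tempered_bounded[of _ 2], use norm_test_kernel(2) assms in auto)

lemma shift_test_integral:
  assumes "s > 0" "\<xi> > 0" "cmod c \<le> 1"
  shows "(\<integral>y. exp (complex_of_real s * (Complex \<xi> y)\<^sup>2) * test_kernel m c (Complex \<xi> y) \<partial>lborel)
       = (\<integral>y. exp (complex_of_real s * (Complex 0 y)\<^sup>2) * test_kernel m c (Complex 0 y) \<partial>lborel)"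
proof -
  define F where "F = (\<lambda>v. exp (complex_of_real s * v\<^sup>2) * test_kernel m c v)"
  have "0 = \<i> * ((\<integral>y. F (Complex \<xi> y) \<partial>lborel) - (\<integral>y. F (Complex 0 y) \<partial>lborel))"
  proof (rule contour_vertical_lines)
    show "\<forall>\<^sub>F n in sequentially. (F has_contour_integral 0) (rectpath (Complex 0 (- real n)) (Complex \<xi> (real n)))"
    proof (intro always_eventually allI Cauchy_theorem_convex_simple)
      fix n
      show "F holomorphic_on {z. Re z > -1}"
      proof -
        have "1 + z \<noteq> 0" if "Re z > -1" for z using that by (auto simp: complex_eq_iff)
        then show ?thesis unfolding F_def test_kernel_def cayley_def by (intro holomorphic_intros) auto
      qed
      show "convex {z. Re z > -1}" by (rule convex_halfspace_Re_gt)
      have "path_image (rectpath (Complex 0 (- real n)) (Complex \<xi> (real n))) \<subseteq> cbox (Complex 0 (- real n)) (Complex \<xi> (real n))"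
        using assms(2) by (intro path_image_rectpath_subset_cbox) auto
      then show "path_image (rectpath (Complex 0 (- real n)) (Complex \<xi> (real n))) \<subseteq> {z. Re z > -1}"
        by (force simp: in_cbox_complex_iff)
    qed auto
    show "\<forall>\<^sub>F n in sequentially. \<forall>z. 0 \<le> Re z \<longrightarrow> Re z \<le> \<xi> \<longrightarrow> \<bar>Im z\<bar> = real n \<longrightarrow>
        cmod (F z) \<le> 2 * (exp (s * \<xi>\<^sup>2) * exp (- s * (real n)\<^sup>2))"
    proof (intro always_eventually allI impI)
      fix n z assume z: "0 \<le> Re z" "Re z \<le> \<xi>" "\<bar>Im z\<bar> = real n"
      have "cmod (exp (complex_of_real s * z\<^sup>2)) \<le> exp (s * \<xi>\<^sup>2) * exp (- s * (Im z)\<^sup>2)"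
        using z assms(2) by (intro exp_rectangle_bound assms(1)) auto
      also have "(Im z)\<^sup>2 = (real n)\<^sup>2" using z(3) by (metis power2_abs)
      finally have "cmod (F z) \<le> (exp (s * \<xi>\<^sup>2) * exp (- s * (real n)\<^sup>2)) * 2"
        unfolding F_def norm_mult using norm_test_kernel(2)[OF z(1) assms(3)] by (intro mult_mono) auto
      then show "cmod (F z) \<le> 2 * (exp (s * \<xi>\<^sup>2) * exp (- s * (real n)\<^sup>2))" by (simp only: mult.commute)
    qed
    show "(\<lambda>n. 2 * (exp (s * \<xi>\<^sup>2) * exp (- s * (real n)\<^sup>2))) \<longlonglongrightarrow> 0" by (rule exp_line_limit[OF assms(1)])
  qed (use assms integrable_exp_test_kernel in \<open>auto simp: F_def\<close>)
  then show ?thesis by (simp add: F_def)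
qed

text \<open>
  The functional does not see the approximants, so its value at the exponential is its value at the error, and
  the former may be computed on any vertical line in the right half plane.
\<close>

lemma rat_error_ge_test_integral:
  assumes "t > 0" "q > 0" "s = t * q" "\<xi> > 0" "cmod c \<le> 1"
  shows "rat_error m t q \<ge> cmod (\<integral>y. exp (complex_of_real s * (Complex \<xi> y)\<^sup>2) * test_kernel m c (Complex \<xi> y) \<partial>lborel) / (2 * pi)"
proof (rule rat_error_ge[OF assms(2,1)])
  fix P E assume P: "degree P \<le> m"
    and E: "\<And>x. x \<le> 0 \<Longrightarrow> cmod (exp (of_real (t * x)) - poly P (of_real x) / (of_real q - of_real x) ^ m) \<le> E"
  have s: "s > 0" using assms by simp
  define r where "r = (\<lambda>y. poly P (of_real (- q * y\<^sup>2)) / (of_real q - of_real (- q * y\<^sup>2)) ^ m)"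
  define f where "f = (\<lambda>y. exp (complex_of_real s * (Complex 0 y)\<^sup>2))"
  let ?k = "\<lambda>y. test_kernel m c (Complex 0 y)"
  have R: "integrable lborel (\<lambda>y. r y * ?k y)" "(\<integral>y. r y * ?k y \<partial>lborel) = 0"
    using rational_class_annihilated[OF P assms(2), of c] by (simp_all add: has_bochner_integral_iff r_def test_kernel_def)
  have F: "integrable lborel (\<lambda>y. f y * ?k y)"
    unfolding f_def by (rule integrable_exp_test_kernel) (use s assms in auto)
  have "(\<integral>y. exp (complex_of_real s * (Complex \<xi> y)\<^sup>2) * test_kernel m c (Complex \<xi> y) \<partial>lborel)
     = (\<integral>y. f y * ?k y \<partial>lborel) - (\<integral>y. r y * ?k y \<partial>lborel)"
    unfolding R(2) shift_test_integral[OF s assms(4,5)] f_def by simp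
  also have "\<dots> = (\<integral>y. f y * ?k y - r y * ?k y \<partial>lborel)" using F R(1) by simp
  finally have eq: "(\<integral>y. exp (complex_of_real s * (Complex \<xi> y)\<^sup>2) * test_kernel m c (Complex \<xi> y) \<partial>lborel)
     = (\<integral>y. f y * ?k y - r y * ?k y \<partial>lborel)" .
  have "cmod (\<integral>y. f y * ?k y - r y * ?k y \<partial>lborel) \<le> (\<integral>y. cmod (f y * ?k y - r y * ?k y) \<partial>lborel)" by simp
  also have "\<dots> \<le> (\<integral>y. E * 2 * (1 / (1 + y\<^sup>2)) \<partial>lborel)"
  proof (rule integral_mono')
    show "integrable lborel (\<lambda>y. E * 2 * (1 / (1 + y\<^sup>2)))" by (intro integrable_mult_right cauchy_density)
    fix y :: real
    have x: "- q * y\<^sup>2 \<le> 0" using assms(2) by simp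
    have "f y = exp (of_real (t * (- q * y\<^sup>2)))"
    proof -
      have "(Complex 0 y)\<^sup>2 = of_real (- y\<^sup>2)" by (simp add: complex_eq_iff power2_eq_square)
      then show ?thesis by (simp add: f_def assms(3) mult_ac)
    qed
    then have "cmod (f y - r y) \<le> E" using E[OF x] by (simp add: r_def)
    moreover have "cmod (?k y) \<le> 2 * (1 / (1 + y\<^sup>2))"
      using norm_test_kernel(1)[of "Complex 0 y" c m] assms(5) by (simp add: norm_one_plus_imaginary)
    ultimately have "cmod (f y - r y) * cmod (?k y) \<le> E * (2 * (1 / (1 + y\<^sup>2)))"
      by (intro mult_mono) (auto intro: order_trans[OF norm_ge_zero])
    then show "cmod (f y * ?k y - r y * ?k y) \<le> E * 2 * (1 / (1 + y\<^sup>2))"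
      by (simp add: left_diff_distrib[symmetric] norm_mult)
    show "0 \<le> E * 2 * (1 / (1 + y\<^sup>2))"
      using order_trans[OF norm_ge_zero \<open>cmod (f y - r y) \<le> E\<close>] by (intro mult_nonneg_nonneg) auto
  qed
  also have "\<dots> = E * 2 * pi" by (simp only: integral_mult_right_zero cauchy_density(2))
  finally show "cmod (\<integral>y. exp (complex_of_real s * (Complex \<xi> y)\<^sup>2) * test_kernel m c (Complex \<xi> y) \<partial>lborel) / (2 * pi) \<le> E"
    unfolding eq using pi_gt_zero by (simp add: field_simps)
qed

section \<open>Laplace's method at the upper saddle point\<close>

lemma saddle_reciprocal:
  assumes "admissible \<xi>"
  shows "1 - saddle \<xi> \<noteq> 0" "1 + saddle \<xi> \<noteq> 0"
    "of_real (alpha_of \<xi>) * saddle \<xi> = 1 / (1 - (saddle \<xi>)\<^sup>2)"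
proof -
  note a = admissibleD[OF assms]
  show 1: "1 - saddle \<xi> \<noteq> 0" "1 + saddle \<xi> \<noteq> 0"
    using a by (auto simp: saddle_def complex_eq_iff)
  have "(1 - saddle \<xi>) * (1 + saddle \<xi>) \<noteq> 0" using 1 by simp
  then have nz: "1 - (saddle \<xi>)\<^sup>2 \<noteq> 0" by (simp add: algebra_simps power2_eq_square)
  have "of_real (alpha_of \<xi>) * saddle \<xi> * (1 - (saddle \<xi>)\<^sup>2) = 1"
    using saddle_equation[OF assms] by (simp add: algebra_simps power2_eq_square power3_eq_cube)
  then show "of_real (alpha_of \<xi>) * saddle \<xi> = 1 / (1 - (saddle \<xi>)\<^sup>2)"
    by (simp add: nonzero_eq_divide_eq[OF nz])
qed

text \<open>
  Half of the second derivative of \<open>ln w(v) + \<alpha> v\<^sup>2\<close> at the saddle point, simplified with the cubic equation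
  (see \<open>curvature_eq\<close>). In the direction of the vertical line it enters with a minus sign.
\<close>

definition curvature :: "real \<Rightarrow> complex" where
  "curvature \<xi> = of_real (alpha_of \<xi>) * (3 - 2 * of_real (alpha_of \<xi>) * saddle \<xi>)"

lemma curvature_pos:
  assumes "admissible \<xi>"
  shows "Re (curvature \<xi>) > 0"
proof -
  note a = admissibleD[OF assms]
  have "2 * alpha_of \<xi> * \<xi> = 1 / (4 * \<xi>\<^sup>2 - 1)" using a by (simp add: alpha_of_def)
  also have "\<dots> < 3" using a(2,3) by (simp add: divide_less_eq)
  finally show ?thesis using a by (simp add: curvature_def saddle_def)
qed

lemma curvature_eq:
  assumes "admissible \<xi>"
  shows "curvature \<xi> = of_real (alpha_of \<xi>) - 1 / (2 * (1 - saddle \<xi>)\<^sup>2) + 1 / (2 * (1 + saddle \<xi>)\<^sup>2)"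
proof -
  define v a where "v = saddle \<xi>" and "a = complex_of_real (alpha_of \<xi>)"
  note r = saddle_reciprocal[OF assms, folded v_def a_def]
  have a1: "a * (v ^ 3 - v) + 1 = 0" using saddle_equation[OF assms] by (simp add: v_def a_def)
  have p: "1 / ((1 - v) * (1 + v)) = a * v" using r(3) by (simp add: algebra_simps power2_eq_square)
  have "- 1 / (2 * (1 - v)\<^sup>2) + 1 / (2 * (1 + v)\<^sup>2) = - 2 * v * (1 / ((1 - v) * (1 + v)))\<^sup>2"
  proof -
    have "- 1 / (2 * p\<^sup>2) + 1 / (2 * q\<^sup>2) = (p\<^sup>2 - q\<^sup>2) / 2 * (1 / (p * q))\<^sup>2" if "p \<noteq> 0" "q \<noteq> 0" for p q :: complex
      using that by (simp add: field_simps)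
    from this[OF r(1,2)] have "- 1 / (2 * (1 - v)\<^sup>2) + 1 / (2 * (1 + v)\<^sup>2) = ((1 - v)\<^sup>2 - (1 + v)\<^sup>2) / 2 * (1 / ((1 - v) * (1 + v)))\<^sup>2" .
    also have "((1 - v)\<^sup>2 - (1 + v)\<^sup>2) / 2 = - 2 * v" by (simp add: power2_eq_square algebra_simps)
    finally show ?thesis .
  qed
  also have "\<dots> = - 2 * v * (a * v)\<^sup>2" by (simp only: p)
  also have "\<dots> = - 2 * a * (a * (v ^ 3 - v) + a * v)" by (simp add: power2_eq_square power3_eq_cube algebra_simps)
  also have "a * (v ^ 3 - v) = - 1" using a1 by (simp add: eq_neg_iff_add_eq_0)
  finally show ?thesis unfolding curvature_def v_def[symmetric] a_def[symmetric]
    by (simp add: algebra_simps)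
qed

definition phase :: "real \<Rightarrow> complex \<Rightarrow> complex" where
  "phase \<xi> v = cayley v * exp (of_real (alpha_of \<xi>) * v\<^sup>2)"

lemma norm_phase_saddle: "cmod (phase \<xi> (saddle \<xi>)) = level \<xi>"
  by (simp add: phase_def level_def norm_mult)

text \<open>
  The value at \<open>z = 0\<close> is \<open>0\<close>, because division by \<open>0\<close> yields \<open>0\<close>; this makes the function continuous there.
\<close>

definition log_rest :: "complex \<Rightarrow> complex" where
  "log_rest z = (ln (1 + z) - z + z\<^sup>2 / 2) / z\<^sup>2"

lemma log_rest_tendsto:
  assumes "(f \<longlongrightarrow> 0) F"
  shows "((\<lambda>x. log_rest (f x)) \<longlongrightarrow> 0) F"
proof -
  have "isCont log_rest 0"
    using Ln_second_order unfolding isCont_def log_rest_def by simp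
  from isCont_tendsto_compose[OF this assms] show ?thesis by (simp add: log_rest_def)
qed

lemma one_plus_exp_log_rest: "z \<noteq> -1 \<Longrightarrow> 1 + z = exp (z - z\<^sup>2 / 2 + z\<^sup>2 * log_rest z)"
  by (cases "z = 0") (simp_all add: log_rest_def exp_Ln add_eq_0_iff)

text \<open>
  Expanding both factors \<open>1 \<mp> (v + \<delta>)\<close> of the Cayley transform logarithmically about the saddle point \<open>v\<close>: the terms
  linear in \<open>\<delta>\<close> cancel by the saddle point equation, and the quadratic ones form the curvature. With
  \<open>\<delta> = i x / sqrt m\<close> the power \<open>m\<close> is compensated by \<open>m \<delta>\<^sup>2 = - x\<^sup>2\<close>.
\<close>

lemma phase_ratio_power:
  assumes "admissible \<xi>" "m \<ge> 1" "Re (saddle \<xi> + \<delta>) > 0" "saddle \<xi> + \<delta> \<noteq> 1" "of_nat m * \<delta>\<^sup>2 = - (of_real x)\<^sup>2"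
  defines "z1 \<equiv> - \<delta> / (1 - saddle \<xi>)" and "z2 \<equiv> \<delta> / (1 + saddle \<xi>)"
  shows "(phase \<xi> (saddle \<xi> + \<delta>) / phase \<xi> (saddle \<xi>)) ^ m
       = exp (- (of_real x)\<^sup>2 * (curvature \<xi> + log_rest z1 / (1 - saddle \<xi>)\<^sup>2 - log_rest z2 / (1 + saddle \<xi>)\<^sup>2))"
proof -
  define v a where "v = saddle \<xi>" and "a = complex_of_real (alpha_of \<xi>)"
  note r = saddle_reciprocal[OF assms(1), folded v_def a_def]
  have z1: "1 - (v + \<delta>) = (1 - v) * (1 + z1)" and z2: "1 + (v + \<delta>) = (1 + v) * (1 + z2)"
    using r by (simp_all add: z1_def z2_def v_def[symmetric] field_simps)
  have n1: "z1 \<noteq> -1" using z1 assms(4) by (auto simp: v_def[symmetric])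
  have "1 + (v + \<delta>) \<noteq> 0" using assms(3) by (auto simp: v_def[symmetric] complex_eq_iff)
  then have n2: "z2 \<noteq> -1" using z2 by auto
  define e1 e2 where "e1 = z1 - z1\<^sup>2 / 2 + z1\<^sup>2 * log_rest z1" and "e2 = z2 - z2\<^sup>2 / 2 + z2\<^sup>2 * log_rest z2"
  have "cayley (v + \<delta>) = cayley v * (exp e1 / exp e2)"
    unfolding cayley_def z1 z2 one_plus_exp_log_rest[OF n1, folded e1_def] one_plus_exp_log_rest[OF n2, folded e2_def] by simp
  then have "phase \<xi> (v + \<delta>) = cayley v * exp (a * v\<^sup>2) * (exp e1 / exp e2 * exp (a * (2 * v * \<delta> + \<delta>\<^sup>2)))"
    by (simp add: phase_def a_def[symmetric] power2_sum distrib_left exp_add mult_ac)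
  also have "exp e1 / exp e2 * exp (a * (2 * v * \<delta> + \<delta>\<^sup>2)) = exp (e1 - e2 + a * (2 * v * \<delta> + \<delta>\<^sup>2))"
    by (simp add: exp_add exp_diff)
  also have "e1 - e2 + a * (2 * v * \<delta> + \<delta>\<^sup>2) = \<delta>\<^sup>2 * (curvature \<xi> + log_rest z1 / (1 - v)\<^sup>2 - log_rest z2 / (1 + v)\<^sup>2)"
  proof -
    have "1 / (1 - v) + 1 / (1 + v) = 2 * (1 / ((1 - v) * (1 + v)))"
      using r(1,2) by (simp add: divide_simps)
    also have "1 / ((1 - v) * (1 + v)) = a * v" using r(3) by (simp add: algebra_simps power2_eq_square)
    finally have rec: "1 / (1 - v) + 1 / (1 + v) = 2 * (a * v)" .
    have "z1 - z2 + 2 * a * v * \<delta> = - \<delta> * (1 / (1 - v) + 1 / (1 + v)) + 2 * a * v * \<delta>"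
      by (simp add: z1_def z2_def v_def distrib_left)
    also have "\<dots> = 0" unfolding rec by (simp add: mult_ac)
    finally have lin: "z1 - z2 + 2 * a * v * \<delta> = 0" .
    have sq: "z1\<^sup>2 = \<delta>\<^sup>2 / (1 - v)\<^sup>2" "z2\<^sup>2 = \<delta>\<^sup>2 / (1 + v)\<^sup>2"
      by (simp_all add: z1_def z2_def v_def power_divide)
    have "e1 - e2 + a * (2 * v * \<delta> + \<delta>\<^sup>2) = (z1 - z2 + 2 * a * v * \<delta>)
       + \<delta>\<^sup>2 * (a - 1 / (2 * (1 - v)\<^sup>2) + 1 / (2 * (1 + v)\<^sup>2) + log_rest z1 / (1 - v)\<^sup>2 - log_rest z2 / (1 + v)\<^sup>2)"
      unfolding e1_def e2_def sq by (simp add: algebra_simps)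
    then show ?thesis unfolding lin curvature_eq[OF assms(1), folded v_def a_def] by simp
  qed
  finally have "phase \<xi> (v + \<delta>) = phase \<xi> v * exp (\<delta>\<^sup>2 * (curvature \<xi> + log_rest z1 / (1 - v)\<^sup>2 - log_rest z2 / (1 + v)\<^sup>2))"
    by (simp add: phase_def a_def[symmetric])
  moreover have "phase \<xi> v \<noteq> 0"
    using level_pos[OF assms(1)] norm_phase_saddle[of \<xi>] by (auto simp: v_def)
  ultimately have "(phase \<xi> (v + \<delta>) / phase \<xi> v) ^ m = exp (of_nat m * (\<delta>\<^sup>2 * (curvature \<xi> + log_rest z1 / (1 - v)\<^sup>2 - log_rest z2 / (1 + v)\<^sup>2)))"
    by (simp add: exp_of_nat_mult)
  also have "of_nat m * (\<delta>\<^sup>2 * (curvature \<xi> + log_rest z1 / (1 - v)\<^sup>2 - log_rest z2 / (1 + v)\<^sup>2))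
     = (of_nat m * \<delta>\<^sup>2) * (curvature \<xi> + log_rest z1 / (1 - v)\<^sup>2 - log_rest z2 / (1 + v)\<^sup>2)" by (simp only: mult.assoc)
  finally show ?thesis unfolding assms(5) v_def .
qed

text \<open>
  The integrand of the test functional divided by its value at the saddle point, with the constant \<open>c\<close> chosen as
  the Cayley transform of the conjugate saddle point.
\<close>

definition saddle_integrand :: "real \<Rightarrow> nat \<Rightarrow> complex \<Rightarrow> complex" where
  "saddle_integrand \<xi> m v = (phase \<xi> v / phase \<xi> (saddle \<xi>)) ^ m * test_kernel 0 (cnj (cayley (saddle \<xi>))) v"

lemma test_integral_normalised:
  assumes "admissible \<xi>"
  defines "c \<equiv> cnj (cayley (saddle \<xi>))"
  shows "cmod (\<integral>y. exp (complex_of_real (alpha_of \<xi> * m) * (Complex \<xi> y)\<^sup>2) * test_kernel m c (Complex \<xi> y) \<partial>lborel)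
       = level \<xi> ^ m * cmod (\<integral>y. saddle_integrand \<xi> m (Complex \<xi> y) \<partial>lborel)"
proof -
  define p where "p = phase \<xi> (saddle \<xi>)"
  have p: "cmod p = level \<xi>" "p \<noteq> 0"
    using norm_phase_saddle level_pos[OF assms(1)] by (auto simp: p_def simp flip: norm_phase_saddle)
  have "exp (complex_of_real (alpha_of \<xi> * m) * v\<^sup>2) * test_kernel m c v = p ^ m * saddle_integrand \<xi> m v" for v
  proof -
    have "exp (complex_of_real (alpha_of \<xi> * m) * v\<^sup>2) = exp (of_real (alpha_of \<xi>) * v\<^sup>2) ^ m"
      by (simp add: exp_of_nat_mult[symmetric] mult_ac)
    then have "exp (complex_of_real (alpha_of \<xi> * m) * v\<^sup>2) * test_kernel m c v = phase \<xi> v ^ m * test_kernel 0 c v"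
      by (simp add: phase_def test_kernel_def power_mult_distrib mult_ac)
    then show ?thesis using p(2) by (simp add: saddle_integrand_def c_def power_divide p_def)
  qed
  then show ?thesis by (simp add: norm_mult norm_power p(1))
qed

lemma saddle_integrand_bound:
  assumes "admissible \<xi>"
  shows "cmod (saddle_integrand \<xi> m (Complex \<xi> y)) \<le> 2 * exp (- (decay \<xi> * m * (\<bar>y\<bar> - saddle_height \<xi>)\<^sup>2))"
    "cmod (saddle_integrand \<xi> m (Complex \<xi> y)) \<le> cmod (test_kernel 0 (cnj (cayley (saddle \<xi>))) (Complex \<xi> y))"
proof -
  note a = admissibleD[OF assms]
  have "cmod (phase \<xi> (Complex \<xi> y)) \<le> level \<xi> * exp (- decay \<xi> * (\<bar>y\<bar> - saddle_height \<xi>)\<^sup>2)"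
    unfolding phase_def by (rule level_line_gaussian_bound[OF assms])
  then have 1: "cmod (phase \<xi> (Complex \<xi> y) / phase \<xi> (saddle \<xi>)) \<le> exp (- decay \<xi> * (\<bar>y\<bar> - saddle_height \<xi>)\<^sup>2)"
    using level_pos[OF assms] by (simp add: norm_divide norm_phase_saddle divide_le_eq mult.commute)
  then have "cmod (phase \<xi> (Complex \<xi> y) / phase \<xi> (saddle \<xi>)) ^ m \<le> exp (- decay \<xi> * (\<bar>y\<bar> - saddle_height \<xi>)\<^sup>2) ^ m"
    by (intro power_mono) auto
  also have "\<dots> = exp (- (decay \<xi> * m * (\<bar>y\<bar> - saddle_height \<xi>)\<^sup>2))"
    by (simp add: exp_of_nat_mult[symmetric] mult_ac)
  finally have 2: "cmod (phase \<xi> (Complex \<xi> y) / phase \<xi> (saddle \<xi>)) ^ m \<le> exp (- (decay \<xi> * m * (\<bar>y\<bar> - saddle_height \<xi>)\<^sup>2))" .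
  have c: "cmod (cnj (cayley (saddle \<xi>))) \<le> 1"
    using cayley_right_half_plane(1)[of "saddle \<xi>"] a by (simp add: saddle_def)
  have k: "cmod (test_kernel 0 (cnj (cayley (saddle \<xi>))) (Complex \<xi> y)) \<le> 2"
    by (rule norm_test_kernel(2)) (use a c in auto)
  show "cmod (saddle_integrand \<xi> m (Complex \<xi> y)) \<le> 2 * exp (- (decay \<xi> * m * (\<bar>y\<bar> - saddle_height \<xi>)\<^sup>2))"
    unfolding saddle_integrand_def norm_mult norm_power using mult_mono[OF 2 k] by (simp add: mult.commute)
  have "decay \<xi> * (\<bar>y\<bar> - saddle_height \<xi>)\<^sup>2 \<ge> 0" using decay_pos[OF assms] by simp
  then have "exp (- decay \<xi> * (\<bar>y\<bar> - saddle_height \<xi>)\<^sup>2) \<le> 1" by simp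
  from order_trans[OF 1 this] have "cmod (phase \<xi> (Complex \<xi> y) / phase \<xi> (saddle \<xi>)) ^ m \<le> 1"
    by (intro power_le_one norm_ge_zero)
  then show "cmod (saddle_integrand \<xi> m (Complex \<xi> y)) \<le> cmod (test_kernel 0 (cnj (cayley (saddle \<xi>))) (Complex \<xi> y))"
    unfolding saddle_integrand_def norm_mult norm_power by (rule mult_left_le_one_le[rotated 2]) auto
qed

lemma continuous_on_saddle_integrand_line:
  assumes "admissible \<xi>"
  shows "continuous_on UNIV (\<lambda>y. saddle_integrand \<xi> m (Complex \<xi> y))"
proof -
  have "phase \<xi> (saddle \<xi>) \<noteq> 0" using norm_phase_saddle[of \<xi>] level_pos[OF assms] by auto
  moreover have "1 + Complex \<xi> y \<noteq> 0" for y using admissibleD(1)[OF assms] by (simp add: complex_eq_iff)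
  ultimately show ?thesis
    unfolding saddle_integrand_def
    by (intro continuous_intros continuous_on_test_kernel_line)
      (use admissibleD(1)[OF assms] in \<open>auto simp: phase_def cayley_def intro!: continuous_intros\<close>)
qed

text \<open>
  The half line \<open>\<sigma> y > 0\<close>, \<open>\<sigma> = \<plusminus> 1\<close>, is rescaled about its own saddle point; on each half a single Gaussian
  dominates.
\<close>

definition half_rescaled :: "real \<Rightarrow> real \<Rightarrow> nat \<Rightarrow> real \<Rightarrow> complex" where
  "half_rescaled \<sigma> \<xi> m x = indicator {0<..} (saddle_height \<xi> + x / sqrt m) *\<^sub>R
     saddle_integrand \<xi> m (Complex \<xi> (\<sigma> * (saddle_height \<xi> + x / sqrt m)))"

lemma half_rescaled_integral:
  assumes "admissible \<xi>" "m \<ge> 1"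
  shows "sqrt m * (\<integral>y. saddle_integrand \<xi> m (Complex \<xi> y) \<partial>lborel)
     = (\<integral>x. half_rescaled 1 \<xi> m x \<partial>lborel) + (\<integral>x. half_rescaled (-1) \<xi> m x \<partial>lborel)"
proof -
  let ?f = "\<lambda>y. saddle_integrand \<xi> m (Complex \<xi> y)"
  have dm: "decay \<xi> * m > 0" using decay_pos[OF assms(1)] assms(2) by simp
  have int: "integrable lborel ?f"
  proof (rule Bochner_Integration.integrable_bound)
    show "integrable lborel (\<lambda>y. 2 * exp (- (decay \<xi> * m) * (\<bar>y\<bar> - saddle_height \<xi>)\<^sup>2))"
      by (intro integrable_mult_right two_gaussians_integral(1) dm)
    show "?f \<in> borel_measurable lborel"
      using continuous_on_saddle_integrand_line[OF assms(1)] by (simp add: borel_measurable_continuous_onI)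
    show "AE y in lborel. norm (?f y) \<le> norm (2 * exp (- (decay \<xi> * m) * (\<bar>y\<bar> - saddle_height \<xi>)\<^sup>2))"
      using saddle_integrand_bound(1)[OF assms(1), of m] by (intro AE_I2) simp
  qed
  have ih: "integrable lborel (\<lambda>y. indicator {0<..} (\<sigma> * y) *\<^sub>R ?f y)" for \<sigma> :: real
  proof -
    have "(\<lambda>y. indicator {0<..} (\<sigma> * y) *\<^sub>R ?f y) = (\<lambda>y. indicator {y. \<sigma> * y > 0} y *\<^sub>R ?f y)"
      by (auto simp: indicator_def)
    moreover have "{y. \<sigma> * y > 0} \<in> sets lborel" by measurable
    ultimately show ?thesis using integrable_mult_indicator[OF _ int] by simp
  qed
  have half: "sqrt m * (\<integral>y. indicator {0<..} (\<sigma> * y) *\<^sub>R ?f y \<partial>lborel) = (\<integral>x. half_rescaled \<sigma> \<xi> m x \<partial>lborel)"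
    if "\<sigma> = 1 \<or> \<sigma> = -1" for \<sigma> :: real
  proof -
    have c: "\<sigma> / sqrt m \<noteq> 0" "\<bar>\<sigma> / sqrt m\<bar> = 1 / sqrt m" and s2: "\<sigma> * \<sigma> = 1" using that assms(2) by auto
    have sm: "sqrt m * (1 / sqrt m) = 1" using assms(2) by simp
    have "(\<integral>y. indicator {0<..} (\<sigma> * y) *\<^sub>R ?f y \<partial>lborel) = (1 / sqrt m) *\<^sub>R
      (\<integral>x. indicator {0<..} (\<sigma> * (\<sigma> * saddle_height \<xi> + \<sigma> / sqrt m * x)) *\<^sub>R ?f (\<sigma> * saddle_height \<xi> + \<sigma> / sqrt m * x) \<partial>lborel)"
      unfolding c(2)[symmetric] by (rule lborel_integral_real_affine[OF c(1)])
    also have "(\<lambda>x. indicator {0<..} (\<sigma> * (\<sigma> * saddle_height \<xi> + \<sigma> / sqrt m * x)) *\<^sub>R ?f (\<sigma> * saddle_height \<xi> + \<sigma> / sqrt m * x)) = half_rescaled \<sigma> \<xi> m"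
    proof
      fix x
      have e: "\<sigma> * saddle_height \<xi> + \<sigma> / sqrt m * x = \<sigma> * (saddle_height \<xi> + x / sqrt m)" by (simp add: distrib_left)
      have k: "\<sigma> * (\<sigma> * saddle_height \<xi> + \<sigma> / sqrt m * x) = saddle_height \<xi> + x / sqrt m"
        unfolding e mult.assoc[symmetric] s2 by simp
      show "indicator {0<..} (\<sigma> * (\<sigma> * saddle_height \<xi> + \<sigma> / sqrt m * x)) *\<^sub>R ?f (\<sigma> * saddle_height \<xi> + \<sigma> / sqrt m * x) = half_rescaled \<sigma> \<xi> m x"
        unfolding half_rescaled_def k unfolding e ..
    qed
    finally have "(\<integral>y. indicator {0<..} (\<sigma> * y) *\<^sub>R ?f y \<partial>lborel) = (1 / sqrt m) *\<^sub>R (\<integral>x. half_rescaled \<sigma> \<xi> m x \<partial>lborel)" .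
    moreover have "complex_of_real (sqrt m) * ((1 / sqrt m) *\<^sub>R z) = z" for z
      unfolding scaleR_conv_of_real mult.assoc[symmetric] of_real_mult[symmetric] sm by simp
    ultimately show ?thesis by simp
  qed
  have "(\<integral>y. ?f y \<partial>lborel) = (\<integral>y. indicator {0<..} (1 * y) *\<^sub>R ?f y + indicator {0<..} (-1 * y) *\<^sub>R ?f y \<partial>lborel)"
  proof (rule integral_cong_AE)
    have "AE y in lborel. y \<noteq> (0::real)" by (rule AE_lborel_singleton)
    then show "AE y in lborel. ?f y = indicator {0<..} (1 * y) *\<^sub>R ?f y + indicator {0<..} (-1 * y) *\<^sub>R ?f y"
      by eventually_elim (auto simp: indicator_def)
  qed (use int ih[of 1] ih[of "-1"] in auto)
  also have "\<dots> = (\<integral>y. indicator {0<..} (1 * y) *\<^sub>R ?f y \<partial>lborel) + (\<integral>y. indicator {0<..} (-1 * y) *\<^sub>R ?f y \<partial>lborel)"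
    by (rule Bochner_Integration.integral_add[OF ih ih])
  finally show ?thesis using half[of 1] half[of "-1"] by (simp add: distrib_left)
qed

lemma half_rescaled_bound:
  assumes "admissible \<xi>" "m \<ge> 1" "\<sigma> = 1 \<or> \<sigma> = -1" "d \<le> decay \<xi>"
  shows "cmod (half_rescaled \<sigma> \<xi> m x) \<le> 2 * exp (- d * x\<^sup>2)"
proof (cases "saddle_height \<xi> + x / sqrt m > 0")
  case True
  have "(\<bar>\<sigma> * (saddle_height \<xi> + x / sqrt m)\<bar> - saddle_height \<xi>)\<^sup>2 = x\<^sup>2 / m"
    using True assms(3) by (auto simp: abs_mult power_divide)
  then have "decay \<xi> * m * (\<bar>\<sigma> * (saddle_height \<xi> + x / sqrt m)\<bar> - saddle_height \<xi>)\<^sup>2 = decay \<xi> * x\<^sup>2"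
    using assms(2) by simp
  with saddle_integrand_bound(1)[OF assms(1), of m "\<sigma> * (saddle_height \<xi> + x / sqrt m)"]
  have "cmod (saddle_integrand \<xi> m (Complex \<xi> (\<sigma> * (saddle_height \<xi> + x / sqrt m)))) \<le> 2 * exp (- (decay \<xi> * x\<^sup>2))"
    by (simp only:)
  also have "exp (- (decay \<xi> * x\<^sup>2)) \<le> exp (- (d * x\<^sup>2))"
    using mult_right_mono[OF assms(4), of "x\<^sup>2"] by simp
  finally show ?thesis using True by (simp add: half_rescaled_def)
next
  case False
  then show ?thesis by (simp add: half_rescaled_def)
qed

lemma half_rescaled_measurable:
  assumes "admissible \<xi>" "m \<ge> 1"
  shows "half_rescaled \<sigma> \<xi> m \<in> borel_measurable lborel"
proof -
  have "(\<lambda>x. saddle_integrand \<xi> m (Complex \<xi> (\<sigma> * (saddle_height \<xi> + x / sqrt m)))) \<in> borel_measurable borel"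
    by (intro borel_measurable_continuous_onI continuous_on_compose2[OF continuous_on_saddle_integrand_line[OF assms(1)]] continuous_intros) (use assms(2) in auto)
  then show ?thesis unfolding half_rescaled_def by measurable
qed

text \<open>
  The parameter \<open>\<xi>\<close> varies along the sequence together with \<open>m\<close>. Limits of this kind, together with compactness,
  give bounds that are uniform in \<open>\<xi>\<close>.
\<close>

locale saddle_sequence =
  fixes X :: "nat \<Rightarrow> real" and M :: "nat \<Rightarrow> nat" and x0 :: real
  assumes adm: "\<And>j. admissible (X j)" and adm0: "admissible x0"
    and X: "X \<longlonglongrightarrow> x0" and M1: "\<And>j. M j \<ge> 1" and M: "filterlim M at_top sequentially"
begin

lemma data_tendsto:
  "(\<lambda>j. saddle_height (X j)) \<longlonglongrightarrow> saddle_height x0"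
  "(\<lambda>j. saddle (X j)) \<longlonglongrightarrow> saddle x0"
  "(\<lambda>j. alpha_of (X j)) \<longlonglongrightarrow> alpha_of x0"
  "(\<lambda>j. curvature (X j)) \<longlonglongrightarrow> curvature x0"
  "(\<lambda>j. cayley (saddle (X j))) \<longlonglongrightarrow> cayley (saddle x0)"
proof -
  have *: "(\<lambda>j. f (X j)) \<longlonglongrightarrow> f x0" if "continuous_on {x. admissible x} f" for f :: "real \<Rightarrow> 'b::topological_space"
    using continuous_on_tendsto_compose[OF that X] adm adm0 by simp
  show 1: "(\<lambda>j. saddle_height (X j)) \<longlonglongrightarrow> saddle_height x0" "(\<lambda>j. saddle (X j)) \<longlonglongrightarrow> saddle x0"
  "(\<lambda>j. alpha_of (X j)) \<longlonglongrightarrow> alpha_of x0"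
    by (intro * continuous_on_saddle_data)+
  show "(\<lambda>j. curvature (X j)) \<longlonglongrightarrow> curvature x0" unfolding curvature_def by (intro tendsto_intros 1)
  show "(\<lambda>j. cayley (saddle (X j))) \<longlonglongrightarrow> cayley (saddle x0)"
    unfolding cayley_def by (intro tendsto_intros 1 saddle_reciprocal adm0)
qed

lemma scale_tendsto: "(\<lambda>j. x / sqrt (M j)) \<longlonglongrightarrow> 0"
proof -
  have "filterlim (\<lambda>j. sqrt (real (M j))) at_top sequentially"
    by (intro filterlim_compose[OF sqrt_at_top] filterlim_compose[OF filterlim_real_sequentially M])
  then show ?thesis by (intro tendsto_divide_0[OF tendsto_const] filterlim_at_top_imp_at_infinity)
qed

lemma indicator_eventually:
  "\<forall>\<^sub>F j in sequentially. saddle_height (X j) + x / sqrt (M j) > 0"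
proof -
  have "(\<lambda>j. saddle_height (X j) + x / sqrt (M j)) \<longlonglongrightarrow> saddle_height x0 + 0"
    by (intro tendsto_intros data_tendsto scale_tendsto)
  then show ?thesis using admissibleD(6)[OF adm0] by (intro order_tendstoD(1)) auto
qed

lemma kernel_tendsto:
  "(\<lambda>j. test_kernel 0 (cnj (cayley (saddle (X j)))) (Complex (X j) (\<sigma> * (saddle_height (X j) + x / sqrt (M j)))))
     \<longlonglongrightarrow> test_kernel 0 (cnj (cayley (saddle x0))) (Complex x0 (\<sigma> * saddle_height x0))"
proof -
  define Y where "Y = (\<lambda>j. Complex (X j) (\<sigma> * (saddle_height (X j) + x / sqrt (M j))))"
  define L where "L = Complex x0 (\<sigma> * saddle_height x0)"
  have "Y \<longlonglongrightarrow> Complex x0 (\<sigma> * (saddle_height x0 + 0))"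
    unfolding Y_def by (intro tendsto_Complex tendsto_intros X data_tendsto scale_tendsto)
  then have Y: "Y \<longlonglongrightarrow> L" by (simp add: L_def)
  have "1 + L \<noteq> 0"
    using admissibleD(1)[OF adm0] by (simp add: complex_eq_iff L_def)
  then have "(\<lambda>j. test_kernel 0 (cnj (cayley (saddle (X j)))) (Y j)) \<longlonglongrightarrow> test_kernel 0 (cnj (cayley (saddle x0))) L"
    unfolding test_kernel_def cayley_def[of "Y _"] cayley_def[of L] by (intro tendsto_intros data_tendsto Y) auto
  then show ?thesis by (simp only: Y_def L_def)
qed

text \<open>
  The kernel contains the factor \<open>w(v) - c\<close>, which vanishes at the lower saddle point.
\<close>

lemma lower_half_tendsto: "(\<lambda>j. half_rescaled (-1) (X j) (M j) x) \<longlonglongrightarrow> 0"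
proof (rule Lim_null_comparison)
  have "Complex x0 (- 1 * saddle_height x0) = cnj (saddle x0)" by (simp add: saddle_def complex_eq_iff)
  moreover have "cayley (cnj z) = cnj (cayley z)" for z by (simp add: cayley_def)
  ultimately have "test_kernel 0 (cnj (cayley (saddle x0))) (Complex x0 (- 1 * saddle_height x0)) = 0"
    by (simp add: test_kernel_def)
  with tendsto_norm_zero[OF kernel_tendsto[of "-1" x, unfolded this]]
  show "(\<lambda>j. cmod (test_kernel 0 (cnj (cayley (saddle (X j)))) (Complex (X j) (- 1 * (saddle_height (X j) + x / sqrt (M j)))))) \<longlonglongrightarrow> 0"
    by simp
  show "\<forall>\<^sub>F j in sequentially. norm (half_rescaled (-1) (X j) (M j) x)
      \<le> cmod (test_kernel 0 (cnj (cayley (saddle (X j)))) (Complex (X j) (- 1 * (saddle_height (X j) + x / sqrt (M j)))))"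
    using saddle_integrand_bound(2)[OF adm]
    by (intro always_eventually allI) (auto simp: half_rescaled_def indicator_def simp del: mult_minus1)
qed

lemma upper_half_tendsto:
  "(\<lambda>j. half_rescaled 1 (X j) (M j) x) \<longlonglongrightarrow> exp (- (of_real x)\<^sup>2 * curvature x0) * test_kernel 0 (cnj (cayley (saddle x0))) (saddle x0)"
proof -
  define \<delta> where "\<delta> = (\<lambda>j. \<i> * complex_of_real (x / sqrt (M j)))"
  define z1 z2 where "z1 = (\<lambda>j. - \<delta> j / (1 - saddle (X j)))" and "z2 = (\<lambda>j. \<delta> j / (1 + saddle (X j)))"
  have d0: "\<delta> \<longlonglongrightarrow> 0" unfolding \<delta>_def using tendsto_mult_left[OF tendsto_of_real[OF scale_tendsto[of x]], of \<i>] by simp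
  have "z1 \<longlonglongrightarrow> - 0 / (1 - saddle x0)" "z2 \<longlonglongrightarrow> 0 / (1 + saddle x0)"
    unfolding z1_def z2_def by (intro tendsto_intros d0 data_tendsto saddle_reciprocal adm0)+
  then have z0: "z1 \<longlonglongrightarrow> 0" "z2 \<longlonglongrightarrow> 0" by simp_all
  have lim: "(\<lambda>j. exp (- (of_real x)\<^sup>2 * (curvature (X j) + log_rest (z1 j) / (1 - saddle (X j))\<^sup>2 - log_rest (z2 j) / (1 + saddle (X j))\<^sup>2)))
     \<longlonglongrightarrow> exp (- (of_real x)\<^sup>2 * (curvature x0 + 0 / (1 - saddle x0)\<^sup>2 - 0 / (1 + saddle x0)\<^sup>2))"
    by (intro tendsto_intros data_tendsto log_rest_tendsto z0) (use saddle_reciprocal[OF adm0] in auto)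
  have "(\<lambda>j. exp (- (of_real x)\<^sup>2 * (curvature (X j) + log_rest (z1 j) / (1 - saddle (X j))\<^sup>2 - log_rest (z2 j) / (1 + saddle (X j))\<^sup>2))
      * test_kernel 0 (cnj (cayley (saddle (X j)))) (Complex (X j) (1 * (saddle_height (X j) + x / sqrt (M j)))))
     \<longlonglongrightarrow> exp (- (of_real x)\<^sup>2 * (curvature x0 + 0 / (1 - saddle x0)\<^sup>2 - 0 / (1 + saddle x0)\<^sup>2))
      * test_kernel 0 (cnj (cayley (saddle x0))) (Complex x0 (1 * saddle_height x0))"
    by (rule tendsto_mult[OF lim kernel_tendsto])
  moreover have "\<forall>\<^sub>F j in sequentially. exp (- (of_real x)\<^sup>2 * (curvature (X j) + log_rest (z1 j) / (1 - saddle (X j))\<^sup>2 - log_rest (z2 j) / (1 + saddle (X j))\<^sup>2))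
      * test_kernel 0 (cnj (cayley (saddle (X j)))) (Complex (X j) (1 * (saddle_height (X j) + x / sqrt (M j))))
      = half_rescaled 1 (X j) (M j) x"
    using indicator_eventually[of x]
  proof eventually_elim
    case (elim j)
    have v: "Complex (X j) (1 * (saddle_height (X j) + x / sqrt (M j))) = saddle (X j) + \<delta> j"
      by (simp add: saddle_def \<delta>_def complex_eq_iff)
    have pw: "(phase (X j) (saddle (X j) + \<delta> j) / phase (X j) (saddle (X j))) ^ M j =
      exp (- (of_real x)\<^sup>2 * (curvature (X j) + log_rest (z1 j) / (1 - saddle (X j))\<^sup>2 - log_rest (z2 j) / (1 + saddle (X j))\<^sup>2))"
      unfolding z1_def z2_def
    proof (rule phase_ratio_power[OF adm M1])
      show "Re (saddle (X j) + \<delta> j) > 0" "saddle (X j) + \<delta> j \<noteq> 1"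
        unfolding v[symmetric] using admissibleD(1)[OF adm, of j] elim by (auto simp: complex_eq_iff)
      have "complex_of_real (x / sqrt (M j)) ^ 2 = of_real (x\<^sup>2 / M j)"
        by (simp add: power_divide flip: of_real_power)
      then have "(\<delta> j)\<^sup>2 = - of_real (x\<^sup>2 / M j)" by (simp only: \<delta>_def power_mult_distrib power2_i mult_minus1)
      then show "of_nat (M j) * (\<delta> j)\<^sup>2 = - (of_real x)\<^sup>2" using M1[of j] by simp
    qed
    have "half_rescaled 1 (X j) (M j) x = saddle_integrand (X j) (M j) (saddle (X j) + \<delta> j)"
      unfolding half_rescaled_def v using elim by (simp add: indicator_def)
    then show ?case unfolding v saddle_integrand_def pw by simp
  qed
  ultimately show ?thesis
    by (rule Lim_transform_eventually[THEN back_subst[where P="\<lambda>l. _ \<longlonglongrightarrow> l"]]) (simp add: saddle_def)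
qed

end

context saddle_sequence
begin

lemma rescaled_integral_tendsto:
  assumes "d > 0" "\<And>j. d \<le> decay (X j)"
  shows "(\<lambda>j. sqrt (M j) * (\<integral>y. saddle_integrand (X j) (M j) (Complex (X j) y) \<partial>lborel))
    \<longlonglongrightarrow> (\<integral>x. exp (- curvature x0 * (complex_of_real x)\<^sup>2) \<partial>lborel) * test_kernel 0 (cnj (cayley (saddle x0))) (saddle x0)"
proof -
  let ?K = "test_kernel 0 (cnj (cayley (saddle x0))) (saddle x0)"
  have w: "integrable lborel (\<lambda>x. 2 * exp (- d * x\<^sup>2))"
    using gaussian_integral(1)[OF assms(1), of 0] by simp
  have "(\<lambda>j. \<integral>x. half_rescaled 1 (X j) (M j) x \<partial>lborel) \<longlonglongrightarrow> (\<integral>x. exp (- (complex_of_real x)\<^sup>2 * curvature x0) * ?K \<partial>lborel)"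
    by (rule integral_dominated_convergence[where w = "\<lambda>x. 2 * exp (- d * x\<^sup>2)"])
      (use w half_rescaled_measurable[OF adm M1] half_rescaled_bound[OF adm M1 _ assms(2)] upper_half_tendsto in auto)
  moreover have "(\<lambda>j. \<integral>x. half_rescaled (-1) (X j) (M j) x \<partial>lborel) \<longlonglongrightarrow> integral\<^sup>L lborel (\<lambda>x::real. 0)"
    by (rule integral_dominated_convergence[where w = "\<lambda>x. 2 * exp (- d * x\<^sup>2)" and f = "\<lambda>_. 0"])
      (use w half_rescaled_measurable[OF adm M1] half_rescaled_bound[OF adm M1 _ assms(2)] lower_half_tendsto in auto)
  ultimately have "(\<lambda>j. (\<integral>x. half_rescaled 1 (X j) (M j) x \<partial>lborel) + (\<integral>x. half_rescaled (-1) (X j) (M j) x \<partial>lborel))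
     \<longlonglongrightarrow> (\<integral>x. exp (- (complex_of_real x)\<^sup>2 * curvature x0) * ?K \<partial>lborel) + integral\<^sup>L lborel (\<lambda>x::real. 0)"
    by (rule tendsto_add)
  also have "(\<integral>x. exp (- (complex_of_real x)\<^sup>2 * curvature x0) * ?K \<partial>lborel) + integral\<^sup>L lborel (\<lambda>x::real. 0)
    = (\<integral>x. exp (- curvature x0 * (complex_of_real x)\<^sup>2) \<partial>lborel) * ?K"
    by (simp add: mult.commute)
  finally show ?thesis unfolding half_rescaled_integral[OF adm M1] .
qed

end

lemma test_kernel_saddle_nonzero:
  assumes "admissible \<xi>"
  shows "test_kernel 0 (cnj (cayley (saddle \<xi>))) (saddle \<xi>) \<noteq> 0"
proof
  define w where "w = cayley (saddle \<xi>)"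
  assume "test_kernel 0 (cnj (cayley (saddle \<xi>))) (saddle \<xi>) = 0"
  then have "w = cnj w" using saddle_reciprocal(2)[OF assms] by (simp add: test_kernel_def w_def)
  then have "Im w = 0" by (simp add: complex_eq_iff)
  then obtain r where r: "w = of_real r" by (metis complex_is_Real_iff Reals_cases)
  have eq: "1 - saddle \<xi> = of_real r * (1 + saddle \<xi>)"
    using saddle_reciprocal(2)[OF assms] by (simp add: w_def[unfolded cayley_def] flip: r)
  from arg_cong[OF eq, of Im] have "saddle_height \<xi> * (r + 1) = 0" by (simp add: saddle_def algebra_simps)
  then have "r = -1" using admissibleD(6)[OF assms] by auto
  with eq show False by simp
qed

text \<open>
  Otherwise there are parameters \<open>\<xi>\<^sub>j\<close> and degrees \<open>m\<^sub>j \<rightarrow> \<infinity>\<close> for which the rescaled integrals tend to \<open>0\<close>. Along a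
  subsequence with \<open>\<xi>\<^sub>j\<close> convergent they tend to the nonzero limit found above.
\<close>

lemma saddle_integral_lower_uniform:
  assumes "admissible x1" "x1 \<le> x2"
  shows "\<exists>c>0. \<exists>N. \<forall>\<xi>\<in>{x1..x2}. \<forall>m\<ge>N. c \<le> sqrt m * cmod (\<integral>y. saddle_integrand \<xi> m (Complex \<xi> y) \<partial>lborel)"
proof (rule ccontr)
  let ?I = "\<lambda>\<xi> m. sqrt (real m) * cmod (\<integral>y. saddle_integrand \<xi> m (Complex \<xi> y) \<partial>lborel)"
  assume *: "\<not> ?thesis"
  have "\<exists>\<xi> m. \<xi> \<in> {x1..x2} \<and> m \<ge> Suc n \<and> ?I \<xi> m < 1 / real (Suc n)" for n
  proof (rule ccontr)
    assume "\<nexists>\<xi> m. \<xi> \<in> {x1..x2} \<and> m \<ge> Suc n \<and> ?I \<xi> m < 1 / real (Suc n)"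
    then have "\<forall>\<xi>\<in>{x1..x2}. \<forall>m\<ge>Suc n. 1 / real (Suc n) \<le> ?I \<xi> m" by (meson not_le)
    moreover have "1 / real (Suc n) > 0" by simp
    ultimately show False using * by blast
  qed
  then obtain X0 M0 where XM: "\<And>n. X0 n \<in> {x1..x2}" "\<And>n. M0 n \<ge> Suc n" "\<And>n. ?I (X0 n) (M0 n) < 1 / real (Suc n)"
    by metis
  obtain x0 r where r: "x0 \<in> {x1..x2}" "strict_mono r" "(X0 \<circ> r) \<longlonglongrightarrow> x0"
    using compact_imp_seq_compact[OF compact_Icc[of x1 x2]] XM(1) unfolding seq_compact_def by meson
  obtain d c where dc: "d > 0" "\<And>\<xi>. \<xi> \<in> {x1..x2} \<Longrightarrow> d \<le> decay \<xi>" "\<And>\<xi>. \<xi> \<in> {x1..x2} \<Longrightarrow> \<xi> + saddle_height \<xi> \<le> c"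
    using admissible_interval_bounds[OF assms] by blast
  have rn: "r n \<ge> n" for n using r(2) by (rule seq_suble)
  interpret saddle_sequence "X0 \<circ> r" "M0 \<circ> r" x0
  proof
    show "admissible ((X0 \<circ> r) j)" for j using XM(1)[of "r j"] admissible_mono[OF assms(1)] by auto
    show "admissible x0" using r(1) admissible_mono[OF assms(1)] by auto
    show "(X0 \<circ> r) \<longlonglongrightarrow> x0" by (rule r(3))
    show "1 \<le> (M0 \<circ> r) j" for j using XM(2)[of "r j"] by simp
    have "n \<le> (M0 \<circ> r) n" for n using XM(2)[of "r n"] rn[of n] by simp
    then show "filterlim (M0 \<circ> r) at_top sequentially"
      by (intro filterlim_at_top_mono[OF filterlim_ident]) auto
  qed
  have "(\<lambda>j. sqrt ((M0 \<circ> r) j) * (\<integral>y. saddle_integrand ((X0 \<circ> r) j) ((M0 \<circ> r) j) (Complex ((X0 \<circ> r) j) y) \<partial>lborel))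
    \<longlonglongrightarrow> (\<integral>x. exp (- curvature x0 * (complex_of_real x)\<^sup>2) \<partial>lborel) * test_kernel 0 (cnj (cayley (saddle x0))) (saddle x0)" (is "?S \<longlonglongrightarrow> ?L")
    by (rule rescaled_integral_tendsto[OF dc(1)]) (use dc(2) XM(1) in auto)
  moreover have "?S \<longlonglongrightarrow> 0"
  proof (rule Lim_null_comparison)
    show "\<forall>\<^sub>F j in sequentially. norm (?S j) \<le> 1 / real (Suc j)"
    proof (intro always_eventually allI)
      fix j
      have "norm (?S j) = ?I (X0 (r j)) (M0 (r j))" by (simp add: norm_mult)
      also have "\<dots> \<le> 1 / real (Suc (r j))" using XM(3) by (rule less_imp_le)
      also have "\<dots> \<le> 1 / real (Suc j)" using rn[of j] by (intro divide_left_mono) auto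
      finally show "norm (?S j) \<le> 1 / real (Suc j)" .
    qed
    show "(\<lambda>j. 1 / real (Suc j)) \<longlonglongrightarrow> 0" by real_asymp
  qed
  ultimately have "?L = 0" by (rule LIMSEQ_unique)
  then show False
    using complex_gaussian_integral_nonzero[OF curvature_pos[OF adm0]] test_kernel_saddle_nonzero[OF adm0] by simp
qed

lemma rat_error_lower_large:
  assumes "admissible x1" "x1 \<le> x2" "t > 0"
  shows "\<exists>c>0. \<exists>N. \<forall>\<xi>\<in>{x1..x2}. \<forall>m\<ge>N. m \<ge> 1 \<longrightarrow> c * level \<xi> ^ m / sqrt m \<le> rat_error m t (q_pole t (alpha_of \<xi>) m)"
proof -
  obtain c N where cN: "c > 0" "\<And>\<xi> m. \<xi> \<in> {x1..x2} \<Longrightarrow> m \<ge> N \<Longrightarrow> c \<le> sqrt m * cmod (\<integral>y. saddle_integrand \<xi> m (Complex \<xi> y) \<partial>lborel)"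
    using saddle_integral_lower_uniform[OF assms(1,2)] by blast
  have "c / (2 * pi) * level \<xi> ^ m / sqrt m \<le> rat_error m t (q_pole t (alpha_of \<xi>) m)"
    if xi: "\<xi> \<in> {x1..x2}" and m: "m \<ge> N" "m \<ge> 1" for \<xi> m
  proof -
    have adm: "admissible \<xi>" using xi admissible_mono[OF assms(1)] by auto
    note a = admissibleD[OF adm]
    define I where "I = cmod (\<integral>y. saddle_integrand \<xi> m (Complex \<xi> y) \<partial>lborel)"
    have q: "q_pole t (alpha_of \<xi>) m > 0" "alpha_of \<xi> * m = t * q_pole t (alpha_of \<xi>) m"
      using a m(2) assms(3) by (auto simp: q_pole_def)
    have "cmod (cnj (cayley (saddle \<xi>))) \<le> 1"
      using cayley_right_half_plane(1)[of "saddle \<xi>"] a by (simp add: saddle_def)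
    from rat_error_ge_test_integral[OF assms(3) q a(1) this, of m]
    have "level \<xi> ^ m * I / (2 * pi) \<le> rat_error m t (q_pole t (alpha_of \<xi>) m)"
      unfolding test_integral_normalised[OF adm] I_def .
    moreover have "c / sqrt m \<le> I"
      using cN(2)[OF xi m(1)] m(2) by (simp add: I_def divide_le_eq mult.commute)
    then have "level \<xi> ^ m * (c / sqrt m) / (2 * pi) \<le> level \<xi> ^ m * I / (2 * pi)"
      using level_pos[OF adm] pi_gt_zero by (intro divide_right_mono mult_left_mono) auto
    moreover have "c / (2 * pi) * level \<xi> ^ m / sqrt m = level \<xi> ^ m * (c / sqrt m) / (2 * pi)" by (simp add: mult_ac)
    ultimately show ?thesis by linarith
  qed
  moreover have "c / (2 * pi) > 0" using cN(1) by simp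
  ultimately show ?thesis by blast
qed

section \<open>Small degrees\<close>

lemma fwd_diff_poly:
  fixes p :: "complex poly"
  assumes "degree p \<le> k"
  shows "\<exists>r. (\<forall>x. poly p (x + h) - poly p x = poly r x) \<and> degree r \<le> k - 1 \<and> (k = 0 \<longrightarrow> r = 0)"
  using assms
proof (induction k arbitrary: p)
  case 0
  then obtain a where "p = [:a:]" by (auto elim: degree_eq_zeroE)
  then show ?case by (intro exI[of _ 0]) simp
next
  case (Suc k)
  obtain a p' where p: "p = pCons a p'" by (cases p)
  have "degree p' \<le> k" using Suc.prems by (cases "p' = 0") (auto simp: p)
  from Suc.IH[OF this] obtain r' where r': "\<And>x. poly p' (x + h) - poly p' x = poly r' x" "degree r' \<le> k - 1" "k = 0 \<longrightarrow> r' = 0" by blast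
  \<comment> \<open>\<open>(x + h) p'(x + h) - x p'(x) = x (p'(x + h) - p'(x)) + h p'(x + h)\<close>\<close>
  let ?r = "pCons 0 r' + smult h (pcompose p' [:h, 1:])"
  have "poly p (x + h) - poly p x = poly ?r x" for x
    by (simp add: p poly_pcompose add.commute flip: r'(1)) (simp add: algebra_simps)
  moreover have "degree (pCons 0 r') \<le> k" using r'(2,3) by (cases "r' = 0") auto
  moreover have "degree (smult h (pcompose p' [:h, 1:])) \<le> k"
    using degree_pcompose_le[of p' "[:h, 1:]"] \<open>degree p' \<le> k\<close> by (intro order_trans[OF degree_smult_le]) simp
  ultimately show ?case by (intro exI[of _ ?r]) (auto intro: degree_add_le)
qed

fun fwd_diff :: "nat \<Rightarrow> real \<Rightarrow> (real \<Rightarrow> complex) \<Rightarrow> real \<Rightarrow> complex" where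
  "fwd_diff 0 h f x = f x"
| "fwd_diff (Suc n) h f x = fwd_diff n h f (x + h) - fwd_diff n h f x"

lemma fwd_diff_minus: "fwd_diff n h (\<lambda>x. f x - g x) x = fwd_diff n h f x - fwd_diff n h g x"
  by (induction n arbitrary: x) simp_all

lemma fwd_diff_shift: "fwd_diff n h (\<lambda>x. f (x + h) - f x) x = fwd_diff (Suc n) h f x"
  by (induction n arbitrary: x) simp_all

lemma fwd_diff_poly_zero:
  "degree p < n \<or> p = 0 \<Longrightarrow> fwd_diff n h (\<lambda>x. poly p (of_real x)) x = 0"
proof (induction n arbitrary: p x)
  case 0
  then show ?case by simp
next
  case (Suc n)
  then have "degree p \<le> n" by auto
  from fwd_diff_poly[OF this, of "of_real h"] obtain r where
    r: "\<And>x. poly p (x + of_real h) - poly p x = poly r x" "degree r \<le> n - 1" "n = 0 \<longrightarrow> r = 0" by blast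
  have "fwd_diff (Suc n) h (\<lambda>x. poly p (of_real x)) x = fwd_diff n h (\<lambda>x. poly r (of_real x)) x"
    unfolding fwd_diff_shift[symmetric] by (simp add: r(1))
  also have "\<dots> = 0" by (rule Suc.IH) (use r in auto)
  finally show ?case .
qed

lemma norm_fwd_diff_le:
  assumes "\<And>j. j \<le> n \<Longrightarrow> cmod (f (x + of_nat j * h)) \<le> E"
  shows "cmod (fwd_diff n h f x) \<le> 2 ^ n * E"
  using assms
proof (induction n arbitrary: x)
  case (Suc n)
  have "cmod (fwd_diff n h f (x + h)) \<le> 2 ^ n * E"
    by (rule Suc.IH) (use Suc.prems[of "Suc _"] in \<open>auto simp: algebra_simps\<close>)
  moreover have "cmod (fwd_diff n h f x) \<le> 2 ^ n * E"
    by (rule Suc.IH) (use Suc.prems in auto)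
  ultimately show ?case
    using norm_triangle_ineq4[of "fwd_diff n h f (x + h)" "fwd_diff n h f x"] by simp
qed (use assms[of 0] in simp)

text \<open>
  In the alternating sum of function values the last one has coefficient \<open>1\<close>, and by monotonicity all the others
  are controlled by the last but one.
\<close>

lemma fwd_diff_dominated_by_last:
  assumes "mono_on {x0..} f" "\<And>x. x \<ge> x0 \<Longrightarrow> f x \<ge> 0" "h > 0" "x \<ge> x0"
  shows "cmod (fwd_diff (Suc n) h (\<lambda>x. of_real (f x)) x - of_real (f (x + of_nat (Suc n) * h))) \<le> (2 ^ Suc n - 1) * f (x + of_nat n * h)"
  using assms(4)
proof (induction n arbitrary: x)
  case 0
  then show ?case using assms(2)[of x] by simp
next
  case (Suc n)
  define D where "D = fwd_diff (Suc n) h (\<lambda>x. complex_of_real (f x))"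
  have nn: "f (x + of_nat n * h) \<ge> 0" "f (x + of_nat (Suc n) * h) \<ge> 0"
    using Suc.prems assms(3) by (auto intro!: assms(2) add_increasing2)
  have mono: "f (x + of_nat n * h) \<le> f (x + of_nat (Suc n) * h)"
    using Suc.prems assms(3) by (intro mono_onD[OF assms(1)]) (auto intro!: add_increasing2 mult_right_mono)
  have shift: "x + h + of_nat k * h = x + of_nat (Suc k) * h" for k by (simp add: algebra_simps)
  have "cmod (D (x + h) - of_real (f (x + of_nat (Suc (Suc n)) * h))) \<le> (2 ^ Suc n - 1) * f (x + of_nat (Suc n) * h)"
    using Suc.IH[of "x + h"] Suc.prems assms(3) unfolding shift D_def by simp
  moreover have "cmod (D x) \<le> 2 ^ Suc n * f (x + of_nat (Suc n) * h)"
  proof -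
    have "cmod (D x) \<le> cmod (of_real (f (x + of_nat (Suc n) * h)) :: complex) + cmod (D x - of_real (f (x + of_nat (Suc n) * h)))"
      by (rule norm_triangle_sub)
    also have "\<dots> \<le> f (x + of_nat (Suc n) * h) + (2 ^ Suc n - 1) * f (x + of_nat n * h)"
      using Suc.IH[OF Suc.prems] nn unfolding D_def by simp
    also have "\<dots> \<le> f (x + of_nat (Suc n) * h) + (2 ^ Suc n - 1) * f (x + of_nat (Suc n) * h)"
      using mono by (intro add_left_mono mult_left_mono) (auto simp: one_le_power simp del: power_Suc)
    finally show ?thesis by (simp add: algebra_simps)
  qed
  ultimately have "cmod (D (x + h) - of_real (f (x + of_nat (Suc (Suc n)) * h))) + cmod (D x)
      \<le> (2 ^ Suc n - 1) * f (x + of_nat (Suc n) * h) + 2 ^ Suc n * f (x + of_nat (Suc n) * h)" by (rule add_mono)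
  also have "\<dots> = (2 ^ Suc (Suc n) - 1) * f (x + of_nat (Suc n) * h)" by (simp add: algebra_simps)
  finally have *: "cmod (D (x + h) - of_real (f (x + of_nat (Suc (Suc n)) * h))) + cmod (D x) \<le> (2 ^ Suc (Suc n) - 1) * f (x + of_nat (Suc n) * h)" .
  have "fwd_diff (Suc (Suc n)) h (\<lambda>x. of_real (f x)) x - of_real (f (x + of_nat (Suc (Suc n)) * h))
     = (D (x + h) - of_real (f (x + of_nat (Suc (Suc n)) * h))) - D x" by (simp add: D_def)
  then show ?case by (simp only: order_trans[OF norm_triangle_ineq4 *])
qed

text \<open>
  In the variable \<open>y = 1 / (1 + T)\<close> the approximants are polynomials of degree at most \<open>N\<close> on \<open>(0, 1]\<close>, annihilated by
  differences of order \<open>n = N + 1\<close>, and the function is \<open>f(y) = exp (- s (1 / y - 1))\<close>. On the nodes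
  \<open>h, 2 h, \<dots>, (n + 1) h\<close> with small \<open>h\<close> the last value of \<open>f\<close> is at least \<open>2^(n + 1)\<close> times the preceding one, so the difference of \<open>f\<close> is at least half its last value, whereas the difference of the error is at
  most \<open>2^n\<close> times its maximum.
\<close>

lemma rat_error_lower_small:
  assumes "0 < s1" "s1 \<le> s2" "t > 0"
  shows "\<exists>e>0. \<forall>m\<le>N. \<forall>q>0. s1 \<le> t * q \<longrightarrow> t * q \<le> s2 \<longrightarrow> e \<le> rat_error m t q"
proof -
  define n where "n = Suc N"
  \<comment> \<open>\<open>h K \<le> s1\<close> is what makes consecutive last values of \<open>f\<close> differ by the factor \<open>2^(n + 1)\<close>.\<close>
  define K where "K = real n * (real n + 1) * (real n + 1) * ln 2"
  define h where "h = min (1 / (n + 1)) (s1 / K)"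
  have n: "n \<ge> 1" by (simp add: n_def)
  have K: "K > 0" unfolding K_def using n by (intro mult_pos_pos) auto
  have h: "h > 0" "h * (n + 1) \<le> 1" "h * K \<le> s1"
  proof -
    show "h > 0" using assms(1) K by (simp add: h_def)
    have "h \<le> 1 / (n + 1)" by (simp add: h_def)
    then show "h * (n + 1) \<le> 1" by (simp add: field_simps)
    have "h \<le> s1 / K" by (simp add: h_def)
    then show "h * K \<le> s1" using K by (simp add: field_simps)
  qed
  define e where "e = exp (- s2 * (1 / (h * (n + 1)) - 1)) / 2 ^ (n + 1)"
  have "e \<le> rat_error m t q" if m: "m \<le> N" and q: "q > 0" "s1 \<le> t * q" "t * q \<le> s2" for m q
  proof (rule rat_error_ge[OF q(1) assms(3)])
    fix P E assume P: "degree P \<le> m"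
      and E: "\<And>x. x \<le> 0 \<Longrightarrow> cmod (exp (of_real (t * x)) - poly P (of_real x) / (of_real q - of_real x) ^ m) \<le> E"
    define s where "s = t * q"
    have s: "s1 \<le> s" "s \<le> s2" "s > 0" using q assms(1) by (auto simp: s_def)
    define f where "f = (\<lambda>y::real. exp (- s * (1 / y - 1)))"
    define p where "p = (\<Sum>i\<le>m. smult (coeff P i * of_real q ^ i / of_real q ^ m) ([:-1, 1:] ^ i * monom 1 (m - i)))"
    have dp: "degree p < n"
    proof -
      have "degree (smult (coeff P i * of_real q ^ i / of_real q ^ m) ([:-1, 1:] ^ i * monom 1 (m - i))) \<le> m" if "i \<le> m" for i
      proof -
        have "degree ([:-1, 1::complex:] ^ i * monom 1 (m - i)) \<le> degree ([:-1, 1::complex:] ^ i) + degree (monom (1::complex) (m - i))"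
          by (rule degree_mult_le)
        also have "\<dots> \<le> i + (m - i)"
          using degree_power_le[of "[:-1, 1::complex:]" i] by (intro add_mono degree_monom_le) simp
        finally show ?thesis using that by (intro order_trans[OF degree_smult_le]) simp
      qed
      then have "degree p \<le> m" unfolding p_def by (intro degree_sum_le) auto
      then show ?thesis using m by (simp add: n_def)
    qed
    have err: "cmod (of_real (f y) - poly p (of_real y)) \<le> E" if y: "0 < y" "y \<le> 1" for y :: real
    proof -
      define x where "x = q * (1 - 1 / y)"
      have x: "x \<le> 0" using y q(1) by (auto simp: x_def mult_le_0_iff)
      have cy: "complex_of_real y \<noteq> 0" and cq: "complex_of_real q \<noteq> 0" using y q(1) by auto
      have fx: "exp (of_real (t * x)) = complex_of_real (f y)"
        unfolding f_def exp_of_real[symmetric] by (rule arg_cong[where f=exp], rule arg_cong[where f=of_real]) (simp add: x_def s_def algebra_simps)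
      have cx: "complex_of_real x = of_real q * (of_real y - 1) / of_real y" using cy by (simp add: x_def field_simps)
      have dn: "of_real q - complex_of_real x = of_real q / of_real y" unfolding cx using cy by (simp add: field_simps)
      have "poly P (of_real x) = (\<Sum>i\<le>m. coeff P i * of_real x ^ i)"
        unfolding poly_altdef using P by (intro sum.mono_neutral_left) (auto simp: coeff_eq_0)
      then have "poly P (of_real x) / (of_real q - of_real x) ^ m = (\<Sum>i\<le>m. coeff P i * (of_real q * (of_real y - 1) / of_real y) ^ i / (of_real q / of_real y) ^ m)"
        unfolding dn unfolding cx by (simp add: sum_divide_distrib)
      also have "\<dots> = poly p (of_real y)"
        unfolding p_def poly_sum
      proof (rule sum.cong[OF refl])
        fix i assume "i \<in> {..m}"
        then obtain j where j: "m = i + j" by (auto simp: le_iff_add)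
        show "coeff P i * (of_real q * (of_real y - 1) / of_real y) ^ i / (of_real q / of_real y) ^ m =
          poly (smult (coeff P i * of_real q ^ i / of_real q ^ m) ([:-1, 1:] ^ i * monom 1 (m - i))) (of_real y)"
          using cy cq by (simp add: j poly_monom power_divide power_mult_distrib power_add)
      qed
      finally show ?thesis using E[OF x] unfolding fx by simp
    qed
    have "E \<ge> 0" by (rule order_trans[OF norm_ge_zero E[of 0]]) simp
    have node: "0 < h + real j * h" "h + real j * h \<le> 1" if "j \<le> n" for j
    proof -
      show "0 < h + real j * h" using h(1) by (intro add_pos_nonneg) auto
      have "real j * h \<le> real n * h" using that h(1) by (intro mult_right_mono) auto
      then show "h + real j * h \<le> 1" using h(2) by (simp add: algebra_simps)
    qed
    let ?D = "fwd_diff n h (\<lambda>y. complex_of_real (f y)) h"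
    have "?D = fwd_diff n h (\<lambda>y. complex_of_real (f y) - poly p (of_real y)) h"
      unfolding fwd_diff_minus using fwd_diff_poly_zero[of p n h h] dp by simp
    moreover have "cmod (fwd_diff n h (\<lambda>y. complex_of_real (f y) - poly p (of_real y)) h) \<le> 2 ^ n * E"
      by (rule norm_fwd_diff_le) (rule err[OF node])
    ultimately have "cmod ?D \<le> 2 ^ n * E" by (simp only:)
    moreover have "f (h + real n * h) - 2 ^ n * f (h + real N * h) \<le> cmod ?D"
    proof -
      have "cmod (?D - of_real (f (h + real n * h))) \<le> (2 ^ n - 1) * f (h + real N * h)"
        unfolding n_def
      proof (rule fwd_diff_dominated_by_last)
        show "mono_on {h..} f"
        proof (rule mono_onI)
          fix r u assume ru: "r \<in> {h..}" "u \<in> {h..}" "r \<le> u"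
          then have "1 / u \<le> 1 / r" using h(1) by (intro divide_left_mono mult_pos_pos) auto
          then show "f r \<le> f u" using s(3) by (simp add: f_def)
        qed
      qed (use h(1) in \<open>auto simp: f_def\<close>)
      also have "\<dots> \<le> 2 ^ n * f (h + real N * h)" by (intro mult_right_mono) (auto simp: f_def)
      finally have "cmod (?D - of_real (f (h + real n * h))) \<le> 2 ^ n * f (h + real N * h)" .
      moreover have "f (h + real n * h) \<le> cmod ?D + cmod (?D - of_real (f (h + real n * h)))"
        using norm_triangle_sub[of "complex_of_real (f (h + real n * h))" ?D] by (simp add: norm_minus_commute f_def)
      ultimately show ?thesis by simp
    qed
    moreover have "2 ^ (n + 1) * f (h + real N * h) \<le> f (h + real n * h)"
    proof -
      define u where "u = h * (n + 1)"
      have nodes: "h + real n * h = u" "h + real N * h = h * n" by (simp_all add: u_def n_def algebra_simps)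
      have u0: "u > 0" "h * n > 0" using h(1) n by (auto simp: u_def)
      have d: "1 / (h * n) - 1 / u = 1 / (h * (n * (n + 1)))"
      proof -
        have "1 / (p * r) - 1 / (p * (r + 1)) = 1 / (p * (r * (r + 1)))" if "p > 0" "r > 0" for p r :: real
          using that by (simp add: divide_simps)
        from this[OF h(1), of n] n show ?thesis by (simp add: u_def algebra_simps)
      qed
      have "(n + 1) * ln 2 \<le> s / (h * (n * (n + 1)))"
      proof -
        have "((n + 1) * ln 2) * (h * (n * (n + 1))) = h * K" by (simp add: K_def algebra_simps)
        also have "\<dots> \<le> s" using h(3) s by linarith
        finally have "((n + 1) * ln 2) * (h * (n * (n + 1))) \<le> s" .
        moreover have "0 < h * (n * (n + 1))" using h(1) n by (simp add: add_pos_nonneg)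
        ultimately show ?thesis by (simp only: pos_le_divide_eq)
      qed
      also have "\<dots> = s * (1 / (h * n) - 1 / u)" unfolding d by simp
      finally have "(n + 1) * ln 2 + (- s * (1 / (h * n) - 1)) \<le> - s * (1 / u - 1)" by (simp add: algebra_simps)
      then have "exp ((n + 1) * ln 2 + (- s * (1 / (h * n) - 1))) \<le> exp (- s * (1 / u - 1))" by (simp only: exp_le_cancel_iff)
      moreover have "exp (real (n + 1) * ln 2) = 2 ^ (n + 1)" by (subst exp_of_nat_mult) simp
      ultimately show ?thesis unfolding nodes f_def exp_add by (simp add: mult_ac)
    qed
    ultimately have "f (h + real n * h) \<le> 2 ^ (n + 1) * E" by (simp add: field_simps)
    moreover have "exp (- s2 * (1 / (h * (n + 1)) - 1)) \<le> f (h + real n * h)"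
    proof -
      have "h + real n * h = h * (n + 1)" by (simp add: algebra_simps)
      moreover have "0 \<le> 1 / (h * (n + 1)) - 1" using h(1,2) by (simp add: pos_le_divide_eq)
      then have "s * (1 / (h * (n + 1)) - 1) \<le> s2 * (1 / (h * (n + 1)) - 1)" using s by (intro mult_right_mono) auto
      ultimately show ?thesis by (simp add: f_def)
    qed
    ultimately show "e \<le> E" by (simp add: e_def field_simps)
  qed
  moreover have "e > 0" by (simp add: e_def)
  ultimately show ?thesis by blast
qed

section \<open>The order of the error and the least degree\<close>

text \<open>
  For the finitely many \<open>m\<close> below the threshold of the asymptotic lower bound, a positive constant is enough,
  because the level is less than \<open>1\<close>.
\<close>

lemma rat_error_two_sided:
  assumes "0 < a" "a \<le> b" "b < alpha_c" "t > 0"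
  obtains c C k1 k2 where "c > 0" "C > 0" "0 < k1"
    "\<And>\<alpha>. \<alpha> \<in> {a..b} \<Longrightarrow> k1 \<le> kappa \<alpha> \<and> kappa \<alpha> \<le> k2"
    "\<And>\<alpha> m. \<alpha> \<in> {a..b} \<Longrightarrow> m \<ge> 1 \<Longrightarrow> c * exp (- kappa \<alpha> * m) / sqrt m \<le> rat_error m t (q_pole t \<alpha> m)"
    "\<And>\<alpha> m. \<alpha> \<in> {a..b} \<Longrightarrow> m \<ge> 1 \<Longrightarrow> rat_error m t (q_pole t \<alpha> m) \<le> C * exp (- kappa \<alpha> * m) / sqrt m"
proof -
  obtain x1 x2 where x: "admissible x1" "x1 \<le> x2" "{a..b} \<subseteq> alpha_of ` {x1..x2}"
    using alpha_range_parametrised[OF assms(1-3)] by blast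
  have adm: "admissible \<xi>" if "\<xi> \<in> {x1..x2}" for \<xi> using that admissible_mono[OF x(1)] by auto
  have kap: "kappa (alpha_of \<xi>) = - ln (level \<xi>)" if "\<xi> \<in> {x1..x2}" for \<xi>
    by (simp add: kappa_def H_e_alpha_of[OF adm[OF that]])
  have lev: "exp (- kappa (alpha_of \<xi>) * real m) = level \<xi> ^ m" if "\<xi> \<in> {x1..x2}" for \<xi> m
  proof -
    have "exp (- kappa (alpha_of \<xi>) * real m) = exp (real m * ln (level \<xi>))" by (simp add: kap[OF that] mult.commute)
    also have "\<dots> = level \<xi> ^ m" using level_pos[OF adm[OF that]] by (simp add: exp_of_nat_mult)
    finally show ?thesis .
  qed
  obtain C where C: "C > 0" "\<And>\<xi> m. \<xi> \<in> {x1..x2} \<Longrightarrow> m \<ge> 1 \<Longrightarrow> rat_error m t (q_pole t (alpha_of \<xi>) m) \<le> C * level \<xi> ^ m / sqrt m"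
    using rat_error_upper_uniform[OF x(1,2) assms(4)] by blast
  obtain c1 N where c1: "c1 > 0" "\<And>\<xi> m. \<xi> \<in> {x1..x2} \<Longrightarrow> m \<ge> N \<Longrightarrow> m \<ge> 1 \<Longrightarrow> c1 * level \<xi> ^ m / sqrt m \<le> rat_error m t (q_pole t (alpha_of \<xi>) m)"
    using rat_error_lower_large[OF x(1,2) assms(4)] by blast
  have "a \<le> b * Suc N" using assms(1,2) by (simp add: algebra_simps add_increasing2)
  from rat_error_lower_small[OF assms(1) this assms(4), of N]
  obtain e where e: "e > 0" "\<And>m q. m \<le> N \<Longrightarrow> q > 0 \<Longrightarrow> a \<le> t * q \<Longrightarrow> t * q \<le> b * Suc N \<Longrightarrow> e \<le> rat_error m t q"
    by blast
  define c where "c = min c1 e"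
  have c: "c > 0" "c \<le> c1" "c \<le> e" using c1(1) e(1) by (auto simp: c_def)
  have low: "c * exp (- kappa \<alpha> * m) / sqrt m \<le> rat_error m t (q_pole t \<alpha> m)" if \<alpha>: "\<alpha> \<in> {a..b}" and m: "m \<ge> 1" for \<alpha> m
  proof -
    obtain \<xi> where xi: "\<xi> \<in> {x1..x2}" "\<alpha> = alpha_of \<xi>" using x(3) \<alpha> by blast
    have l: "0 \<le> level \<xi> ^ m" "level \<xi> ^ m \<le> 1"
      using level_pos[OF adm[OF xi(1)]] level_less_1[OF adm[OF xi(1)]] by (auto intro: power_le_one)
    show ?thesis
    proof (cases "m \<ge> N")
      case True
      have "c * level \<xi> ^ m / sqrt m \<le> c1 * level \<xi> ^ m / sqrt m"
        using c(2) l by (intro divide_right_mono mult_right_mono) auto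
      also have "\<dots> \<le> rat_error m t (q_pole t \<alpha> m)" using c1(2)[OF xi(1) True m] xi(2) by simp
      finally show ?thesis by (simp only: xi(2) lev[OF xi(1)])
    next
      case False
      have sq: "1 \<le> sqrt m" using m by simp
      have "c * level \<xi> ^ m / sqrt m \<le> c * 1 / 1"
        using c(1) l sq by (intro frac_le mult_left_mono) auto
      also have "\<dots> \<le> e" using c(3) by simp
      also have "\<dots> \<le> rat_error m t (q_pole t \<alpha> m)"
      proof (rule e(2))
        have tq: "t * q_pole t \<alpha> m = \<alpha> * m" using assms(4) by (simp add: q_pole_def)
        show "m \<le> N" using False by simp
        show "0 < q_pole t \<alpha> m" using \<alpha> assms m by (simp add: q_pole_def)
        have "a * 1 \<le> \<alpha> * m" using \<alpha> assms m by (intro mult_mono) auto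
        then show "a \<le> t * q_pole t \<alpha> m" by (simp add: tq)
        show "t * q_pole t \<alpha> m \<le> b * Suc N" unfolding tq using \<alpha> assms False by (intro mult_mono) auto
      qed
      finally show ?thesis by (simp only: xi(2) lev[OF xi(1)])
    qed
  qed
  have up: "rat_error m t (q_pole t \<alpha> m) \<le> C * exp (- kappa \<alpha> * m) / sqrt m" if \<alpha>: "\<alpha> \<in> {a..b}" and m: "m \<ge> 1" for \<alpha> m
  proof -
    obtain \<xi> where xi: "\<xi> \<in> {x1..x2}" "\<alpha> = alpha_of \<xi>" using x(3) \<alpha> by blast
    show ?thesis unfolding xi(2) lev[OF xi(1)] by (rule C(2)[OF xi(1) m])
  qed
  have sub: "{x1..x2} \<subseteq> {x. admissible x}" using adm by auto
  have ne: "{x1..x2} \<noteq> {}" using x(2) by simp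
  have cont: "continuous_on {x1..x2} (\<lambda>x. - ln (level x))"
    using level_pos adm by (intro continuous_intros continuous_on_subset[OF continuous_on_saddle_data(4) sub]) force
  obtain u where u: "u \<in> {x1..x2}" "\<And>\<xi>. \<xi> \<in> {x1..x2} \<Longrightarrow> - ln (level u) \<le> - ln (level \<xi>)"
    using continuous_attains_inf[OF compact_Icc ne cont] by blast
  obtain w where w: "\<And>\<xi>. \<xi> \<in> {x1..x2} \<Longrightarrow> - ln (level \<xi>) \<le> - ln (level w)"
    using continuous_attains_sup[OF compact_Icc ne cont] by blast
  have "- ln (level u) > 0" using level_pos[OF adm[OF u(1)]] level_less_1[OF adm[OF u(1)]] by simp
  moreover have "- ln (level u) \<le> kappa \<alpha> \<and> kappa \<alpha> \<le> - ln (level w)" if \<alpha>: "\<alpha> \<in> {a..b}" for \<alpha>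
  proof -
    obtain \<xi> where xi: "\<xi> \<in> {x1..x2}" "\<alpha> = alpha_of \<xi>" using x(3) \<alpha> by blast
    show ?thesis unfolding xi(2) kap[OF xi(1)] using u(2)[OF xi(1)] w[OF xi(1)] by blast
  qed
  ultimately show ?thesis using that[OF c(1) C(1) _ _ low up] by blast
qed

text \<open>
  Write \<open>L = ln (1 / \<epsilon>)\<close> and \<open>m* = L / \<kappa> - ln L / (2 \<kappa>)\<close>. The hypotheses say \<open>- ln E(m) = \<kappa> m + ln m / 2 + O(1)\<close>, and
  \<open>\<kappa> m* + ln m* / 2 = L + O(1)\<close> because \<open>L / (2 \<kappa>) \<le> m* \<le> L / \<kappa>\<close>. Moving \<open>m\<close> by a constant away from \<open>m*\<close> changes the left
  side by more than the error term. Each of the bounds uses one side of the hypotheses, and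
  \<open>E\<close> need not be monotone.
\<close>

lemma least_below_tolerance:
  fixes E :: "nat \<Rightarrow> real" and c C k1 k2 \<kappa> \<epsilon> :: real
  assumes "c > 0" "C > 0" "0 < k1" "k1 \<le> \<kappa>" "\<kappa> \<le> k2"
    and low: "\<And>m. m \<ge> 1 \<Longrightarrow> c * exp (- \<kappa> * m) / sqrt m \<le> E m"
    and up: "\<And>m. m \<ge> 1 \<Longrightarrow> E m \<le> C * exp (- \<kappa> * m) / sqrt m"
    and \<epsilon>: "0 < \<epsilon>" "\<epsilon> \<le> exp (- 1)"
  shows "\<bar>real (LEAST m. m \<ge> 1 \<and> E m \<le> \<epsilon>) - (ln (1 / \<epsilon>) / \<kappa> - ln (ln (1 / \<epsilon>)) / (2 * \<kappa>))\<bar>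
    \<le> (\<bar>ln C\<bar> + \<bar>ln (2 * k2)\<bar> / 2) / k1 + 1 + (\<bar>ln c\<bar> + \<bar>ln k1\<bar> / 2) / k1"
proof -
  define L where "L = ln (1 / \<epsilon>)"
  \<comment> \<open>\<open>\<kappa> D1\<close> dominates \<open>ln C + ln (2 \<kappa>) / 2\<close>, and \<open>\<kappa> D2\<close> dominates \<open>- ln c - ln \<kappa> / 2\<close>.\<close>
  define D1 D2 where "D1 = (\<bar>ln C\<bar> + \<bar>ln (2 * k2)\<bar> / 2) / k1" and "D2 = (\<bar>ln c\<bar> + \<bar>ln k1\<bar> / 2) / k1"
  define ms where "ms = L / \<kappa> - ln L / (2 * \<kappa>)"
  define M where "M = (LEAST m. m \<ge> 1 \<and> E m \<le> \<epsilon>)"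
  have k: "\<kappa> > 0" using assms by simp
  have "ln \<epsilon> \<le> ln (exp (- 1))" using \<epsilon> by (subst ln_le_cancel_iff) auto
  then have L: "L \<ge> 1" "ln \<epsilon> = - L" using \<epsilon> by (simp_all add: L_def ln_div)
  have lnL: "0 \<le> ln L" "ln L \<le> L" using L ln_le_minus_one[of L] by auto
  have kms: "\<kappa> * ms = L - ln L / 2" using k by (simp add: ms_def field_simps)
  have ms: "L / (2 * \<kappa>) \<le> ms" "ms \<le> L / \<kappa>"
    using lnL k by (simp_all add: ms_def field_simps)
  have D: "D1 \<ge> 0" "D2 \<ge> 0" using assms(3) by (simp_all add: D1_def D2_def)
  have kD1: "\<kappa> * D1 \<ge> \<bar>ln C\<bar> + \<bar>ln (2 * k2)\<bar> / 2" and kD2: "\<kappa> * D2 \<ge> \<bar>ln c\<bar> + \<bar>ln k1\<bar> / 2"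
    using mult_right_mono[OF assms(4) D(1)] mult_right_mono[OF assms(4) D(2)] assms(3) by (simp_all add: D1_def D2_def)
  define m where "m = nat \<lceil>ms + D1\<rceil>"
  have pos: "L / (2 * \<kappa>) > 0" using L(1) k by simp
  have m: "ms + D1 \<le> real m" "real m \<le> ms + D1 + 1"
    using pos ms(1) D(1) by (simp_all add: m_def)
  have m1: "m \<ge> 1" using m(1) pos ms(1) D(1) by (cases m) auto
  have Em: "E m \<le> \<epsilon>"
  proof -
    have lm: "ln L - ln (2 * \<kappa>) \<le> ln m"
    proof -
      have "ln (L / (2 * \<kappa>)) \<le> ln m" using pos ms(1) m(1) D(1) m1 by (subst ln_le_cancel_iff) auto
      then show ?thesis using L(1) k by (simp add: ln_div)
    qed
    have "ln (2 * \<kappa>) \<le> ln (2 * k2)" using k assms(5) by (subst ln_le_cancel_iff) auto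
    moreover have "\<kappa> * (ms + D1) \<le> \<kappa> * m" using m(1) k by (intro mult_left_mono) auto
    then have "L - ln L / 2 + \<kappa> * D1 \<le> \<kappa> * m" unfolding distrib_left kms .
    ultimately have "ln C - \<kappa> * m - ln m / 2 \<le> - L"
      using lm kD1 abs_ge_self[of "ln C"] abs_ge_self[of "ln (2 * k2)"] by linarith
    moreover have "ln (C * exp (- \<kappa> * m) / sqrt m) = ln C - \<kappa> * m - ln m / 2"
      using assms(2) m1 by (simp add: ln_mult ln_div ln_sqrt)
    ultimately have "ln (C * exp (- \<kappa> * m) / sqrt m) \<le> ln \<epsilon>" using L(2) by simp
    then have "C * exp (- \<kappa> * m) / sqrt m \<le> \<epsilon>"
      using assms(2) m1 \<epsilon>(1) by (subst (asm) ln_le_cancel_iff) auto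
    then show ?thesis using up[OF m1] by linarith
  qed
  then have "M \<le> m" unfolding M_def using m1 by (intro Least_le) auto
  then have upper: "M \<le> ms + D1 + 1" using m(2) by linarith
  have "M \<ge> 1 \<and> E M \<le> \<epsilon>" unfolding M_def by (rule LeastI[of _ m]) (use m1 Em in auto)
  then have M: "M \<ge> 1" "c * exp (- \<kappa> * M) / sqrt M \<le> \<epsilon>" using low[of M] by auto
  have "ln (c * exp (- \<kappa> * M) / sqrt M) \<le> ln \<epsilon>"
    using M assms(1) \<epsilon>(1) by (subst ln_le_cancel_iff) auto
  moreover have "ln (c * exp (- \<kappa> * M) / sqrt M) = ln c - \<kappa> * M - ln M / 2"
    using assms(1) M(1) by (simp add: ln_mult ln_div ln_sqrt)
  ultimately have key: "L + ln c \<le> \<kappa> * M + ln M / 2" using L(2) by linarith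
  have lower: "ms - D2 \<le> M"
  proof (rule ccontr)
    assume "\<not> ms - D2 \<le> M"
    then have lt: "M < ms - D2" by simp
    then have "\<kappa> * M < \<kappa> * (ms - D2)" using k by simp
    then have "\<kappa> * M < L - ln L / 2 - \<kappa> * D2" unfolding right_diff_distrib kms .
    moreover have "ln M \<le> ln (L / \<kappa>)" using lt ms(2) D(2) M(1) by (subst ln_le_cancel_iff) auto
    then have "ln M \<le> ln L - ln \<kappa>" using L(1) k by (simp add: ln_div)
    moreover have "ln k1 \<le> ln \<kappa>" using assms(3,4) by (subst ln_le_cancel_iff) auto
    ultimately show False
      using key kD2 abs_ge_minus_self[of "ln c"] abs_ge_minus_self[of "ln k1"] by linarith
  qed
  have "\<bar>real M - ms\<bar> \<le> D1 + 1 + D2" using upper lower D by linarith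
  then show ?thesis by (simp only: M_def ms_def L_def D1_def D2_def)
qed

theorem theorem6p1:
  fixes t a b :: real
  assumes "t > 0" and "0 < a" and "a \<le> b" and "b < alpha_c"
  shows "(\<exists>C. \<forall>\<^sub>F \<epsilon> in at_right 0. \<forall>\<alpha>\<in>{a..b}.
            \<bar>real (m_min t \<alpha> \<epsilon>)
              - (ln (1 / \<epsilon>) / kappa \<alpha> - ln (ln (1 / \<epsilon>)) / (2 * kappa \<alpha>))\<bar> \<le> C)
       \<and> (\<forall>\<alpha>\<in>{a..b}.
            ((\<lambda>\<epsilon>. real (m_min t \<alpha> \<epsilon>) / ln (1 / \<epsilon>)) \<longlongrightarrow> 1 / kappa \<alpha>) (at_right 0))"
proof -
  obtain c C k1 k2 where *: "c > 0" "C > 0" "0 < k1"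
    "\<And>\<alpha>. \<alpha> \<in> {a..b} \<Longrightarrow> k1 \<le> kappa \<alpha> \<and> kappa \<alpha> \<le> k2"
    "\<And>\<alpha> m. \<alpha> \<in> {a..b} \<Longrightarrow> m \<ge> 1 \<Longrightarrow> c * exp (- kappa \<alpha> * m) / sqrt m \<le> rat_error m t (q_pole t \<alpha> m)"
    "\<And>\<alpha> m. \<alpha> \<in> {a..b} \<Longrightarrow> m \<ge> 1 \<Longrightarrow> rat_error m t (q_pole t \<alpha> m) \<le> C * exp (- kappa \<alpha> * m) / sqrt m"
    using rat_error_two_sided[OF assms(2-4,1)] by blast
  define D where "D = (\<bar>ln C\<bar> + \<bar>ln (2 * k2)\<bar> / 2) / k1 + 1 + (\<bar>ln c\<bar> + \<bar>ln k1\<bar> / 2) / k1"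
  have bound: "\<bar>real (m_min t \<alpha> \<epsilon>) - (ln (1 / \<epsilon>) / kappa \<alpha> - ln (ln (1 / \<epsilon>)) / (2 * kappa \<alpha>))\<bar> \<le> D"
    if "\<alpha> \<in> {a..b}" "0 < \<epsilon>" "\<epsilon> \<le> exp (- 1)" for \<alpha> \<epsilon>
    unfolding m_min_def D_def
    by (rule least_below_tolerance[OF *(1-3) _ _ *(5)[OF that(1)] *(6)[OF that(1)] that(2,3)])
      (use *(4)[OF that(1)] in auto)
  have small: "\<forall>\<^sub>F \<epsilon> in at_right 0. 0 < \<epsilon> \<and> \<epsilon> \<le> exp (- 1 :: real)"
    by (rule eventually_at_rightI[of _ "exp (- 1)"]) auto
  have "((\<lambda>\<epsilon>. real (m_min t \<alpha> \<epsilon>) / ln (1 / \<epsilon>)) \<longlongrightarrow> 1 / kappa \<alpha>) (at_right 0)"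
    if \<alpha>: "\<alpha> \<in> {a..b}" for \<alpha>
  proof -
    have k: "kappa \<alpha> > 0" using *(3) *(4)[OF \<alpha>] by linarith
    have "((\<lambda>\<epsilon>. real (m_min t \<alpha> \<epsilon>) / ln (1 / \<epsilon>) - 1 / kappa \<alpha>) \<longlongrightarrow> 0) (at_right 0)"
    proof (rule Lim_null_comparison)
      show "\<forall>\<^sub>F \<epsilon> in at_right 0. norm (real (m_min t \<alpha> \<epsilon>) / ln (1 / \<epsilon>) - 1 / kappa \<alpha>)
          \<le> D / ln (1 / \<epsilon>) + ln (ln (1 / \<epsilon>)) / (2 * kappa \<alpha>) / ln (1 / \<epsilon>)"
        using small
      proof eventually_elim
        case (elim \<epsilon>)
        define L where "L = ln (1 / \<epsilon>)"
        have "ln \<epsilon> \<le> ln (exp (- 1))" using elim by (subst ln_le_cancel_iff) auto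
        then have L: "L \<ge> 1" using elim by (simp add: L_def ln_div)
        have "0 \<le> ln L / (2 * kappa \<alpha>)" using L k by simp
        then have "\<bar>real (m_min t \<alpha> \<epsilon>) - L / kappa \<alpha>\<bar> \<le> D + ln L / (2 * kappa \<alpha>)"
          using bound[OF \<alpha>, of \<epsilon>] elim unfolding L_def[symmetric] by linarith
        then have "\<bar>real (m_min t \<alpha> \<epsilon>) - L / kappa \<alpha>\<bar> / L \<le> (D + ln L / (2 * kappa \<alpha>)) / L"
          using L by (intro divide_right_mono) auto
        moreover have "real (m_min t \<alpha> \<epsilon>) / L - 1 / kappa \<alpha> = (real (m_min t \<alpha> \<epsilon>) - L / kappa \<alpha>) / L"
          using L by (simp add: diff_divide_distrib)
        ultimately show ?case unfolding L_def[symmetric] using L by (simp add: abs_divide add_divide_distrib)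
      qed
      show "((\<lambda>\<epsilon>. D / ln (1 / \<epsilon>) + ln (ln (1 / \<epsilon>)) / (2 * kappa \<alpha>) / ln (1 / \<epsilon>)) \<longlongrightarrow> 0) (at_right 0)"
      proof -
        have "((\<lambda>\<epsilon>::real. 1 / ln (1 / \<epsilon>)) \<longlongrightarrow> 0) (at_right 0)"
          "((\<lambda>\<epsilon>::real. ln (ln (1 / \<epsilon>)) / ln (1 / \<epsilon>)) \<longlongrightarrow> 0) (at_right 0)"
          by real_asymp+
        from tendsto_add[OF tendsto_mult_left[OF this(1), of D] tendsto_mult_left[OF this(2), of "1 / (2 * kappa \<alpha>)"]]
        show ?thesis by (simp add: mult_ac)
      qed
    qed
    then show ?thesis by (rule Lim_null[THEN iffD2])
  qed
  moreover have "\<forall>\<^sub>F \<epsilon> in at_right 0. \<forall>\<alpha>\<in>{a..b}.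
      \<bar>real (m_min t \<alpha> \<epsilon>) - (ln (1 / \<epsilon>) / kappa \<alpha> - ln (ln (1 / \<epsilon>)) / (2 * kappa \<alpha>))\<bar> \<le> D"
    using small by eventually_elim (use bound in auto)
  ultimately show ?thesis by blast
qed

end
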